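(* In the setting of the context (i.i.d. right-censored observations with censoring independent of $Z$), let $\varepsilon>0$. Then, for all $j,k\in\mathcal{J}$ with $j\ne k$, $$\sup_{0\le t\le\theta}\big|\hat{\Lambda}^{\rho,\varepsilon}_{jk}(t)-\Lambda^{\rho,\varepsilon}_{jk}(t)\big|\xrightarrow{\text{a.s.}}0,\qquad n\to\infty,$$ and for all $j\in\mathcal{J}$, $$\sup_{0\le t\le\theta}\big|\hat{p}^{\rho,\varepsilon}_{j}(t)-p^{\rho,\varepsilon}_{j}(t)\big|\xrightarrow{\text{a.s.}}0,\qquad n\to\infty.$$
   Context: Let $(\Omega,\mathcal{F},\mathbb{F},\mathbb{P})$ be a filtered probability space and $Z=(Z_t)_{t\ge0}$ a non-explosive (right-continuous, piecewise constant) jump process on a finite state space $\mathcal{J}$ with deterministic initial state $Z_0\equiv z_0$; no Markov assumption is made. For $j\neq k$ let $N_{jk}(t)=\#\{s\in(0,t]: Z_{s-}=j,\ Z_s=k\}$ and assume $\mathbb{E}[N_{jk}(t)]<\infty$ for all $t$. Assume $\mathcal{J}=\mathcal{J}_0\cup\mathcal{J}_1$ (disjoint), $z_0\in\mathcal{J}_0$, and $\mathbb{P}(Z_t\in\mathcal{J}_1,Z_s\in\mathcal{J}_0)=0$ for $t\le s$. Let $\tau=\inf\{t>0: Z_t\in\mathcal{J}_1\}$. For each $j,k$, $t\mapsto\rho(t,j,k)$ is a non-negative process, predictable with respect to the filtration $\mathbb{F}^Z$ generated by $Z$, and uniformly bounded on compacts. Put $H(t)=\rho(\tau,Z_{\tau-},Z_\tau)^{\mathbf{1}\{\tau\le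 t\}}$. Standing assumption: $\int_0^t \frac{1}{\mathbb{E}[H(s-)\mathbf 1\{Z_{s-}=j\}]}\,\mathrm{d}\mathbb{E}[\int_0^s H(u)N_{jk}(\mathrm{d}u)]<\infty$ and the same with $H\equiv1$, for all $t$ and $j\ne k$ (with $0/0=0$). Censoring: $R$ is a strictly positive random variable independent of $Z$, and $\theta$ is fixed strictly below the right endpoint of the support of $R$. Targets: for $j\ne k$, $$p^{\rho,c}_j(t)=\mathbb{E}[H(t)\mathbf{1}\{Z_t=j\}\mathbf{1}\{t<R\}],\quad p^{\rho,c}_{jk}(t)=\mathbb{E}\Big[\int_0^tH(s)\mathbf{1}\{s\le R\}N_{jk}(\mathrm{d}s)\Big],\quad \Lambda^{\rho,\varepsilon}_{jk}(t)=\int_0^t\frac{1}{p^{\rho,c}_j(s-)\vee\varepsilon}p^{\rho,c}_{jk}(\mathrm{d}s).$$ $\Lambda^{\varepsilon}_{jk}$ denotes $\Lambda^{\rho,\varepsilon}_{jk}$ with $H\equiv1$. Diagonal: $\Lambda^{\rho,\varepsilon}_{jj}=-\sum_{k\neq j}\Lambda^\varepsilon_{jk}$ for $j\in\mathcal{J}_0$ and $\Lambda^{\rho,\varepsilon}_{jj}=-\sum_{k\neq j}\Lambda^{\rho,\varepsilon}_{jk}$ for $j\in\mathcal{J}_1$. Set $p^{\rho,\varepsilon}_j(t)=[\prod_{(0,t]}(\mathrm{Id}+\Lambda^{\rho,\varepsilon}(\mathrm{d}s))]_{z_0j}$. Estimators: let $(Z^\ell,R^\ell)_{\ell=1}^n$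 be i.i.d. copies of $(Z,R)$, with $H^\ell$, $N^\ell_{jk}$ the corresponding versions of $H$, $N_{jk}$ (only $Z^\ell$ stopped at $R^\ell$ is used). Put $$\mathbb{I}^\rho_j(t)=\frac1n\sum_{\ell=1}^nH^\ell(t)\mathbf{1}\{Z^\ell_t=j\}\mathbf{1}\{t<R^\ell\},\quad \mathbb{N}^\rho_{jk}(t)=\frac1n\sum_{\ell=1}^n\int_0^tH^\ell(s)\mathbf{1}\{s\le R^\ell\}N^\ell_{jk}(\mathrm{d}s),$$ $$\hat{\Lambda}^{\rho,\varepsilon}_{jk}(t)=\int_0^t\frac{1}{\mathbb{I}^\rho_j(s-)\vee\varepsilon}\mathbb{N}^\rho_{jk}(\mathrm{d}s)\quad(j\ne k),$$ $\hat\Lambda^{\varepsilon}_{jk}$ the same with $H^\ell\equiv1$; diagonal $\hat\Lambda^{\rho,\varepsilon}_{jj}=-\sum_{k\ne j}\hat\Lambda^{\varepsilon}_{jk}$ for $j\in\mathcal{J}_0$, $\hat\Lambda^{\rho,\varepsilon}_{jj}=-\sum_{k\ne j}\hat\Lambda^{\rho,\varepsilon}_{jk}$ for $j\in\mathcal{J}_1$; and $\hat p^{\rho,\varepsilon}_j(t)=[\prod_{(0,t]}(\mathrm{Id}+\hat\Lambda^{\rho,\varepsilon}(\mathrm{d}s))]_{z_0j}$. Integrals $\int_0^t$ are over $(0,t]$. The product integral $\prod_{(0,t]}(\mathrm{Id}+\Lambda(\mathrm{d}s))$ of a right-continuous matrix function of finite variation is the limit over refining partitions $0=s_0<\dots<s_m=t$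 of $(\mathrm{Id}+\Lambda(s_1)-\Lambda(s_0))\cdots(\mathrm{Id}+\Lambda(s_m)-\Lambda(s_{m-1}))$, equivalently the unique solution of $P(t)=\mathrm{Id}+\int_{(0,t]}P(s-)\Lambda(\mathrm{d}s)$. *)

theory Defs
  imports "HOL-Probability.Probability"
begin

text \<open>
  Processes with values in the finite state space are path-valued maps
  \<open>Z :: 'a \<Rightarrow> real \<Rightarrow> 'j\<close>. Time is \<open>[0,\<infinity>)\<close>; the values of a path at negative times are irrelevant.
\<close>

section \<open>Jump processes\<close>

definition jump_path :: "(real \<Rightarrow> 'j) \<Rightarrow> bool" where
  "jump_path z \<longleftrightarrow> (\<exists>T :: nat \<Rightarrow> real. T 0 = 0 \<and> strict_mono T \<and> filterlim T at_top sequentially \<and>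
     (\<forall>n. \<forall>s\<in>{T n..<T (Suc n)}. z s = z (T n)))"

text \<open>The left limit is taken in the discrete topology of the state space.\<close>

definition left_state :: "(real \<Rightarrow> 'j) \<Rightarrow> real \<Rightarrow> 'j" where
  "left_state z t = (THE k. \<forall>\<^sub>F s in at_left t. z s = k)"

definition jump_count :: "(real \<Rightarrow> 'j) \<Rightarrow> 'j \<Rightarrow> 'j \<Rightarrow> real \<Rightarrow> real" where
  "jump_count z j k t = real (card {s\<in>{0<..t}. left_state z s = j \<and> z s = k})"

text \<open>The infimum is \<open>\<infinity>\<close> if the set is never hit.\<close>

definition hitting_time :: "'j set \<Rightarrow> (real \<Rightarrow> 'j) \<Rightarrow> ereal" where
  "hitting_time J z = Inf (ereal ` {t. 0 < t \<and> z t \<in> J})"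

section \<open>Generated filtrations and predictability\<close>

text \<open>
  \<open>state_algebra \<Omega> Z I\<close> is the \<open>\<sigma>\<close>-algebra on \<open>\<Omega>\<close> generated by \<open>Z\<^sub>s\<close>, \<open>s \<in> I\<close>. For \<open>\<Omega> = UNIV\<close> and
  \<open>Z\<close> the coordinate process one obtains the canonical path space and its filtration.
\<close>

definition state_algebra :: "'a set \<Rightarrow> ('a \<Rightarrow> real \<Rightarrow> 'j) \<Rightarrow> real set \<Rightarrow> 'a measure" where
  "state_algebra \<Omega> Z I = sigma \<Omega> {{\<omega>\<in>\<Omega>. Z \<omega> s = k} | s k. s \<in> I}"

definition natural_filtration :: "'a set \<Rightarrow> ('a \<Rightarrow> real \<Rightarrow> 'j) \<Rightarrow> real \<Rightarrow> 'a measure" where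
  "natural_filtration \<Omega> Z t = state_algebra \<Omega> Z {0..t}"

definition path_space :: "(real \<Rightarrow> 'j) measure" where
  "path_space = state_algebra UNIV (\<lambda>z. z) {0..}"

definition predictable_algebra :: "'a set \<Rightarrow> (real \<Rightarrow> 'a measure) \<Rightarrow> (real \<times> 'a) measure" where
  "predictable_algebra \<Omega> F = sigma ({0..} \<times> \<Omega>)
     ({{0} \<times> A | A. A \<in> sets (F 0)} \<union> {{s<..t} \<times> A | s t A. 0 \<le> s \<and> s \<le> t \<and> A \<in> sets (F s)})"

definition predictable :: "'a set \<Rightarrow> (real \<Rightarrow> 'a measure) \<Rightarrow> (real \<Rightarrow> 'a \<Rightarrow> real) \<Rightarrow> bool" where
  "predictable \<Omega> F X \<longleftrightarrow> (\<lambda>(t, \<omega>). X t \<omega>) \<in> borel_measurable (predictable_algebra \<Omega> F)"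

text \<open>
  A process that is predictable with respect to the filtration generated by \<open>Z\<close> is
  \<open>(t, \<omega>) \<mapsto> g t (Z \<omega>)\<close> for a functional \<open>g\<close> that is predictable on the canonical path space. The
  version corresponding to a copy \<open>Z\<^sup>\<ell>\<close> of \<open>Z\<close> is \<open>(t, \<omega>) \<mapsto> g t (Z\<^sup>\<ell> \<omega>)\<close>. Copies are numbered from 1.
\<close>

definition corresponding_versions ::
  "'a set \<Rightarrow> ('a \<Rightarrow> real \<Rightarrow> 'j) \<Rightarrow> (real \<Rightarrow> 'j \<Rightarrow> 'j \<Rightarrow> 'a \<Rightarrow> real) \<Rightarrow>
   (nat \<Rightarrow> 'a \<Rightarrow> real \<Rightarrow> 'j) \<Rightarrow> (nat \<Rightarrow> real \<Rightarrow> 'j \<Rightarrow> 'j \<Rightarrow> 'a \<Rightarrow> real) \<Rightarrow> bool" where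
  "corresponding_versions \<Omega> Z \<rho> Zs \<rho>s \<longleftrightarrow>
     (\<exists>g :: real \<Rightarrow> 'j \<Rightarrow> 'j \<Rightarrow> (real \<Rightarrow> 'j) \<Rightarrow> real.
        (\<forall>j k. predictable UNIV (natural_filtration UNIV (\<lambda>z. z)) (\<lambda>t. g t j k)) \<and>
        (\<forall>t\<ge>0. \<forall>j k. \<forall>\<omega>\<in>\<Omega>. \<rho> t j k \<omega> = g t j k (Z \<omega>)) \<and>
        (\<forall>l\<ge>1. \<forall>t\<ge>0. \<forall>j k. \<forall>\<omega>\<in>\<Omega>. \<rho>s l t j k \<omega> = g t j k (Zs l \<omega>)))"

section \<open>The scaling process, Stieltjes integrals and product integrals\<close>

text \<open>The exponent is a natural number, so that \<open>0 ^ 0 = 1\<close>.\<close>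

definition scaling ::
  "'j set \<Rightarrow> (real \<Rightarrow> 'j \<Rightarrow> 'j \<Rightarrow> 'a \<Rightarrow> real) \<Rightarrow> ('a \<Rightarrow> real \<Rightarrow> 'j) \<Rightarrow> real \<Rightarrow> 'a \<Rightarrow> real" where
  "scaling J1 \<rho> Z t \<omega> =
     (let \<tau> = hitting_time J1 (Z \<omega>); u = real_of_ereal \<tau>
      in \<rho> u (left_state (Z \<omega>) u) (Z \<omega> u) \<omega> ^ (of_bool (\<tau> \<le> ereal t) :: nat))"

text \<open>
  \<open>\<integral>\<^sub>(\<^sub>0\<^sub>,\<^sub>t\<^sub>] f(s) G(ds)\<close> for a right-continuous and nondecreasing \<open>G\<close>. All integrators below are of
  this kind and vanish on the negative half-line.
\<close>

definition stieltjes :: "(real \<Rightarrow> real) \<Rightarrow> (real \<Rightarrow> real) \<Rightarrow> real \<Rightarrow> real" where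
  "stieltjes f G t = (LINT s:{0<..t}|interval_measure G. f s)"

fun increment_product :: "(real \<Rightarrow> real^'j^'j) \<Rightarrow> real list \<Rightarrow> real^'j^'j" where
  "increment_product L (a # b # xs) = (mat 1 + (L b - L a)) ** increment_product L (b # xs)"
| "increment_product L _ = mat 1"

text \<open>
  The limit is along the finite subsets of \<open>[0,t]\<close>, directed by inclusion, that is, along refining
  partitions; the end points are added to each finite subset.
\<close>

definition product_integral :: "(real \<Rightarrow> real^'j^'j) \<Rightarrow> real \<Rightarrow> real^'j^'j" where
  "product_integral L t = Lim (finite_subsets_at_top {0..t})
     (\<lambda>D. increment_product L (sorted_list_of_set ({0, t} \<union> D)))"

section \<open>Cumulative transition rates\<close>

definition trunc_hazard :: "real \<Rightarrow> (real \<Rightarrow> real) \<Rightarrow> (real \<Rightarrow> real) \<Rightarrow> real \<Rightarrow> real" where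
  "trunc_hazard \<epsilon> p q t = stieltjes (\<lambda>s. 1 / max (Lim (at_left s) p) \<epsilon>) q t"

text \<open>
  \<open>L\<close> are the off-diagonal entries; on the diagonal, rows in \<open>J0\<close> are compensated with \<open>L1\<close> (the rates
  without scaling) and all other rows with \<open>L\<close> itself.
\<close>

definition rate_matrix ::
  "'j set \<Rightarrow> ('j \<Rightarrow> 'j \<Rightarrow> real \<Rightarrow> real) \<Rightarrow> ('j \<Rightarrow> 'j \<Rightarrow> real \<Rightarrow> real) \<Rightarrow> real \<Rightarrow> real^'j^'j" where
  "rate_matrix J0 L L1 t = (\<chi> j k.
     if j \<noteq> k then L j k t
     else if j \<in> J0 then - (\<Sum>i\<in>UNIV - {j}. L1 j i t)
     else - (\<Sum>i\<in>UNIV - {j}. L j i t))"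

definition unit_scaling :: "real \<Rightarrow> 'a \<Rightarrow> real" where
  "unit_scaling t \<omega> = 1"

section \<open>Targets\<close>

text \<open>
  In this section \<open>H\<close> is either the scaling process or \<^const>\<open>unit_scaling\<close>. The first definition is the
  integrability condition on the uncensored occupation and transition quantities. The convention
  \<open>0 / 0 = 0\<close> is that of real division.
\<close>

definition finite_cum_rates ::
  "'a measure \<Rightarrow> (real \<Rightarrow> 'a \<Rightarrow> real) \<Rightarrow> ('a \<Rightarrow> real \<Rightarrow> 'j) \<Rightarrow> bool" where
  "finite_cum_rates M H Z \<longleftrightarrow> (\<forall>t\<ge>0. \<forall>j k. j \<noteq> k \<longrightarrow>
     (\<integral>\<^sup>+s\<in>{0<..t}.
        ennreal (1 / (LINT \<omega>|M. Lim (at_left s) (\<lambda>u. H u \<omega>) * of_bool (left_state (Z \<omega>) s = j)))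
      \<partial>interval_measure (\<lambda>s. LINT \<omega>|M. stieltjes (\<lambda>u. H u \<omega>) (jump_count (Z \<omega>) j k) s)) < \<infinity>)"

definition p_occ ::
  "'a measure \<Rightarrow> (real \<Rightarrow> 'a \<Rightarrow> real) \<Rightarrow> ('a \<Rightarrow> real \<Rightarrow> 'j) \<Rightarrow> ('a \<Rightarrow> real) \<Rightarrow> 'j \<Rightarrow> real \<Rightarrow> real" where
  "p_occ M H Z R j t = (LINT \<omega>|M. H t \<omega> * of_bool (Z \<omega> t = j) * of_bool (t < R \<omega>))"

definition p_trans ::
  "'a measure \<Rightarrow> (real \<Rightarrow> 'a \<Rightarrow> real) \<Rightarrow> ('a \<Rightarrow> real \<Rightarrow> 'j) \<Rightarrow> ('a \<Rightarrow> real) \<Rightarrow> 'j \<Rightarrow> 'j \<Rightarrow> real \<Rightarrow> real" where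
  "p_trans M H Z R j k t =
     (LINT \<omega>|M. stieltjes (\<lambda>s. H s \<omega> * of_bool (s \<le> R \<omega>)) (jump_count (Z \<omega>) j k) t)"

definition cum_rate ::
  "'a measure \<Rightarrow> real \<Rightarrow> (real \<Rightarrow> 'a \<Rightarrow> real) \<Rightarrow> ('a \<Rightarrow> real \<Rightarrow> 'j) \<Rightarrow> ('a \<Rightarrow> real) \<Rightarrow>
   'j \<Rightarrow> 'j \<Rightarrow> real \<Rightarrow> real" where
  "cum_rate M \<epsilon> H Z R j k = trunc_hazard \<epsilon> (p_occ M H Z R j) (p_trans M H Z R j k)"

definition p_eps ::
  "'a measure \<Rightarrow> 'j set \<Rightarrow> 'j \<Rightarrow> real \<Rightarrow> (real \<Rightarrow> 'a \<Rightarrow> real) \<Rightarrow> ('a \<Rightarrow> real \<Rightarrow> 'j::finite) \<Rightarrow> ('a \<Rightarrow> real) \<Rightarrow>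
   'j \<Rightarrow> real \<Rightarrow> real" where
  "p_eps M J0 z0 \<epsilon> H Z R j t =
     product_integral (rate_matrix J0 (cum_rate M \<epsilon> H Z R) (cum_rate M \<epsilon> unit_scaling Z R)) t $ z0 $ j"

section \<open>Estimators\<close>

definition I_occ ::
  "nat \<Rightarrow> (nat \<Rightarrow> real \<Rightarrow> 'a \<Rightarrow> real) \<Rightarrow> (nat \<Rightarrow> 'a \<Rightarrow> real \<Rightarrow> 'j) \<Rightarrow> (nat \<Rightarrow> 'a \<Rightarrow> real) \<Rightarrow> 'a \<Rightarrow>
   'j \<Rightarrow> real \<Rightarrow> real" where
  "I_occ n Hs Zs Rs \<omega> j t =
     1 / real n * (\<Sum>l=1..n. Hs l t \<omega> * of_bool (Zs l \<omega> t = j) * of_bool (t < Rs l \<omega>))"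

definition N_trans ::
  "nat \<Rightarrow> (nat \<Rightarrow> real \<Rightarrow> 'a \<Rightarrow> real) \<Rightarrow> (nat \<Rightarrow> 'a \<Rightarrow> real \<Rightarrow> 'j) \<Rightarrow> (nat \<Rightarrow> 'a \<Rightarrow> real) \<Rightarrow> 'a \<Rightarrow>
   'j \<Rightarrow> 'j \<Rightarrow> real \<Rightarrow> real" where
  "N_trans n Hs Zs Rs \<omega> j k t =
     1 / real n *
     (\<Sum>l=1..n. stieltjes (\<lambda>s. Hs l s \<omega> * of_bool (s \<le> Rs l \<omega>)) (jump_count (Zs l \<omega>) j k) t)"

definition cum_rate_hat ::
  "nat \<Rightarrow> real \<Rightarrow> (nat \<Rightarrow> real \<Rightarrow> 'a \<Rightarrow> real) \<Rightarrow> (nat \<Rightarrow> 'a \<Rightarrow> real \<Rightarrow> 'j) \<Rightarrow> (nat \<Rightarrow> 'a \<Rightarrow> real) \<Rightarrow> 'a \<Rightarrow>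
   'j \<Rightarrow> 'j \<Rightarrow> real \<Rightarrow> real" where
  "cum_rate_hat n \<epsilon> Hs Zs Rs \<omega> j k =
     trunc_hazard \<epsilon> (I_occ n Hs Zs Rs \<omega> j) (N_trans n Hs Zs Rs \<omega> j k)"

definition p_eps_hat ::
  "nat \<Rightarrow> 'j set \<Rightarrow> 'j \<Rightarrow> real \<Rightarrow> (nat \<Rightarrow> real \<Rightarrow> 'a \<Rightarrow> real) \<Rightarrow> (nat \<Rightarrow> 'a \<Rightarrow> real \<Rightarrow> 'j::finite) \<Rightarrow>
   (nat \<Rightarrow> 'a \<Rightarrow> real) \<Rightarrow> 'a \<Rightarrow> 'j \<Rightarrow> real \<Rightarrow> real" where
  "p_eps_hat n J0 z0 \<epsilon> Hs Zs Rs \<omega> j t =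
     product_integral
       (rate_matrix J0 (cum_rate_hat n \<epsilon> Hs Zs Rs \<omega>) (cum_rate_hat n \<epsilon> (\<lambda>_. unit_scaling) Zs Rs \<omega>))
       t $ z0 $ j"

section \<open>The right endpoint of the support\<close>

definition support_right_end :: "'a measure \<Rightarrow> ('a \<Rightarrow> real) \<Rightarrow> ereal" where
  "support_right_end M R =
     Sup (ereal ` {x. \<forall>U. open U \<and> x \<in> U \<longrightarrow> 0 < measure (distr M borel R) U})"

end

theory Submission
  imports Defs
begin

text \<open>
The estimators are obtained from sample averages by two maps: the averages of occupations and of transitions
are sent to the truncated rates \<open>\<integral> 1/(I(s-) \<or> \<epsilon>) N(ds)\<close>, and the rates to their product integral. The averages
converge uniformly on \<open>[0,\<theta>]\<close> almost surely, and both maps are continuous along this convergence.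

\<^emph>\<open>Averages.\<close> An average of i.i.d. nondecreasing right-continuous processes with finite means converges uniformly
(\<open>glivenko_cantelli\<close>): by the strong law of large numbers it converges, together with its left limits, at
countably many points, and monotonicity fills the gaps. The transition processes \<open>\<integral> H(s) 1{s \<le> R} N(ds)\<close> are
monotone. The occupation process \<open>H(t) 1{Z(t) = j} 1{t < R}\<close> is not, but it moves only when \<open>Z\<close> jumps or
when censoring takes place. Its increments are therefore at most \<open>C\<close> times those of the clock that counts all
jumps and the censoring, and it is the difference of two monotone processes (\<open>occ_increment\<close>,
\<open>avg_occ_uniform_limit\<close>).

\<^emph>\<open>Rates.\<close> Replacing the random weight \<open>1/(I(s-) \<or> \<epsilon>)\<close> by its deterministic limit \<open>f\<close> costs at most the uniform
distance of the weights times the total transition mass (\<open>trunc_hazard_uniform_limit\<close>). What remains is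
\<open>\<integral> f dN\<close> for a fixed \<open>f\<close>. This is again an average of i.i.d. monotone processes, so that the uniform law applies a
second time (\<open>weighted_uniform_limit\<close>). Its expectation is \<open>\<integral> f dE[N]\<close>, because \<open>f\<close> is left-continuous and the
integrals are limits of Riemann sums, which are linear in the integrator.

\<^emph>\<open>Product integrals.\<close> Summation by parts in the discrete Duhamel identity bounds the difference of two finite
products, over one and the same partition, by a constant times the uniform distance of the integrands, where the
constant depends on the total variations only (\<open>increment_product_diff\<close>). Comparison with step functions then shows
that the limit over partitions exists (\<open>product_integral_tendsto\<close>), and passage to this limit gives the continuity of
the product integral (\<open>product_integral_diff\<close>).

\<^emph>\<open>Measurability.\<close> The copies of \<open>H\<close> are functionals of the copies of the path. The law of large numbers applies
once this functional is known to be measurable on the space of jump paths (\<open>measurable_entry_value\<close>). Bounds and signs, which are known on the paths of \<open>Z\<close> only, are transferred to the copies by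
equality of the laws.
\<close>

section \<open>Product integrals\<close>

text \<open>
The operator norm is used because it is submultiplicative and gives the identity matrix norm 1, so that
products of factors \<open>1 + \<Delta>\<close> are bounded by exponentials of the total variation.
\<close>

definition mnorm :: "real^'n^'n \<Rightarrow> real" where
  "mnorm A = onorm (\<lambda>x. A *v x)"

lemma mnorm_nonneg: "0 \<le> mnorm A"
  unfolding mnorm_def by (rule onorm_pos_le) (rule matrix_vector_mul_bounded_linear)

lemma mnorm_mult: "mnorm (A ** B) \<le> mnorm A * mnorm B"
  using onorm_compose[of "(*v) A" "(*v) B"]
  by (simp add: mnorm_def comp_def matrix_vector_mul_bounded_linear matrix_vector_mul_assoc)

lemma mnorm_add: "mnorm (A + B) \<le> mnorm A + mnorm B"
  using onorm_triangle[of "(*v) A" "(*v) B"]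
  by (simp add: mnorm_def matrix_vector_mul_bounded_linear matrix_vector_mult_add_rdistrib)

lemma mnorm_diff: "mnorm (A - B) \<le> mnorm A + mnorm B"
proof -
  have "mnorm (- B) = mnorm B"
    using onorm_neg[of "\<lambda>x. B *v x"] matrix_vector_mult_diff_rdistrib[of 0 B] by (simp add: mnorm_def)
  then show ?thesis using mnorm_add[of A "- B"] by simp
qed

lemma mnorm_0 [simp]: "mnorm 0 = 0"
  by (simp add: mnorm_def onorm_zero)

lemma mnorm_1 [simp]: "mnorm (mat 1 :: real^'n^'n) = 1"
proof -
  obtain i :: 'n where True by simp
  have "norm (axis i 1 :: real^'n) \<le> mnorm (mat 1 :: real^'n^'n) * norm (axis i 1 :: real^'n)"
    using onorm[of "\<lambda>x. mat 1 *v x" "axis i 1 :: real^'n"] by (simp add: mnorm_def bounded_linear_ident)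
  then have "1 \<le> mnorm (mat 1 :: real^'n^'n)"
    by simp
  moreover have "mnorm (mat 1 :: real^'n^'n) \<le> 1"
    using onorm_id_le by (simp add: mnorm_def)
  ultimately show ?thesis by simp
qed

lemma abs_component_le_mnorm: "\<bar>A $ i $ j\<bar> \<le> mnorm A"
  using matrix_component_le_onorm[of A i j] by (simp add: mnorm_def)

lemma mnorm_le_sum: "mnorm A \<le> (\<Sum>i\<in>UNIV. \<Sum>j\<in>UNIV. \<bar>A $ i $ j\<bar>)"
  using onorm_le_matrix_component_sum[of A] by (simp add: mnorm_def)

lemma norm_le_mnorm: "norm (A :: real^'n^'n) \<le> real CARD('n) * real CARD('n) * mnorm A"
proof -
  have "norm A \<le> (\<Sum>i\<in>UNIV. norm (A $ i))"
    by (simp add: norm_vec_def L2_set_le_sum)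
  also have "\<dots> \<le> (\<Sum>i\<in>UNIV. \<Sum>j\<in>UNIV. \<bar>A $ i $ j\<bar>)"
    by (intro sum_mono) (simp add: norm_le_l1_cart)
  also have "\<dots> \<le> (\<Sum>i\<in>(UNIV::'n set). \<Sum>j\<in>(UNIV::'n set). mnorm A)"
    by (intro sum_mono abs_component_le_mnorm)
  finally show ?thesis by (simp add: mult_ac)
qed

lemma matrix_diff_ldistrib: "A ** (B - C) = A ** B - A ** (C :: real^'n^'n)"
  using matrix_add_ldistrib[of A "B - C" C] by (simp add: algebra_simps)

lemma matrix_add_rdistrib: "(A + B) ** C = A ** C + B ** (C :: real^'n^'n)"
  by (vector matrix_matrix_mult_def sum.distrib[symmetric] field_simps)

lemma matrix_diff_rdistrib: "(A - B) ** C = A ** C - B ** (C :: real^'n^'n)"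
  using matrix_add_rdistrib[of "A - B" B C] by (simp add: algebra_simps)

text \<open>
Each factor has norm at most \<open>1 + d \<le> exp d\<close>, where \<open>d\<close> is the increment of the dominating function \<open>\<gamma>\<close>; the
increments telescope.
\<close>

lemma increment_product_norm:
  fixes A :: "real \<Rightarrow> real^'n^'n" and \<gamma> :: "real \<Rightarrow> real"
  assumes dom: "\<And>x y. x \<in> I \<Longrightarrow> y \<in> I \<Longrightarrow> x \<le> y \<Longrightarrow> mnorm (A y - A x) \<le> \<gamma> y - \<gamma> x"
    and "sorted xs" "set xs \<subseteq> I" "xs \<noteq> []"
  shows "mnorm (increment_product A xs) \<le> exp (\<gamma> (last xs) - \<gamma> (hd xs))"
  using assms(2-)
proof (induction xs rule: induct_list012)
  case (3 a b xs)
  let ?P = "increment_product A (b # xs)"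
  define d where "d = \<gamma> b - \<gamma> a"
  have 1: "mnorm (A b - A a) \<le> d"
    using 3 dom[of a b] by (auto simp: d_def)
  have 2: "mnorm ?P \<le> exp (\<gamma> (last (b # xs)) - \<gamma> b)"
    using 3 by simp
  have "mnorm (increment_product A (a # b # xs)) \<le> mnorm (mat 1 + (A b - A a)) * mnorm ?P"
    using mnorm_mult by simp
  also have "\<dots> \<le> exp d * exp (\<gamma> (last (b # xs)) - \<gamma> b)"
  proof (intro mult_mono 2 mnorm_nonneg)
    have "mnorm (mat 1 + (A b - A a)) \<le> 1 + d"
      using mnorm_add[of "mat 1" "A b - A a"] 1 by simp
    then show "mnorm (mat 1 + (A b - A a)) \<le> exp d"
      using exp_ge_add_one_self[of d] by linarith
  qed simp
  also have "\<dots> = exp (\<gamma> (last (a # b # xs)) - \<gamma> (hd (a # b # xs)))"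
    by (simp add: d_def flip: exp_add)
  finally show ?case .
qed simp_all

text \<open>
In the discrete Duhamel identity the increments of \<open>A - B\<close> stand between a partial product of \<open>A\<close> and one of \<open>B\<close>.
Summation by parts moves the differences to these products, whose variation is controlled by \<open>\<gamma>\<close>. Only the
uniform distance \<open>e\<close> of \<open>A\<close> and \<open>B\<close> is left, and the bound does not depend on the partition.
\<close>

lemma increment_product_diff:
  fixes A B :: "real \<Rightarrow> real^'n^'n" and \<gamma> :: "real \<Rightarrow> real"
  assumes domA: "\<And>x y. x \<in> I \<Longrightarrow> y \<in> I \<Longrightarrow> x \<le> y \<Longrightarrow> mnorm (A y - A x) \<le> \<gamma> y - \<gamma> x"
    and domB: "\<And>x y. x \<in> I \<Longrightarrow> y \<in> I \<Longrightarrow> x \<le> y \<Longrightarrow> mnorm (B y - B x) \<le> \<gamma> y - \<gamma> x"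
    and e: "\<And>x. x \<in> I \<Longrightarrow> mnorm (A x - B x) \<le> e"
    and "sorted xs" "set xs \<subseteq> I" "xs \<noteq> []"
  defines "G \<equiv> \<gamma> (last xs) - \<gamma> (hd xs)"
  shows "mnorm (increment_product A xs - increment_product B xs) \<le> 2 * e * (1 + G) * exp G"
proof -
  \<comment> \<open>Summation by parts: the boundary term at the left end point is carried along.\<close>
  define F where "F xs = increment_product A xs - increment_product B xs
     + (A (hd xs) - B (hd xs)) ** increment_product B xs" for xs
  have e0: "0 \<le> e" if "x \<in> I" for x
    using e[OF that] mnorm_nonneg[of "A x - B x"] by linarith
  have F: "mnorm (F xs) \<le> e * (1 + 2 * (\<gamma> (last xs) - \<gamma> (hd xs))) * exp (\<gamma> (last xs) - \<gamma> (hd xs))"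
    using assms(4-6)
  proof (induction xs rule: induct_list012)
    case (2 x)
    then show ?case using e[of x] by (simp add: F_def)
  next
    case (3 a b xs)
    let ?A = "increment_product A (b # xs)" and ?B = "increment_product B (b # xs)"
    define d where "d = \<gamma> b - \<gamma> a"
    define g where "g = \<gamma> (last (b # xs)) - \<gamma> b"
    define U where "U = A b - A a"
    define V where "V = B b - B a"
    have I: "a \<in> I" "b \<in> I" "a \<le> b" "last (b # xs) \<in> I" "b \<le> last (b # xs)"
      using 3 by (auto dest: last_in_set split: if_splits)
    have d: "mnorm U \<le> d" "mnorm V \<le> d" "0 \<le> d"
      using domA[of a b] domB[of a b] I mnorm_nonneg[of "A b - A a"] by (auto simp: d_def U_def V_def)
    have g: "0 \<le> g"
      using domA[of b "last (b # xs)"] I mnorm_nonneg[of "A (last (b # xs)) - A b"] by (auto simp: g_def)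
    have Bn: "mnorm ?B \<le> exp g"
      using increment_product_norm[of I B \<gamma> "b # xs"] domB 3 by (auto simp: g_def)
    have IH: "mnorm (F (b # xs)) \<le> e * (1 + 2 * g) * exp g"
      using 3 by (auto simp: g_def)
    have eq: "F (a # b # xs) = (mat 1 + U) ** F (b # xs)
        + ((A a - B a) ** (V ** ?B) - U ** ((A b - B b) ** ?B))"
      unfolding F_def U_def V_def
      by (simp add: matrix_add_ldistrib matrix_add_rdistrib matrix_mul_assoc algebra_simps
            matrix_diff_ldistrib matrix_diff_rdistrib)
    have "mnorm (F (a # b # xs)) \<le> mnorm (mat 1 + U) * mnorm (F (b # xs))
        + (mnorm (A a - B a) * (mnorm V * mnorm ?B) + mnorm U * (mnorm (A b - B b) * mnorm ?B))"
      unfolding eq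
      by (intro order.trans[OF mnorm_add] add_mono order.trans[OF mnorm_diff] mnorm_mult
          order.trans[OF mnorm_mult mult_left_mono] mnorm_nonneg)
    also have "\<dots> \<le> (1 + d) * (e * (1 + 2 * g) * exp g) + (e * (d * exp g) + d * (e * exp g))"
    proof (intro add_mono mult_mono mnorm_nonneg IH Bn d e I mult_nonneg_nonneg)
      show "mnorm (mat 1 + U) \<le> 1 + d"
        using mnorm_add[of "mat 1" U] d by simp
    qed (use d e0 I in auto)
    also have "\<dots> = e * exp g * ((1 + d) * (1 + 2 * g) + 2 * d)"
      by (simp add: algebra_simps)
    also have "\<dots> \<le> e * exp g * (exp d * (1 + 2 * g) + 2 * d * exp d)"
    proof (intro mult_left_mono add_mono mult_right_mono)
      show "2 * d \<le> 2 * d * exp d"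
        using d by (simp add: mult_le_cancel_left1)
    qed (use e0 I g exp_ge_add_one_self[of d] in auto)
    also have "\<dots> = e * (1 + 2 * (d + g)) * exp (d + g)"
      by (simp add: exp_add algebra_simps)
    also have "d + g = \<gamma> (last (a # b # xs)) - \<gamma> (hd (a # b # xs))"
      by (simp add: d_def g_def)
    finally show ?case .
  qed auto
  have hI: "hd xs \<in> I"
    using assms by auto
  have "increment_product A xs - increment_product B xs
      = F xs - (A (hd xs) - B (hd xs)) ** increment_product B xs"
    by (simp add: F_def)
  then have "mnorm (increment_product A xs - increment_product B xs)
      \<le> mnorm (F xs) + mnorm (A (hd xs) - B (hd xs)) * mnorm (increment_product B xs)"
    using mnorm_diff mnorm_mult by (smt (verit))
  also have "\<dots> \<le> e * (1 + 2 * G) * exp G + e * exp G"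
    unfolding G_def
    by (intro add_mono F mult_mono mnorm_nonneg e e0[OF hI] hI
         increment_product_norm[of I] domB assms(4-6))
  also have "\<dots> = 2 * e * (1 + G) * exp G"
    by (simp add: algebra_simps)
  finally show ?thesis .
qed

text \<open>
A point across which \<open>B\<close> does not move contributes the identity matrix. Hence, for a step function, only the
points of \<open>D\<close>, at which it may jump, matter.
\<close>

lemma increment_product_filter:
  assumes "sorted (a # xs)" "distinct (a # xs)"
    and B: "\<And>x y. x \<in> set (a # xs) \<Longrightarrow> y \<in> set (a # xs) \<Longrightarrow> x \<le> y \<Longrightarrow> D \<inter> {x<..y} = {} \<Longrightarrow> B x = B y"
    and "D \<inter> {a<..} \<subseteq> set xs"
  shows "increment_product B (a # xs) = increment_product B (a # filter (\<lambda>x. x \<in> D) xs)"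
  using assms
proof (induction xs arbitrary: a)
  case (Cons b xs)
  have IH: "increment_product B (b # xs) = increment_product B (b # filter (\<lambda>x. x \<in> D) xs)"
    using Cons.prems by (intro Cons.IH) auto
  show ?case
  proof (cases "b \<in> D")
    case True
    then show ?thesis using IH by simp
  next
    case False
    have "x \<notin> {a<..b}" if "x \<in> D" for x
    proof
      assume x: "x \<in> {a<..b}"
      with that Cons.prems(4) have "x \<in> set (b # xs)" by auto
      with Cons.prems(1) have "b \<le> x" by auto
      with x that False show False by auto
    qed
    then have "D \<inter> {a<..b} = {}" by blast
    then have ab: "B a = B b"
      using Cons.prems(1) by (intro Cons.prems(3)) auto
    have "increment_product B (b # ys) = increment_product B (a # ys)" for ys
      using ab by (cases ys) auto
    then show ?thesis using IH ab False by simp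
  qed
qed simp

text \<open>
The oscillation is at most \<open>\<eta>\<close> on every half-open interval \<open>[d,d')\<close> between neighbouring points of \<open>D\<close>; the
formulation with an arbitrary pair \<open>x \<le> y\<close> avoids any enumeration of \<open>D\<close>.
\<close>

definition partitioned :: "(real \<Rightarrow> real) \<Rightarrow> real \<Rightarrow> bool" where
  "partitioned \<alpha> t \<longleftrightarrow> (\<forall>\<eta>>0. \<exists>D. finite D \<and> D \<subseteq> {0..t} \<and>
     (\<forall>x y. 0 \<le> x \<and> x \<le> y \<and> y \<le> t \<and> D \<inter> {x<..y} = {} \<longrightarrow> \<alpha> y - \<alpha> x \<le> \<eta>))"

text \<open>
Bisection: near a point \<open>x\<close> the partition \<open>{x}\<close> will do, since \<open>\<alpha>\<close> has a left limit at \<open>x\<close> and is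
right-continuous there.
\<close>

lemma right_continuous_partitioned:
  assumes mono: "mono \<alpha>" and rc: "\<And>x. 0 \<le> x \<Longrightarrow> (\<alpha> \<longlongrightarrow> \<alpha> x) (at_right x)" and "0 \<le> t"
  shows "partitioned \<alpha> t"
  unfolding partitioned_def
proof (intro allI impI)
  fix \<eta> :: real assume \<eta>: "0 < \<eta>"
  define P where "P u v \<longleftrightarrow> (\<exists>D. finite D \<and> D \<subseteq> {u..v} \<and>
     (\<forall>x y. u \<le> x \<and> x \<le> y \<and> y \<le> v \<and> D \<inter> {x<..y} = {} \<longrightarrow> \<alpha> y - \<alpha> x \<le> \<eta>))" for u v
  have "P 0 t"
    using \<open>0 \<le> t\<close>
  proof (induction rule: Bolzano)
    case (trans a b c)
    then obtain D1 D2 where D: "finite D1" "D1 \<subseteq> {a..b}" "finite D2" "D2 \<subseteq> {b..c}"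
      and 1: "\<And>x y. a \<le> x \<Longrightarrow> x \<le> y \<Longrightarrow> y \<le> b \<Longrightarrow> D1 \<inter> {x<..y} = {} \<Longrightarrow> \<alpha> y - \<alpha> x \<le> \<eta>"
      and 2: "\<And>x y. b \<le> x \<Longrightarrow> x \<le> y \<Longrightarrow> y \<le> c \<Longrightarrow> D2 \<inter> {x<..y} = {} \<Longrightarrow> \<alpha> y - \<alpha> x \<le> \<eta>"
      unfolding P_def by metis
    show ?case
      unfolding P_def
    proof (intro exI[of _ "insert b (D1 \<union> D2)"] conjI allI impI)
      fix x y assume *: "a \<le> x \<and> x \<le> y \<and> y \<le> c \<and> insert b (D1 \<union> D2) \<inter> {x<..y} = {}"
      then consider "y \<le> b" | "b \<le> x" by force
      then show "\<alpha> y - \<alpha> x \<le> \<eta>"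
        using 1[of x y] 2[of x y] * by cases auto
    qed (use D trans in auto)
  next
    case (local x)
    obtain r where r: "r > x" "\<And>y. x < y \<Longrightarrow> y < r \<Longrightarrow> \<alpha> y < \<alpha> x + \<eta>"
      using order_tendstoD(2)[OF rc[of x], of "\<alpha> x + \<eta>"] local \<eta>
      by (auto simp: eventually_at_right_field)
    have bdd: "bdd_above (\<alpha> ` {..<x})" using monoD[OF mono] by (intro bdd_aboveI[of _ "\<alpha> x"]) auto
    define s where "s = Sup (\<alpha> ` {..<x})"
    have "\<exists>l<x. s - \<eta> < \<alpha> l"
    proof -
      have "\<exists>z\<in>\<alpha> ` {..<x}. s - \<eta> < z"
        using \<eta> by (subst less_cSup_iff[symmetric]) (auto simp: bdd s_def)
      then show ?thesis by auto
    qed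
    then obtain l where l: "l < x" "s - \<eta> < \<alpha> l" by blast
    have s: "\<alpha> y \<le> s" if "y < x" for y
      unfolding s_def using that bdd by (auto intro!: cSup_upper)
    show ?case
    proof (intro exI[of _ "min (r - x) (x - l)"] conjI allI impI)
      fix a b assume ab: "a \<le> x \<and> x \<le> b \<and> b - a < min (r - x) (x - l)"
      show "P a b"
        unfolding P_def
      proof (intro exI[of _ "{x}"] conjI allI impI)
        fix u v assume uv: "a \<le> u \<and> u \<le> v \<and> v \<le> b \<and> {x} \<inter> {u<..v} = {}"
        then have "x \<notin> {u<..v}" by blast
        then consider "v < x" | "u = v" | "x \<le> u" "u < v" using uv by fastforce
        then show "\<alpha> v - \<alpha> u \<le> \<eta>"
        proof cases
          case 1
          then have "\<alpha> l \<le> \<alpha> u" using ab uv by (intro monoD[OF mono]) auto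
          then show ?thesis using s[OF 1] l by auto
        next
          case 3
          have "\<alpha> x \<le> \<alpha> u" using 3 by (intro monoD[OF mono]) auto
          then show ?thesis using r(2)[of v] 3 ab uv by force
        qed (use \<eta> in auto)
      qed (use ab in auto)
    qed (use r l in auto)
  qed
  then show "\<exists>D. finite D \<and> D \<subseteq> {0..t} \<and>
     (\<forall>x y. 0 \<le> x \<and> x \<le> y \<and> y \<le> t \<and> D \<inter> {x<..y} = {} \<longrightarrow> \<alpha> y - \<alpha> x \<le> \<eta>)"
    by (simp add: P_def)
qed

definition grid :: "real \<Rightarrow> real set \<Rightarrow> real list" where
  "grid T D = sorted_list_of_set ({0, T} \<union> D)"

context
  fixes t :: real
  assumes t: "0 \<le> t"
begin

lemma grid_props:
  assumes "finite D" "D \<subseteq> {0..t}"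
  shows "set (grid t D) = {0, t} \<union> D" "sorted (grid t D)" "distinct (grid t D)" "grid t D \<noteq> []"
    "hd (grid t D) = 0" "last (grid t D) = t"
proof -
  show *: "set (grid t D) = {0, t} \<union> D" "sorted (grid t D)" "distinct (grid t D)" and ne: "grid t D \<noteq> []"
    using assms by (simp_all add: grid_def del: Un_insert_left)
  obtain y ys where y: "grid t D = y # ys" using ne by (cases "grid t D") auto
  have "y \<in> {0, t} \<union> D" using *(1) y list.set_intros(1)[of y ys] by (simp only:)
  then have "y \<in> {0..t}" using assms t by auto
  moreover have "y \<le> 0" using *(1,2) y by auto
  ultimately show "hd (grid t D) = 0" using y by simp
  obtain z zs where z: "grid t D = zs @ [z]" using ne by (cases "grid t D" rule: rev_cases) auto
  have "z \<in> {0, t} \<union> D" using *(1) z by (metis in_set_conv_decomp)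
  then have "z \<in> {0..t}" using assms t by auto
  moreover have "t \<in> set (grid t D)" using *(1) by simp
  then have "t \<le> z" using *(2) unfolding z by (auto simp: sorted_append)
  ultimately show "last (grid t D) = t" using z by simp
qed

lemma increment_product_grid_diff:
  fixes A B :: "real \<Rightarrow> real^'n^'n" and \<gamma> :: "real \<Rightarrow> real"
  assumes "\<And>x y. 0 \<le> x \<Longrightarrow> x \<le> y \<Longrightarrow> y \<le> t \<Longrightarrow> mnorm (A y - A x) \<le> \<gamma> y - \<gamma> x"
    and "\<And>x y. 0 \<le> x \<Longrightarrow> x \<le> y \<Longrightarrow> y \<le> t \<Longrightarrow> mnorm (B y - B x) \<le> \<gamma> y - \<gamma> x"
    and "\<And>x. 0 \<le> x \<Longrightarrow> x \<le> t \<Longrightarrow> mnorm (A x - B x) \<le> e"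
    and "finite D" "D \<subseteq> {0..t}"
  shows "mnorm (increment_product A (grid t D) - increment_product B (grid t D))
    \<le> 2 * e * (1 + (\<gamma> t - \<gamma> 0)) * exp (\<gamma> t - \<gamma> 0)"
  using increment_product_diff[of "{0..t}" A \<gamma> B e "grid t D"] assms t
  by (simp add: grid_props)

lemma increment_product_grid_step:
  fixes B :: "real \<Rightarrow> real^'n^'n"
  assumes "finite D" "D \<subseteq> {0..t}" "D0 \<subseteq> D"
    and B: "\<And>x y. 0 \<le> x \<Longrightarrow> x \<le> y \<Longrightarrow> y \<le> t \<Longrightarrow> D0 \<inter> {x<..y} = {} \<Longrightarrow> B x = B y"
  shows "increment_product B (grid t D) = increment_product B (grid t D0)"
proof -
  obtain xs where xs: "grid t D = 0 # xs"
    using grid_props(4,5)[OF assms(1,2)] by (cases "grid t D") auto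
  have fin: "finite D0" "D0 \<subseteq> {0..t}" using assms finite_subset by auto
  note p = grid_props[OF assms(1,2)]
  have "increment_product B (0 # xs) = increment_product B (0 # filter (\<lambda>x. x \<in> {0, t} \<union> D0) xs)"
  proof (rule increment_product_filter)
    show "sorted (0 # xs)" "distinct (0 # xs)" using p xs by auto
    show "({0, t} \<union> D0) \<inter> {0<..} \<subseteq> set xs"
    proof
      fix x assume x: "x \<in> ({0, t} \<union> D0) \<inter> {0<..}"
      with assms(3) have "x \<in> set (0 # xs)" unfolding xs[symmetric] p(1) by blast
      with x show "x \<in> set xs" by auto
    qed
    fix x y assume "x \<in> set (0 # xs)" "y \<in> set (0 # xs)" "x \<le> y" "({0, t} \<union> D0) \<inter> {x<..y} = {}"
    moreover have "{0, t} \<union> D \<subseteq> {0..t}" using assms(2) t by auto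
    then have "set (0 # xs) \<subseteq> {0..t}" using p(1) unfolding xs by (simp only:)
    ultimately show "B x = B y" by (intro B) (auto simp del: list.set)
  qed
  also have "0 # filter (\<lambda>x. x \<in> {0, t} \<union> D0) xs = filter (\<lambda>x. x \<in> {0, t} \<union> D0) (grid t D)"
    by (simp add: xs)
  also have "\<dots> = grid t D0"
  proof (rule sorted_distinct_set_unique)
    show "set (filter (\<lambda>x. x \<in> {0, t} \<union> D0) (grid t D)) = set (grid t D0)"
      unfolding set_filter p(1) grid_props(1)[OF fin] using assms(3) by auto
  qed (simp_all add: sorted_wrt_filter p grid_props[OF fin])
  finally show ?thesis by (simp add: xs)
qed

text \<open>
The limit that defines the product integral exists: up to an error of order \<open>\<eta>\<close>, uniformly in the partition, \<open>A\<close> may be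
replaced by a step function, and for a step function the product is constant as soon as the partition contains
all its jump points. The net of products is therefore Cauchy.
\<close>

lemma product_integral_tendsto:
  fixes A :: "real \<Rightarrow> real^'n^'n"
  assumes dom: "\<And>x y. 0 \<le> x \<Longrightarrow> x \<le> y \<Longrightarrow> y \<le> t \<Longrightarrow> mnorm (A y - A x) \<le> \<alpha> y - \<alpha> x"
    and part: "partitioned \<alpha> t"
  shows "((\<lambda>D. increment_product A (grid t D)) \<longlongrightarrow> product_integral A t) (finite_subsets_at_top {0..t})"
proof -
  let ?F = "finite_subsets_at_top {0..t}"
  let ?P = "\<lambda>D. increment_product A (grid t D)"
  have \<alpha>mono: "\<alpha> x \<le> \<alpha> y" if "0 \<le> x" "x \<le> y" "y \<le> t" for x y
    using dom[OF that] mnorm_nonneg[of "A y - A x"] by simp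
  define G where "G = \<alpha> t - \<alpha> 0"
  have G: "0 \<le> G" using \<alpha>mono[of 0 t] t by (simp add: G_def)
  define C where "C = real CARD('n) * real CARD('n) * (2 * (2 * (1 + 2 * G) * exp (2 * G)))"
  have C: "0 < C" using G by (auto simp: C_def intro!: mult_pos_pos)
  have "cauchy_filter (filtermap ?P ?F)"
    unfolding cauchy_filter_metric_filtermap
  proof (intro allI impI)
    fix e :: real assume e: "0 < e"
    define \<eta> where "\<eta> = e / (2 * C)"
    have \<eta>: "0 < \<eta>" using e C by (simp add: \<eta>_def)
    obtain D1 where D1: "finite D1" "D1 \<subseteq> {0..t}"
      and osc1: "\<And>x y. 0 \<le> x \<Longrightarrow> x \<le> y \<Longrightarrow> y \<le> t \<Longrightarrow> D1 \<inter> {x<..y} = {} \<Longrightarrow> \<alpha> y - \<alpha> x \<le> \<eta>"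
      using part \<eta> unfolding partitioned_def by metis
    define D0 where "D0 = insert 0 D1"
    have D0: "finite D0" "D0 \<subseteq> {0..t}" "0 \<in> D0" using D1 t by (auto simp: D0_def)
    \<comment> \<open>\<open>A\<close> is replaced by the step function that is constant between the points of \<open>D0\<close>.\<close>
    \<comment> \<open>The last point of \<open>D0\<close> that is not after \<open>x\<close>; \<open>0 \<in> D0\<close> makes it well defined.\<close>
    define \<pi> where "\<pi> x = Max (D0 \<inter> {..x})" for x
    have \<pi>: "\<pi> x \<in> D0" "\<pi> x \<le> x" "0 \<le> \<pi> x" "D0 \<inter> {\<pi> x<..x} = {}" if "0 \<le> x" for x
    proof -
      have *: "finite (D0 \<inter> {..x})" "D0 \<inter> {..x} \<noteq> {}" using D0 that by auto
      from Max_in[OF this] show "\<pi> x \<in> D0" "\<pi> x \<le> x" "0 \<le> \<pi> x"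
        using D0 by (auto simp: \<pi>_def)
      show "D0 \<inter> {\<pi> x<..x} = {}"
        using Max_ge[OF *(1)] by (force simp: \<pi>_def)
    qed
    have \<pi>_mono: "\<pi> x \<le> \<pi> y" if "0 \<le> x" "x \<le> y" for x y
      unfolding \<pi>_def using that D0 by (intro Max_mono) auto
    define B where "B x = A (\<pi> x)" for x
    define \<gamma> where "\<gamma> x = \<alpha> x + \<alpha> (\<pi> x)" for x
    have osc: "\<alpha> x - \<alpha> (\<pi> x) \<le> \<eta>" if "0 \<le> x" "x \<le> t" for x
      using \<pi>[OF that(1)] that by (intro osc1) (auto simp: D0_def)
    have A\<gamma>: "mnorm (A y - A x) \<le> \<gamma> y - \<gamma> x" if "0 \<le> x" "x \<le> y" "y \<le> t" for x y
    proof -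
      have "\<pi> y \<le> t" using \<pi>(2)[of y] that by auto
      then show ?thesis
        using dom[OF that] \<alpha>mono[of "\<pi> x" "\<pi> y"] \<pi>[of x] \<pi>_mono[of x y] that by (simp add: \<gamma>_def)
    qed
    have B\<gamma>: "mnorm (B y - B x) \<le> \<gamma> y - \<gamma> x" if "0 \<le> x" "x \<le> y" "y \<le> t" for x y
    proof -
      have "\<pi> y \<le> t" using \<pi>(2)[of y] that by auto
      then show ?thesis
        using dom[of "\<pi> x" "\<pi> y"] \<alpha>mono[of x y] \<pi>[of x] \<pi>_mono[of x y] that
        by (simp add: \<gamma>_def B_def)
    qed
    have AB: "mnorm (A x - B x) \<le> \<eta>" if "0 \<le> x" "x \<le> t" for x
      using dom[of "\<pi> x" x] \<pi>[of x] osc[of x] that by (simp add: B_def)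
    have \<gamma>G: "\<gamma> t - \<gamma> 0 \<le> 2 * G"
    proof -
      have "\<pi> 0 = 0" using \<pi>[of 0] by simp
      then show ?thesis using \<alpha>mono[of "\<pi> t" t] \<pi>[of t] t by (simp add: \<gamma>_def G_def)
    qed
    have \<gamma>0: "0 \<le> \<gamma> t - \<gamma> 0"
      using A\<gamma>[of 0 t] t mnorm_nonneg[of "A t - A 0"] by simp
    have close: "mnorm (?P D - increment_product B (grid t D0)) \<le> \<eta> * (2 * (1 + 2 * G) * exp (2 * G))"
      if D: "finite D" "D \<subseteq> {0..t}" "D0 \<subseteq> D" for D
    proof -
      have "increment_product B (grid t D) = increment_product B (grid t D0)"
      proof (rule increment_product_grid_step[OF D])
        fix x y :: real assume *: "0 \<le> x" "x \<le> y" "y \<le> t" "D0 \<inter> {x<..y} = {}"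
        then have "D0 \<inter> {..x} = D0 \<inter> {..y}" by fastforce
        then show "B x = B y" by (simp add: B_def \<pi>_def)
      qed
      then have "mnorm (?P D - increment_product B (grid t D0))
          \<le> 2 * \<eta> * (1 + (\<gamma> t - \<gamma> 0)) * exp (\<gamma> t - \<gamma> 0)"
        using increment_product_grid_diff[of A \<gamma> B \<eta> D, OF A\<gamma> B\<gamma> AB D(1,2)] by simp
      also have "\<dots> \<le> 2 * \<eta> * (1 + 2 * G) * exp (2 * G)"
        using \<gamma>G \<gamma>0 \<eta> G by (intro mult_mono) auto
      finally show ?thesis by (simp add: algebra_simps)
    qed
    show "\<exists>Q. eventually Q ?F \<and> (\<forall>x y. Q x \<and> Q y \<longrightarrow> dist (?P x) (?P y) < e)"
    proof (intro exI[of _ "\<lambda>D. finite D \<and> D \<subseteq> {0..t} \<and> D0 \<subseteq> D"] conjI allI impI)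
      show "\<forall>\<^sub>F D in ?F. finite D \<and> D \<subseteq> {0..t} \<and> D0 \<subseteq> D"
        unfolding eventually_finite_subsets_at_top using D0 by blast
      fix D D' assume *: "(finite D \<and> D \<subseteq> {0..t} \<and> D0 \<subseteq> D) \<and> (finite D' \<and> D' \<subseteq> {0..t} \<and> D0 \<subseteq> D')"
      let ?b = "increment_product B (grid t D0)"
      have "mnorm (?P D - ?P D') \<le> mnorm (?P D - ?b) + mnorm (?P D' - ?b)"
        using mnorm_diff[of "?P D - ?b" "?P D' - ?b"] by simp
      also have "\<dots> \<le> \<eta> * (2 * (2 * (1 + 2 * G) * exp (2 * G)))"
        using close[of D] close[of D'] * by simp
      finally have "dist (?P D) (?P D') \<le> real CARD('n) * real CARD('n) * (\<eta> * (2 * (2 * (1 + 2 * G) * exp (2 * G))))"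
        unfolding dist_norm by (intro order.trans[OF norm_le_mnorm] mult_left_mono) auto
      also have "\<dots> = C * \<eta>" by (simp add: C_def mult_ac)
      also have "\<dots> < e" using C e by (simp add: \<eta>_def)
      finally show "dist (?P D) (?P D') < e" .
    qed
  qed
  then obtain L where "filtermap ?P ?F \<le> nhds L"
    using cauchy_filter_complete_converges[of "filtermap ?P ?F" UNIV]
    by (auto simp: complete_UNIV filtermap_bot_iff)
  then have L: "(?P \<longlongrightarrow> L) ?F" by (simp add: filterlim_def)
  then have "product_integral A t = L"
    unfolding product_integral_def by (intro tendsto_Lim) (auto simp: grid_def)
  with L show ?thesis by simp
qed

text \<open>
The partition-free bound of \<open>increment_product_diff\<close> with \<open>\<gamma> = \<alpha> + \<beta>\<close> survives the limit over partitions. It is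
stated for entries, which are continuous coordinates of the matrix.
\<close>

lemma product_integral_diff:
  fixes A B :: "real \<Rightarrow> real^'n^'n"
  assumes A: "\<And>x y. 0 \<le> x \<Longrightarrow> x \<le> y \<Longrightarrow> y \<le> t \<Longrightarrow> mnorm (A y - A x) \<le> \<alpha> y - \<alpha> x" "partitioned \<alpha> t"
    and B: "\<And>x y. 0 \<le> x \<Longrightarrow> x \<le> y \<Longrightarrow> y \<le> t \<Longrightarrow> mnorm (B y - B x) \<le> \<beta> y - \<beta> x" "partitioned \<beta> t"
    and e: "\<And>x. 0 \<le> x \<Longrightarrow> x \<le> t \<Longrightarrow> mnorm (A x - B x) \<le> e"
    and K: "\<alpha> t - \<alpha> 0 + (\<beta> t - \<beta> 0) \<le> K"
  shows "\<bar>product_integral A t $ i $ j - product_integral B t $ i $ j\<bar> \<le> 2 * e * (1 + K) * exp K"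
proof -
  let ?F = "finite_subsets_at_top {0..t}"
  define \<gamma> where "\<gamma> x = \<alpha> x + \<beta> x" for x
  have pos: "0 \<le> \<alpha> y - \<alpha> x" "0 \<le> \<beta> y - \<beta> x" if "0 \<le> x" "x \<le> y" "y \<le> t" for x y
    using A(1)[OF that] B(1)[OF that] mnorm_nonneg[of "A y - A x"] mnorm_nonneg[of "B y - B x"] by linarith+
  have e0: "0 \<le> e" using e[of 0] t mnorm_nonneg[of "A 0 - B 0"] by simp
  have "((\<lambda>D. \<bar>increment_product A (grid t D) $ i $ j - increment_product B (grid t D) $ i $ j\<bar>)
     \<longlongrightarrow> \<bar>product_integral A t $ i $ j - product_integral B t $ i $ j\<bar>) ?F"
    by (intro tendsto_intros product_integral_tendsto[of A \<alpha>] product_integral_tendsto[of B \<beta>] A B)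
  then show ?thesis
  proof (rule tendsto_upperbound)
    show "\<forall>\<^sub>F D in ?F. \<bar>increment_product A (grid t D) $ i $ j - increment_product B (grid t D) $ i $ j\<bar>
      \<le> 2 * e * (1 + K) * exp K"
      using eventually_finite_subsets_at_top_weakI[of "{0..t}"]
    proof (rule eventually_mono[where P = "\<lambda>D. finite D \<and> D \<subseteq> {0..t}"])
      fix D assume D: "finite D \<and> D \<subseteq> {0..t}"
      have "\<bar>increment_product A (grid t D) $ i $ j - increment_product B (grid t D) $ i $ j\<bar>
          \<le> mnorm (increment_product A (grid t D) - increment_product B (grid t D))"
        using abs_component_le_mnorm[of "increment_product A (grid t D) - increment_product B (grid t D)" i j]
        by simp
      also have "\<dots> \<le> 2 * e * (1 + (\<gamma> t - \<gamma> 0)) * exp (\<gamma> t - \<gamma> 0)"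
      proof (rule increment_product_grid_diff)
        fix x y assume xy: "0 \<le> x" "x \<le> y" "y \<le> t"
        show "mnorm (A y - A x) \<le> \<gamma> y - \<gamma> x" "mnorm (B y - B x) \<le> \<gamma> y - \<gamma> x"
          using A(1)[OF xy] B(1)[OF xy] pos[OF xy] by (auto simp: \<gamma>_def)
      qed (use e D in auto)
      also have "\<dots> \<le> 2 * e * (1 + K) * exp K"
        using pos[of 0 t] K t e0 by (intro mult_mono) (auto simp: \<gamma>_def)
      finally show "\<bar>increment_product A (grid t D) $ i $ j - increment_product B (grid t D) $ i $ j\<bar>
          \<le> 2 * e * (1 + K) * exp K" .
    qed auto
  qed auto
qed

end

section \<open>The strong law of large numbers\<close>

context prob_space
begin

lemma indep_vars_Suc:
  assumes "indep_vars N Y {1 :: nat..}"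
  shows "indep_vars (\<lambda>i. N (Suc i)) (\<lambda>i. Y (Suc i)) UNIV"
proof -
  define E where "E i = {Y i -` A \<inter> space M | A. A \<in> sets (N i)}" for i
  have E: "indep_sets E {1..}" and rv: "\<And>i. random_variable (N (Suc i)) (Y (Suc i))"
    using assms unfolding indep_vars_def2 E_def by auto
  have "indep_sets (\<lambda>i. E (Suc i)) UNIV"
  proof (rule indep_setsI)
    show "E (Suc i) \<subseteq> events" for i using E by (auto simp: indep_sets_def)
    fix A J assume J: "J \<noteq> {}" "J \<subseteq> (UNIV :: nat set)" "finite J" and A: "\<forall>j\<in>J. A j \<in> E (Suc j)"
    have "prob (\<Inter>j\<in>Suc ` J. A (j - 1)) = (\<Prod>j\<in>Suc ` J. prob (A (j - 1)))"
      using J A by (intro indep_setsD[OF E]) auto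
    then show "prob (\<Inter>j\<in>J. A j) = (\<Prod>j\<in>J. prob (A j))"
      by (simp add: prod.reindex)
  qed
  then show ?thesis
    using rv unfolding indep_vars_def2 E_def by auto
qed

text \<open>
Let \<open>mx n\<close> be the maximum of the partial sums \<open>S_0, \<dots>, S_n\<close> and \<open>mx' n\<close> the same for the shifted sequence
\<open>Y_1, Y_2, \<dots>\<close>. Then \<open>mx (n+1) = max 0 (Y_0 + mx' n)\<close>, that is, \<open>mx (n+1) - mx' n = max (- mx' n) Y_0\<close>. The mean of the
left-hand side is nonnegative, because \<open>mx' n\<close> has the law of \<open>mx n \<le> mx (n+1)\<close>. If the partial sums were unbounded
almost surely, the right-hand side would converge to \<open>Y_0\<close>, dominated by \<open>|Y_0|\<close>, and the mean of \<open>Y_0\<close> would be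
nonnegative. Unboundedness is a tail event, so that by Kolmogorov's 0-1 law its probability is 0.
\<close>

lemma partial_sums_bounded_above:
  fixes Y :: "nat \<Rightarrow> 'a \<Rightarrow> real"
  assumes indep: "indep_vars (\<lambda>_. borel) Y UNIV"
    and distr: "\<And>i. distr M borel (Y i) = distr M borel (Y 0)"
    and int: "integrable M (Y 0)" and neg: "expectation (Y 0) < 0"
  shows "AE \<omega> in M. bdd_above (range (\<lambda>n. \<Sum>i<n. Y i \<omega>))"
proof -
  have rv[measurable]: "\<And>i. random_variable borel (Y i)"
    using indep by (auto simp: indep_vars_def)
  define mx :: "nat \<Rightarrow> (nat \<Rightarrow> real) \<Rightarrow> real" where
    "mx n x = Max ((\<lambda>k. \<Sum>i<k. x i) ` {..n})" for n x
  let ?X = "\<lambda>\<omega> i. Y i \<omega>" and ?X' = "\<lambda>\<omega> i. Y (Suc i) \<omega>"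
  have mx_Suc: "mx (Suc n) x = max 0 (x 0 + mx n (\<lambda>i. x (Suc i)))" for n x
  proof -
    have "(\<lambda>k. \<Sum>i<k. x i) ` {..Suc n} = insert 0 ((\<lambda>s. x 0 + s) ` (\<lambda>k. \<Sum>i<k. x (Suc i)) ` {..n})"
      by (simp add: atMost_Suc_eq_insert_0 image_image sum.lessThan_Suc_shift del: sum.lessThan_Suc)
    then show ?thesis
      unfolding mx_def by (simp add: mono_Max_commute[of "\<lambda>s. x 0 + s", symmetric] mono_def)
  qed
  have mx_mono: "mx n x \<le> mx (Suc n) x" for n x
    unfolding mx_def by (intro Max_mono) auto
  have mx_nonneg: "0 \<le> mx n x" for n x
    unfolding mx_def by (intro Max_ge) (auto intro!: image_eqI[of _ _ 0])
  have sum_le_mx: "(\<Sum>i<k. x i) \<le> mx n x" if "k \<le> n" for k n and x :: "nat \<Rightarrow> real"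
    unfolding mx_def using that by (intro Max_ge) auto
  have mx_abs: "mx n x \<le> (\<Sum>i<n. \<bar>x i\<bar>)" for n x
    unfolding mx_def
  proof (intro Max.boundedI)
    fix a assume "a \<in> (\<lambda>k. \<Sum>i<k. x i) ` {..n}"
    then obtain k where k: "k \<le> n" "a = (\<Sum>i<k. x i)" by auto
    have "a \<le> (\<Sum>i<k. \<bar>x i\<bar>)" unfolding k by (intro sum_mono) auto
    also have "\<dots> \<le> (\<Sum>i<n. \<bar>x i\<bar>)" using k by (intro sum_mono2) auto
    finally show "a \<le> (\<Sum>i<n. \<bar>x i\<bar>)" .
  qed auto
  have mx_meas[measurable]: "mx n \<in> borel_measurable (\<Pi>\<^sub>M i\<in>UNIV. borel)" for n
  proof (induction n)
    case 0
    then show ?case by (simp add: mx_def)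
  next
    case (Suc n)
    have [measurable]: "mx n \<in> borel_measurable (\<Pi>\<^sub>M i\<in>UNIV. borel)" by fact
    have [measurable]: "(\<lambda>x i. x (Suc i)) \<in> (\<Pi>\<^sub>M i\<in>UNIV. borel) \<rightarrow>\<^sub>M (\<Pi>\<^sub>M i\<in>UNIV. (borel :: real measure))"
      by (rule measurable_PiM_single') auto
    show ?case unfolding mx_Suc by measurable
  qed
  have X_meas[measurable]: "?X \<in> M \<rightarrow>\<^sub>M (\<Pi>\<^sub>M i\<in>UNIV. borel)" "?X' \<in> M \<rightarrow>\<^sub>M (\<Pi>\<^sub>M i\<in>UNIV. borel)"
    by (auto intro!: measurable_PiM_single')
  have indep': "indep_vars (\<lambda>_. borel) (\<lambda>i. Y (Suc i)) UNIV"
    using indep_vars_Suc[OF indep_vars_subset[OF indep]] by simp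
  have law: "distr M (\<Pi>\<^sub>M i\<in>UNIV. borel) ?X' = distr M (\<Pi>\<^sub>M i\<in>UNIV. borel) ?X"
  proof -
    have "distr M (\<Pi>\<^sub>M i\<in>UNIV. borel) ?X = (\<Pi>\<^sub>M i\<in>UNIV. distr M borel (Y i))"
      using indep_vars_iff_distr_eq_PiM[of UNIV Y "\<lambda>_. borel"] indep by (simp add: restrict_UNIV)
    moreover have "distr M (\<Pi>\<^sub>M i\<in>UNIV. borel) ?X' = (\<Pi>\<^sub>M i\<in>UNIV. distr M borel (Y (Suc i)))"
      using indep_vars_iff_distr_eq_PiM[of UNIV "\<lambda>i. Y (Suc i)" "\<lambda>_. borel"] indep' by (simp add: restrict_UNIV)
    moreover have "(\<lambda>i. distr M borel (Y (Suc i))) = (\<lambda>i. distr M borel (Y i))"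
      by (rule ext) (metis distr)
    ultimately show ?thesis by simp
  qed
  have intY: "integrable M (Y i)" for i
  proof -
    have "integrable (distr M borel (Y i)) (\<lambda>x. x)"
      unfolding distr[of i] using int by (simp add: integrable_distr_eq)
    then show ?thesis by (simp add: integrable_distr_eq)
  qed
  have int_mx: "integrable M (\<lambda>\<omega>. mx n (?X \<omega>))" "integrable M (\<lambda>\<omega>. mx n (?X' \<omega>))" for n
  proof -
    show "integrable M (\<lambda>\<omega>. mx n (?X \<omega>))"
    proof (rule Bochner_Integration.integrable_bound)
      show "integrable M (\<lambda>\<omega>. \<Sum>i<n. \<bar>Y i \<omega>\<bar>)" using intY by simp
    qed (use mx_abs mx_nonneg in \<open>auto simp: sum_nonneg\<close>)
    show "integrable M (\<lambda>\<omega>. mx n (?X' \<omega>))"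
    proof (rule Bochner_Integration.integrable_bound)
      show "integrable M (\<lambda>\<omega>. \<Sum>i<n. \<bar>Y (Suc i) \<omega>\<bar>)" using intY by simp
    qed (use mx_abs mx_nonneg in \<open>auto simp: sum_nonneg\<close>)
  qed
  have exp_eq: "expectation (\<lambda>\<omega>. mx n (?X' \<omega>)) = expectation (\<lambda>\<omega>. mx n (?X \<omega>))" for n
    using law integral_distr[of ?X M "\<Pi>\<^sub>M i\<in>UNIV. borel" "mx n"]
      integral_distr[of ?X' M "\<Pi>\<^sub>M i\<in>UNIV. borel" "mx n"] by simp
  have incr: "0 \<le> expectation (\<lambda>\<omega>. max (- mx n (?X' \<omega>)) (Y 0 \<omega>))" for n
  proof -
    have "expectation (\<lambda>\<omega>. max (- mx n (?X' \<omega>)) (Y 0 \<omega>))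
        = expectation (\<lambda>\<omega>. mx (Suc n) (?X \<omega>) - mx n (?X' \<omega>))"
      by (intro Bochner_Integration.integral_cong) (auto simp: mx_Suc)
    also have "\<dots> = expectation (\<lambda>\<omega>. mx (Suc n) (?X \<omega>)) - expectation (\<lambda>\<omega>. mx n (?X \<omega>))"
      by (simp add: int_mx exp_eq)
    also have "\<dots> \<ge> 0"
      using mx_mono by (auto intro!: integral_mono int_mx)
    finally show ?thesis .
  qed
  define U where "U = {\<omega> \<in> space M. \<not> bdd_above (range (\<lambda>n. \<Sum>i<n. Y i \<omega>))}"
  \<comment> \<open>Unboundedness does not depend on finitely many terms; hence \<open>U\<close> is a tail event.\<close>
  have bdd_shift: "bdd_above (range (\<lambda>n. \<Sum>i<n. Y i \<omega>)) \<longleftrightarrow> bdd_above (range (\<lambda>n. \<Sum>i<n. Y (i + k) \<omega>))" for k \<omega>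
  proof -
    have eq: "(\<Sum>i<n + k. Y i \<omega>) = (\<Sum>i<k. Y i \<omega>) + (\<Sum>i<n. Y (i + k) \<omega>)" for n
      using sum.atLeastLessThan_concat[of 0 k "n + k" "\<lambda>i. Y i \<omega>"]
        sum.shift_bounds_nat_ivl[of "\<lambda>i. Y i \<omega>" 0 k n] by (simp add: atLeast0LessThan)
    show ?thesis
    proof
      assume "bdd_above (range (\<lambda>n. \<Sum>i<n. Y i \<omega>))"
      then obtain B where B: "\<And>n. (\<Sum>i<n. Y i \<omega>) \<le> B" by (auto simp: bdd_above_def)
      show "bdd_above (range (\<lambda>n. \<Sum>i<n. Y (i + k) \<omega>))"
        using B[of "_ + k"] unfolding eq by (intro bdd_aboveI[of _ "B - (\<Sum>i<k. Y i \<omega>)"]) (auto simp: le_diff_eq add.commute)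
    next
      assume "bdd_above (range (\<lambda>n. \<Sum>i<n. Y (i + k) \<omega>))"
      then obtain B where B: "\<And>n. (\<Sum>i<n. Y (i + k) \<omega>) \<le> B" by (auto simp: bdd_above_def)
      have "(\<Sum>i<n. Y i \<omega>) \<le> max (Max ((\<lambda>n. \<Sum>i<n. Y i \<omega>) ` {..k})) ((\<Sum>i<k. Y i \<omega>) + B)" for n
      proof (cases "n \<le> k")
        case True
        then have "(\<Sum>i<n. Y i \<omega>) \<le> Max ((\<lambda>n. \<Sum>i<n. Y i \<omega>) ` {..k})" by (intro Max_ge) auto
        then show ?thesis by simp
      next
        case False
        then show ?thesis using eq[of "n - k"] B[of "n - k"] by simp
      qed
      then show "bdd_above (range (\<lambda>n. \<Sum>i<n. Y i \<omega>))" by (auto intro!: bdd_aboveI)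
    qed
  qed
  define A where "A i = {Y i -` B \<inter> space M | B. B \<in> sets borel}" for i
  have "prob U = 0 \<or> prob U = 1"
  proof (rule kolmogorov_0_1_law)
    show "indep_sets A UNIV" using indep unfolding indep_vars_def2 A_def by simp
    have "A i = sets (vimage_algebra (space M) (Y i) borel)" for i
      unfolding A_def by (subst sets_vimage_algebra2) auto
    then show "sigma_algebra (space M) (A i)" for i
      using sets.sigma_algebra_axioms[of "vimage_algebra (space M) (Y i) borel"] by simp
    show "U \<in> tail_events A"
      unfolding tail_events_def
    proof
      fix k :: nat
      let ?G = "\<Union> (A ` {k..})"
      have Asub: "?G \<subseteq> Pow (space M)" by (auto simp: A_def)
      define N where "N = sigma (space M) ?G"
      have [simp]: "space N = space M" and setsN: "sets N = sigma_sets (space M) ?G"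
        using Asub by (auto simp: N_def)
      have [measurable]: "Y (i + k) \<in> borel_measurable N" for i
      proof (rule measurableI)
        fix B :: "real set" assume "B \<in> sets borel"
        then have "Y (i + k) -` B \<inter> space M \<in> A (i + k)" by (auto simp: A_def)
        then have "Y (i + k) -` B \<inter> space M \<in> ?G" by (rule UN_I[rotated]) simp
        then show "Y (i + k) -` B \<inter> space N \<in> sets N" by (auto simp: setsN)
      qed auto
      have "U = {\<omega> \<in> space N. \<not> (\<exists>b::nat. \<forall>n. (\<Sum>i<n. Y (i + k) \<omega>) \<le> real b)}"
      proof -
        have "bdd_above (range f) \<longleftrightarrow> (\<exists>b::nat. \<forall>n. f n \<le> real b)" for f :: "nat \<Rightarrow> real"
          unfolding bdd_above_def by (auto intro: order.trans[OF _ real_nat_ceiling_ge])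
        then show ?thesis unfolding U_def bdd_shift[of _ k] by simp
      qed
      also have "\<dots> \<in> sets N" by measurable
      finally show "U \<in> sigma_sets (space M) ?G" by (simp add: setsN)
    qed
  qed
  moreover have Um[measurable]: "U \<in> events"
  proof -
    have "U = {\<omega> \<in> space M. \<not> (\<exists>b::nat. \<forall>n. (\<Sum>i<n. Y i \<omega>) \<le> real b)}"
      unfolding U_def bdd_above_def by (auto intro: order.trans[OF _ real_nat_ceiling_ge])
    also have "\<dots> \<in> events" by measurable
    finally show ?thesis .
  qed
  moreover have "prob U \<noteq> 1"
  proof
    assume "prob U = 1"
    then have AEU: "AE \<omega> in M. \<omega> \<in> U" by (simp add: AE_in_set_eq_1)
    have "(\<lambda>n. expectation (\<lambda>\<omega>. max (- mx n (?X' \<omega>)) (Y 0 \<omega>))) \<longlonglongrightarrow> expectation (Y 0)"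
    proof (rule integral_dominated_convergence)
      show "AE \<omega> in M. (\<lambda>n. max (- mx n (?X' \<omega>)) (Y 0 \<omega>)) \<longlonglongrightarrow> Y 0 \<omega>"
        using AEU
      proof eventually_elim
        case (elim \<omega>)
        then have "\<not> bdd_above (range (\<lambda>n. \<Sum>i<n. Y (i + 1) \<omega>))"
          unfolding U_def using bdd_shift[of \<omega> 1] by simp
        then obtain n where n: "- Y 0 \<omega> < (\<Sum>i<n. Y (Suc i) \<omega>)"
          by (auto simp: bdd_above_def not_le)
        have "max (- mx m (?X' \<omega>)) (Y 0 \<omega>) = Y 0 \<omega>" if "n \<le> m" for m
          using sum_le_mx[OF that, of "?X' \<omega>"] n by simp
        then show ?case
          by (intro tendsto_eventually) (auto simp: eventually_sequentially)
      qed
      show "AE \<omega> in M. norm (max (- mx n (?X' \<omega>)) (Y 0 \<omega>)) \<le> \<bar>Y 0 \<omega>\<bar>" for n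
        using mx_nonneg[of n "?X' _"] by (intro AE_I2) (auto simp: max_def)
    qed (use int in auto)
    then have "0 \<le> expectation (Y 0)"
      by (rule tendsto_lowerbound) (auto simp: incr)
    with neg show False by simp
  qed
  ultimately have "AE \<omega> in M. \<omega> \<notin> U"
    by (subst (asm) prob_eq_0) auto
  then show ?thesis
    by (rule AE_mp) (auto simp: U_def intro!: AE_I2)
qed

text \<open>
If the partial sums of \<open>Y_i - c\<close> stay below \<open>B\<close>, the averages of the \<open>Y_i\<close> stay below \<open>c + B/n\<close>; here \<open>c\<close> is
slightly larger than the mean.
\<close>

lemma averages_eventually_below:
  fixes Y :: "nat \<Rightarrow> 'a \<Rightarrow> real"
  assumes indep: "indep_vars (\<lambda>_. borel) Y UNIV"
    and distr: "\<And>i. distr M borel (Y i) = distr M borel (Y 0)"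
    and int: "integrable M (Y 0)"
  shows "AE \<omega> in M. \<forall>m::nat. \<forall>\<^sub>F n in sequentially. (\<Sum>i<n. Y i \<omega>) / n < expectation (Y 0) + 2 / Suc m"
  unfolding AE_all_countable
proof
  fix m :: nat
  have rv[measurable]: "\<And>i. random_variable borel (Y i)"
    using indep by (auto simp: indep_vars_def)
  define c where "c = expectation (Y 0) + 1 / Suc m"
  have "AE \<omega> in M. bdd_above (range (\<lambda>n. \<Sum>i<n. Y i \<omega> - c))"
  proof (rule partial_sums_bounded_above)
    show "indep_vars (\<lambda>_. borel) (\<lambda>i \<omega>. Y i \<omega> - c) UNIV"
      using indep_vars_compose2[OF indep, of "\<lambda>_ x. x - c" "\<lambda>_. borel"] by simp
    show "distr M borel (\<lambda>\<omega>. Y i \<omega> - c) = distr M borel (\<lambda>\<omega>. Y 0 \<omega> - c)" for i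
      using distr_distr[of "\<lambda>x. x - c" borel borel "Y i" M] distr_distr[of "\<lambda>x. x - c" borel borel "Y 0" M]
        distr[of i] by (simp add: comp_def)
    show "expectation (\<lambda>\<omega>. Y 0 \<omega> - c) < 0"
      using int by (simp add: c_def prob_space)
  qed (use int in auto)
  then show "AE \<omega> in M. \<forall>\<^sub>F n in sequentially. (\<Sum>i<n. Y i \<omega>) / n < expectation (Y 0) + 2 / Suc m"
  proof eventually_elim
    case (elim \<omega>)
    then obtain B where B: "\<And>n. (\<Sum>i<n. Y i \<omega> - c) \<le> B" by (auto simp: bdd_above_def)
    have "(\<lambda>n. B / real n) \<longlonglongrightarrow> 0" by (rule lim_const_over_n)
    then have "\<forall>\<^sub>F n in sequentially. B / real n < 1 / Suc m"
      by (rule order_tendstoD) auto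
    then show ?case
      using eventually_gt_at_top[of 0]
    proof eventually_elim
      case (elim n)
      have "(\<Sum>i<n. Y i \<omega>) \<le> B + n * c" using B[of n] by (simp add: sum_subtractf)
      then have "(\<Sum>i<n. Y i \<omega>) / n \<le> B / n + c" using elim by (simp add: field_simps)
      also have "\<dots> < 1 / Suc m + c" using elim by simp
      finally show ?case by (simp add: c_def)
    qed
  qed
qed

lemma strong_law_of_large_numbers:
  fixes Y :: "nat \<Rightarrow> 'a \<Rightarrow> real"
  assumes indep: "indep_vars (\<lambda>_. borel) Y UNIV"
    and distr: "\<And>i. distr M borel (Y i) = distr M borel (Y 0)"
    and int: "integrable M (Y 0)"
  shows "AE \<omega> in M. (\<lambda>n. (\<Sum>i<n. Y i \<omega>) / n) \<longlonglongrightarrow> expectation (Y 0)"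
proof -
  have rv[measurable]: "\<And>i. random_variable borel (Y i)"
    using indep by (auto simp: indep_vars_def)
  have "AE \<omega> in M. \<forall>m::nat. \<forall>\<^sub>F n in sequentially. (\<Sum>i<n. - Y i \<omega>) / n < expectation (\<lambda>\<omega>. - Y 0 \<omega>) + 2 / Suc m"
  proof (rule averages_eventually_below)
    show "indep_vars (\<lambda>_. borel) (\<lambda>i \<omega>. - Y i \<omega>) UNIV"
      using indep_vars_compose2[OF indep, of "\<lambda>_ x. - x" "\<lambda>_. borel"] by simp
    show "distr M borel (\<lambda>\<omega>. - Y i \<omega>) = distr M borel (\<lambda>\<omega>. - Y 0 \<omega>)" for i
      using distr_distr[of "\<lambda>x. - x" borel borel "Y i" M] distr_distr[of "\<lambda>x. - x" borel borel "Y 0" M]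
        distr[of i] by (simp add: comp_def)
  qed (use int in auto)
  then show ?thesis
    using averages_eventually_below[OF assms]
  proof eventually_elim
    case (elim \<omega>)
    show ?case
    proof (rule LIMSEQ_I)
      fix r :: real assume "0 < r"
      then obtain m where m: "2 / Suc m < r"
        using reals_Archimedean[of "r / 2"] by (auto simp: field_simps)
      have "\<forall>\<^sub>F n in sequentially. norm ((\<Sum>i<n. Y i \<omega>) / n - expectation (Y 0)) < r"
        using elim(1)[rule_format, of m] elim(2)[rule_format, of m]
      proof eventually_elim
        case (elim n)
        then show ?case using m by (auto simp: sum_negf abs_if)
      qed
      then show "\<exists>no. \<forall>n\<ge>no. norm ((\<Sum>i<n. Y i \<omega>) / n - expectation (Y 0)) < r"
        by (simp add: eventually_sequentially)
    qed
  qed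
qed

end

section \<open>Riemann sums for Stieltjes integrals\<close>

text \<open>
The functions for which \<^const>\<open>interval_measure\<close> assigns \<open>G b - G a\<close> to \<open>(a,b]\<close>.
\<close>

definition integrator :: "(real \<Rightarrow> real) \<Rightarrow> bool" where
  "integrator G \<longleftrightarrow> mono G \<and> (\<forall>a. continuous (at_right a) G)"

lemma integrator_measure_Ioc:
  assumes "integrator G" "a \<le> b"
  shows "emeasure (interval_measure G) {a<..b} = ennreal (G b - G a)"
    "measure (interval_measure G) {a<..b} = G b - G a"
  using assms emeasure_interval_measure_Ioc[of a b G] measure_interval_measure_Ioc[of a b G]
  by (auto simp: integrator_def mono_def)

lemma integrator_integrable_Ioc:
  assumes "integrator G" "0 \<le> t"
  shows "integrable (interval_measure G) (\<lambda>s. B * indicator {0<..t} s :: real)"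
  using integrator_measure_Ioc(1)[OF assms] by (intro integrable_mult_right) auto

abbreviation mesh :: "real \<Rightarrow> nat \<Rightarrow> nat \<Rightarrow> real" where
  "mesh t n i \<equiv> t * real i / real (Suc n)"

text \<open>
The integrand is approximated on the cell \<open>(x,y]\<close> by \<open>k x y\<close>, which may look at both end points. This covers
integrands that are products of a left-continuous factor, sampled at \<open>x\<close>, and a right-continuous one, sampled at
\<open>y\<close>. Convergence is dominated convergence for the step functions \<open>\<phi> n\<close>. Riemann sums provide what is needed below:
linearity in the integrator, measurability in parameters, and the interchange with expectations.
\<close>

lemma riemann_stieltjes:
  assumes G: "integrator G" and t: "0 \<le> t"
    and bound: "\<And>x y. 0 \<le> x \<Longrightarrow> x \<le> y \<Longrightarrow> y \<le> t \<Longrightarrow> \<bar>k x y\<bar> \<le> B"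
    and lim: "\<And>s x y. 0 < s \<Longrightarrow> s \<le> t \<Longrightarrow> (\<And>n. 0 \<le> x n \<and> x n < s \<and> s \<le> y n \<and> y n \<le> t) \<Longrightarrow>
       x \<longlonglongrightarrow> s \<Longrightarrow> y \<longlonglongrightarrow> s \<Longrightarrow> (\<lambda>n. k (x n) (y n)) \<longlonglongrightarrow> f s"
  defines "g \<equiv> \<lambda>n i. mesh t n i"
  shows "(\<lambda>n. \<Sum>i<Suc n. k (g n i) (g n (Suc i)) * (G (g n (Suc i)) - G (g n i)))
      \<longlonglongrightarrow> stieltjes f G t" (is "?sums \<longlonglongrightarrow> _")
    and "set_integrable (interval_measure G) {0<..t} f"
proof -
  let ?\<mu> = "interval_measure G"
  define \<phi> where "\<phi> n s = (\<Sum>i<Suc n. k (g n i) (g n (Suc i)) * indicator {g n i<..g n (Suc i)} s)" for n s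
  have g0: "g n 0 = 0" and gt: "g n (Suc n) = t" for n
    by (simp_all add: g_def del: of_nat_Suc)
  have g_mono: "g n i \<le> g n j" if "i \<le> j" for n i j
    using that t by (auto simp: g_def intro!: divide_right_mono mult_left_mono)
  have g_range: "0 \<le> g n i" "i \<le> Suc n \<Longrightarrow> g n i \<le> t" for n i
    using g_mono[of 0 i n] g_mono[of i "Suc n" n] g0 gt by auto
  have g_diff: "g n (Suc i) - g n i = t / Suc n" for n i
    unfolding g_def diff_divide_distrib[symmetric] right_diff_distrib[symmetric] by simp
  have disj: "i = j" if "s \<in> {g n i<..g n (Suc i)}" "s \<in> {g n j<..g n (Suc j)}" for s n i j
  proof (rule ccontr)
    assume "i \<noteq> j"
    then consider "Suc i \<le> j" | "Suc j \<le> i" by linarith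
    then show False using g_mono[of "Suc i" j n] g_mono[of "Suc j" i n] that by cases auto
  qed
  have cell: "\<exists>i<Suc n. s \<in> {g n i<..g n (Suc i)}" if s: "0 < s" "s \<le> t" for s n
  proof -
    define j where "j = (LEAST j. s \<le> g n j)"
    have j: "s \<le> g n j" unfolding j_def by (rule LeastI[of _ "Suc n"]) (use s gt in simp)
    have "j \<noteq> 0" using j s g0 by (cases j) auto
    then obtain i where i: "j = Suc i" by (cases j) auto
    have "\<not> s \<le> g n i" using not_less_Least[of i "\<lambda>j. s \<le> g n j"] i by (simp add: j_def)
    moreover have "j \<le> Suc n" unfolding j_def by (rule Least_le) (use s gt in simp)
    ultimately show ?thesis using i j by (intro exI[of _ i]) auto
  qed
  have \<phi>_cell: "\<phi> n s = k (g n i) (g n (Suc i))" if "i < Suc n" "s \<in> {g n i<..g n (Suc i)}" for n s i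
  proof -
    have "\<phi> n s = (\<Sum>j\<in>{i}. k (g n j) (g n (Suc j)) * indicator {g n j<..g n (Suc j)} s)"
      unfolding \<phi>_def
    proof (intro sum.mono_neutral_right ballI)
      fix j assume "j \<in> {..<Suc n} - {i}"
      then have "s \<notin> {g n j<..g n (Suc j)}" using disj[OF that(2), of j] by blast
      then show "k (g n j) (g n (Suc j)) * indicator {g n j<..g n (Suc j)} s = 0" by simp
    qed (use that in auto)
    also have "\<dots> = k (g n i) (g n (Suc i))" using that(2) by (simp only: sum.insert sum.empty finite.emptyI empty_iff indicator_simps simp_thms not_False_eq_True mult_1_right add_0_right)
    finally show ?thesis .
  qed
  have \<phi>_out: "\<phi> n s = 0" if "\<not> (0 < s \<and> s \<le> t)" for n s
    unfolding \<phi>_def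
  proof (intro sum.neutral ballI)
    fix i assume "i \<in> {..<Suc n}"
    then have "s \<notin> {g n i<..g n (Suc i)}" using that g_range(1)[of n i] g_range(2)[of "Suc i" n] by auto
    then show "k (g n i) (g n (Suc i)) * indicator {g n i<..g n (Suc i)} s = 0" by simp
  qed
  have \<phi>_meas[measurable]: "\<phi> n \<in> borel_measurable borel" for n
    unfolding \<phi>_def by measurable
  have B: "0 \<le> B" using bound[of 0 t] t by linarith
  have \<phi>_bound: "norm (\<phi> n s) \<le> B * indicator {0<..t} s" for n s
  proof (cases "0 < s \<and> s \<le> t")
    case True
    then obtain i where i: "i < Suc n" "s \<in> {g n i<..g n (Suc i)}" using cell by blast
    then show ?thesis
      using \<phi>_cell[OF i] bound[of "g n i" "g n (Suc i)"] g_range(1)[of n i] g_range(2)[of "Suc i" n]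
        g_mono[of i "Suc i" n] True by simp
  next
    case False
    then show ?thesis using \<phi>_out[OF False] B by simp
  qed
  have \<phi>_lim: "(\<lambda>n. \<phi> n s) \<longlonglongrightarrow> indicator {0<..t} s *\<^sub>R f s" for s
  proof (cases "0 < s \<and> s \<le> t")
    case True
    then have "\<forall>n. \<exists>i<Suc n. s \<in> {g n i<..g n (Suc i)}" using cell by blast
    then obtain i where i: "\<And>n. i n < Suc n" "\<And>n. s \<in> {g n (i n)<..g n (Suc (i n))}" by metis
    define x where "x n = g n (i n)" for n
    define y where "y n = g n (Suc (i n))" for n
    have t0: "(\<lambda>n. t / Suc n) \<longlonglongrightarrow> 0"
      using LIMSEQ_Suc[OF lim_const_over_n[of t]] by simp
    have xy: "0 \<le> x n \<and> x n < s \<and> s \<le> y n \<and> y n \<le> t" "y n - x n = t / Suc n" for n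
      using i(2)[of n] g_range(1)[of n] g_range(2)[of "Suc (i n)" n] i(1)[of n] g_diff[of n "i n"]
      by (auto simp: x_def y_def)
    have "x \<longlonglongrightarrow> s"
    proof (rule tendsto_sandwich)
      show "\<forall>\<^sub>F n in sequentially. s - t / Suc n \<le> x n" "\<forall>\<^sub>F n in sequentially. x n \<le> s"
        using xy by (auto intro!: always_eventually) (smt (verit))+
      show "(\<lambda>n. s - t / Suc n) \<longlonglongrightarrow> s" using tendsto_diff[OF tendsto_const t0, of s] by simp
    qed simp
    moreover have "y \<longlonglongrightarrow> s"
    proof (rule tendsto_sandwich)
      show "\<forall>\<^sub>F n in sequentially. y n \<le> s + t / Suc n" "\<forall>\<^sub>F n in sequentially. s \<le> y n"
        using xy by (auto intro!: always_eventually) (smt (verit))+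
      show "(\<lambda>n. s + t / Suc n) \<longlonglongrightarrow> s" using tendsto_add[OF tendsto_const t0, of s] by simp
    qed simp
    ultimately have "(\<lambda>n. k (x n) (y n)) \<longlonglongrightarrow> f s"
      using lim[of s x y] True xy by blast
    moreover have "\<phi> n s = k (x n) (y n)" for n
      using \<phi>_cell[OF i(1) i(2)] by (simp add: x_def y_def)
    ultimately show ?thesis using True by simp
  next
    case False
    then show ?thesis by (simp add: \<phi>_out[OF False])
  qed
  have f_meas[measurable]: "(\<lambda>s. indicator {0<..t} s *\<^sub>R f s) \<in> borel_measurable ?\<mu>"
    by (rule borel_measurable_LIMSEQ_metric[of \<phi>]) (use \<phi>_lim in auto)
  have dom: "integrable ?\<mu> (\<lambda>s. B * indicator {0<..t} s)"
    by (rule integrator_integrable_Ioc[OF G t])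
  show "set_integrable ?\<mu> {0<..t} f"
    unfolding set_integrable_def
    by (rule integrable_dominated_convergence[OF f_meas _ dom, of \<phi>]) (use \<phi>_lim \<phi>_bound in auto)
  have "(\<lambda>n. integral\<^sup>L ?\<mu> (\<phi> n)) \<longlonglongrightarrow> integral\<^sup>L ?\<mu> (\<lambda>s. indicator {0<..t} s *\<^sub>R f s)"
    by (rule integral_dominated_convergence[OF f_meas _ dom]) (use \<phi>_lim \<phi>_bound in auto)
  moreover have "integral\<^sup>L ?\<mu> (\<phi> n) = ?sums n" for n
  proof -
    have "integral\<^sup>L ?\<mu> (\<phi> n) = (\<Sum>i<Suc n. \<integral>s. k (g n i) (g n (Suc i)) * indicator {g n i<..g n (Suc i)} s \<partial>?\<mu>)"
      unfolding \<phi>_def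
      by (intro Bochner_Integration.integral_sum integrable_mult_right integrable_real_indicator)
        (auto simp: integrator_measure_Ioc(1)[OF G] g_mono)
    also have "\<dots> = ?sums n"
      using integrator_measure_Ioc(2)[OF G g_mono] by (intro sum.cong) auto
    finally show ?thesis .
  qed
  ultimately show "?sums \<longlonglongrightarrow> stieltjes f G t"
    by (simp add: stieltjes_def set_lebesgue_integral_def)
qed

lemma stieltjes_nonpos [simp]: "t \<le> 0 \<Longrightarrow> stieltjes f G t = 0"
  by (simp add: stieltjes_def set_lebesgue_integral_def)

text \<open>
Indefinite integrals of nonnegative functions are integrators again, which allows the uniform law of large
numbers to be applied to them.
\<close>

lemma stieltjes_integrator:
  assumes G: "integrator G" and nonneg: "\<And>s. 0 < s \<Longrightarrow> 0 \<le> f s"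
    and int: "\<And>t. 0 \<le> t \<Longrightarrow> set_integrable (interval_measure G) {0<..t} f"
  shows "integrator (stieltjes f G)"
  unfolding integrator_def
proof (intro conjI allI)
  let ?\<mu> = "interval_measure G"
  let ?f = "\<lambda>t s. indicator {0<..t} s *\<^sub>R f s"
  have int': "integrable ?\<mu> (?f t)" for t
  proof (cases "0 \<le> t")
    case False
    then have "{0<..t} = {}" by auto
    then show ?thesis by simp
  qed (use int in \<open>auto simp: set_integrable_def\<close>)
  have st: "stieltjes f G t = integral\<^sup>L ?\<mu> (?f t)" for t
    by (simp add: stieltjes_def set_lebesgue_integral_def)
  show "mono (stieltjes f G)"
    unfolding st by (intro monoI integral_mono int') (auto simp: indicator_def nonneg)
  fix a :: real
  have "(stieltjes f G \<longlongrightarrow> stieltjes f G a) (at_right a)"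
  proof (rule tendsto_at_right_sequentially[of a "a + 1"])
    fix S assume S: "\<And>n. a < S n" "\<And>n. S n < a + 1" "decseq S" "S \<longlonglongrightarrow> a"
    show "(\<lambda>n. stieltjes f G (S n)) \<longlonglongrightarrow> stieltjes f G a"
      unfolding st
    proof (rule integral_dominated_convergence[where w = "?f (a + 1)"])
      show "AE s in ?\<mu>. (\<lambda>n. ?f (S n) s) \<longlonglongrightarrow> ?f a s"
      proof (intro AE_I2 tendsto_eventually)
        fix s
        show "\<forall>\<^sub>F n in sequentially. ?f (S n) s = ?f a s"
        proof (cases "a < s")
          case True
          then have "\<forall>\<^sub>F n in sequentially. S n < s" using S(4) by (simp add: order_tendstoD)
          then show ?thesis by (rule eventually_mono) (use True in auto)
        next
          case False
          then have "s \<in> {0<..S n} \<longleftrightarrow> s \<in> {0<..a}" for n using S(1)[of n] by auto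
          then show ?thesis by (simp add: indicator_def)
        qed
      qed
      show "AE s in ?\<mu>. norm (?f (S n) s) \<le> ?f (a + 1) s" for n
        using S(2)[of n] by (intro AE_I2) (auto simp: indicator_def nonneg)
    qed (use int' in \<open>auto dest: borel_measurable_integrable\<close>)
  qed simp
  then show "continuous (at_right a) (stieltjes f G)" by (simp add: continuous_within)
qed

text \<open>
Continuity is required at positive times only, where left limits of processes on \<open>[0,\<infinity>)\<close> are determined.
\<close>

definition left_continuous :: "(real \<Rightarrow> real) \<Rightarrow> bool" where
  "left_continuous f \<longleftrightarrow> (\<forall>s>0. (f \<longlongrightarrow> f s) (at_left s))"

lemma riemann_stieltjes_left:
  assumes G: "integrator G" and t: "0 \<le> t" and f: "left_continuous f" and B: "\<And>s. \<bar>f s\<bar> \<le> B"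
  defines "g \<equiv> \<lambda>n i. mesh t n i"
  shows "(\<lambda>n. \<Sum>i<Suc n. f (g n i) * (G (g n (Suc i)) - G (g n i))) \<longlonglongrightarrow> stieltjes f G t"
    and "set_integrable (interval_measure G) {0<..t} f"
proof -
  have *: "(\<lambda>n. f (x n)) \<longlonglongrightarrow> f s"
    if "0 < s" and x: "\<And>n. 0 \<le> x n \<and> x n < s \<and> s \<le> y n \<and> y n \<le> t" "x \<longlonglongrightarrow> s" for s x y
  proof -
    have "filterlim x (at_left s) sequentially"
      using x by (intro tendsto_imp_filterlim_at_left) auto
    then show ?thesis
      using f \<open>0 < s\<close> by (auto simp: left_continuous_def intro: filterlim_compose)
  qed
  show "(\<lambda>n. \<Sum>i<Suc n. f (g n i) * (G (g n (Suc i)) - G (g n i))) \<longlonglongrightarrow> stieltjes f G t"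
    unfolding g_def by (rule riemann_stieltjes(1)[OF G t, of "\<lambda>x y. f x" B]) (use B in simp, rule *)
  show "set_integrable (interval_measure G) {0<..t} f"
    by (rule riemann_stieltjes(2)[OF G t, of "\<lambda>x y. f x" B]) (use B in simp, rule *)
qed

lemma integrator_scaled_sum:
  assumes "\<And>l. l \<in> L \<Longrightarrow> integrator (G l)" "0 \<le> (c :: real)"
  shows "integrator (\<lambda>t. c * (\<Sum>l\<in>L. G l t))"
  using assms unfolding integrator_def
  by (auto intro!: monoI mult_left_mono sum_mono continuous_intros dest: monoD)

lemma stieltjes_scaled_sum:
  assumes G: "\<And>l. l \<in> L \<Longrightarrow> integrator (G l)" "0 \<le> c"
    and f: "left_continuous f" "\<And>s. \<bar>f s\<bar> \<le> B"
  shows "stieltjes f (\<lambda>t. c * (\<Sum>l\<in>L. G l t)) t = c * (\<Sum>l\<in>L. stieltjes f (G l) t)"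
proof (cases "0 \<le> t")
  case t: True
  let ?g = "\<lambda>n i. mesh t n i"
  have 1: "(\<lambda>n. \<Sum>i<Suc n. f (?g n i) * (c * (\<Sum>l\<in>L. G l (?g n (Suc i))) - c * (\<Sum>l\<in>L. G l (?g n i))))
      \<longlonglongrightarrow> stieltjes f (\<lambda>t. c * (\<Sum>l\<in>L. G l t)) t"
    by (rule riemann_stieltjes_left(1)[OF integrator_scaled_sum[OF G] t f])
  have 2: "(\<lambda>n. c * (\<Sum>l\<in>L. \<Sum>i<Suc n. f (?g n i) * (G l (?g n (Suc i)) - G l (?g n i))))
      \<longlonglongrightarrow> c * (\<Sum>l\<in>L. stieltjes f (G l) t)"
    by (intro tendsto_intros riemann_stieltjes_left(1)[OF G(1) t f])
  have 3: "(\<lambda>n. \<Sum>i<Suc n. f (?g n i) * (c * (\<Sum>l\<in>L. G l (?g n (Suc i))) - c * (\<Sum>l\<in>L. G l (?g n i))))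
     = (\<lambda>n. c * (\<Sum>l\<in>L. \<Sum>i<Suc n. f (?g n i) * (G l (?g n (Suc i)) - G l (?g n i))))"
  proof
    fix n
    have aux: "f x * (c * (\<Sum>l\<in>L. G l y) - c * (\<Sum>l\<in>L. G l x)) = (\<Sum>l\<in>L. c * (f x * (G l y - G l x)))" for x y
    proof -
      have "f x * (c * (\<Sum>l\<in>L. G l y) - c * (\<Sum>l\<in>L. G l x))
          = c * (f x * ((\<Sum>l\<in>L. G l y) - (\<Sum>l\<in>L. G l x)))"
        by (simp add: algebra_simps)
      also have "(\<Sum>l\<in>L. G l y) - (\<Sum>l\<in>L. G l x) = (\<Sum>l\<in>L. G l y - G l x)"
        by (rule sum_subtractf[symmetric])
      finally show ?thesis unfolding sum_distrib_left .
    qed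
    show "(\<Sum>i<Suc n. f (?g n i) * (c * (\<Sum>l\<in>L. G l (?g n (Suc i))) - c * (\<Sum>l\<in>L. G l (?g n i))))
     = c * (\<Sum>l\<in>L. \<Sum>i<Suc n. f (?g n i) * (G l (?g n (Suc i)) - G l (?g n i)))"
      unfolding aux unfolding sum_distrib_left by (rule sum.swap)
  qed
  show ?thesis by (rule LIMSEQ_unique[OF 1[unfolded 3] 2])
qed simp

lemma stieltjes_le:
  assumes G: "integrator G" and t: "0 \<le> t" and f: "set_integrable (interval_measure G) {0<..t} f"
    and B: "\<And>s. 0 < s \<Longrightarrow> s \<le> t \<Longrightarrow> f s \<le> B"
  shows "stieltjes f G t \<le> B * (G t - G 0)"
proof -
  have "stieltjes f G t \<le> (LINT s:{0<..t}|interval_measure G. B)"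
    unfolding stieltjes_def
  proof (rule set_integral_mono[OF f])
    show "set_integrable (interval_measure G) {0<..t} (\<lambda>s. B)"
      using integrator_integrable_Ioc[OF G t, of B] by (simp add: set_integrable_def mult.commute)
  qed (use B in auto)
  also have "\<dots> = B * (G t - G 0)"
    using integrator_measure_Ioc(2)[OF G t] by (simp add: set_lebesgue_integral_def)
  finally show ?thesis .
qed

lemma stieltjes_diff_le:
  assumes G: "integrator G" and t: "0 \<le> t"
    and f: "left_continuous f1" "\<And>s. \<bar>f1 s\<bar> \<le> B" "left_continuous f2" "\<And>s. \<bar>f2 s\<bar> \<le> B"
    and e: "\<And>s. 0 < s \<Longrightarrow> s \<le> t \<Longrightarrow> \<bar>f1 s - f2 s\<bar> \<le> e"
  shows "\<bar>stieltjes f1 G t - stieltjes f2 G t\<bar> \<le> e * (G t - G 0)"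
proof -
  note i = riemann_stieltjes_left(2)[OF G t f(1,2)] riemann_stieltjes_left(2)[OF G t f(3,4)]
  have eq: "stieltjes (\<lambda>s. f1 s - f2 s) G t = stieltjes f1 G t - stieltjes f2 G t"
    "stieltjes (\<lambda>s. f2 s - f1 s) G t = stieltjes f2 G t - stieltjes f1 G t"
    unfolding stieltjes_def using i by simp_all
  have "f1 s - f2 s \<le> e" "f2 s - f1 s \<le> e" if "0 < s" "s \<le> t" for s
    using e[OF that] by auto
  then show ?thesis
    using stieltjes_le[OF G t set_integral_diff(1)[OF i], of e]
      stieltjes_le[OF G t set_integral_diff(1)[OF i(2,1)], of e] unfolding eq by (simp add: abs_le_iff)
qed

section \<open>Uniform convergence of averages of monotone processes\<close>

text \<open>
The set \<open>Q\<close>, which will be countable, contains the rational numbers and all discontinuities of \<open>F\<close>. Every point \<open>x\<close> has a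
neighbourhood on which the distance is eventually small. To the right of \<open>x\<close>, and on the left as well if \<open>F\<close> is
continuous at \<open>x\<close>, the values are squeezed between those at points of \<open>Q\<close> where \<open>F\<close> differs little. To the left of a
discontinuity the upper bound is instead \<open>Gn n x\<close>, which plays the role of the left limit of \<open>Fn n\<close>. Bisection
gives uniformity on the compact interval.
\<close>

lemma uniform_limit_mono:
  fixes F :: "real \<Rightarrow> real" and Fn :: "nat \<Rightarrow> real \<Rightarrow> real"
  assumes F: "mono F" "\<And>t. (F \<longlongrightarrow> F t) (at_right t)" and Fn: "\<And>n. mono (Fn n)"
    and Q: "\<rat> \<subseteq> Q" "\<And>t. t \<notin> Q \<Longrightarrow> isCont F t"
    and conv: "\<And>t. t \<in> Q \<Longrightarrow> (\<lambda>n. Fn n t) \<longlonglongrightarrow> F t"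
    and L: "\<And>t. t \<in> Q \<Longrightarrow> (\<lambda>k. F (t - 1 / real (Suc k))) \<longlonglongrightarrow> L t"
    and Gn: "\<And>n s t. t \<in> Q \<Longrightarrow> s < t \<Longrightarrow> Fn n s \<le> Gn n t"
    and conv_left: "\<And>t. t \<in> Q \<Longrightarrow> (\<lambda>n. Gn n t) \<longlonglongrightarrow> L t"
    and "a \<le> b"
  shows "uniform_limit {a..b} Fn F sequentially"
proof (rule uniform_limitI)
  fix e :: real assume e: "0 < e"
  define P where "P u v \<longleftrightarrow> (\<forall>\<^sub>F n in sequentially. \<forall>s\<in>{u..v}. dist (Fn n s) (F s) < e)" for u v
  have near: "\<forall>\<^sub>F n in sequentially. \<bar>Fn n t - F t\<bar> < e / 4" if "t \<in> Q" for t
    using tendstoD[OF conv[OF that], of "e / 4"] e by (simp add: dist_real_def)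
  have near_left: "\<forall>\<^sub>F n in sequentially. \<bar>Gn n t - L t\<bar> < e / 4" if "t \<in> Q" for t
    using tendstoD[OF conv_left[OF that], of "e / 4"] e by (simp add: dist_real_def)
  have right: "\<exists>r\<in>\<rat>. x < r \<and> F r < F x + e / 4" for x
  proof -
    have "\<forall>\<^sub>F y in at_right x. F y < F x + e / 4"
      using order_tendstoD(2)[OF F(2), of x "F x + e / 4"] e by simp
    then obtain b where b: "x < b" "\<And>y. x < y \<Longrightarrow> y < b \<Longrightarrow> F y < F x + e / 4"
      by (auto simp: eventually_at_right_field)
    from Rats_dense_in_real[OF b(1)] obtain r where "r \<in> \<rat>" "x < r" "r < b" by auto
    with b(2) show ?thesis by auto
  qed
  have "P a b"
    using \<open>a \<le> b\<close>
  proof (induction rule: Bolzano)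
    case (trans u v w)
    from trans(1,2) show ?case
      unfolding P_def by eventually_elim (metis atLeastAtMost_iff linear)
  next
    case (local x)
    obtain r where r: "r \<in> \<rat>" "x < r" "F r < F x + e / 4" using right[of x] by auto
    have "\<exists>l<x. \<forall>\<^sub>F n in sequentially. \<forall>s\<in>{l<..<r}. dist (Fn n s) (F s) < e"
    proof (cases "x \<in> Q")
      case True
      have Fl: "F s \<le> L x" if "s < x" for s
      proof (rule tendsto_lowerbound[OF L[OF True]])
        have "(\<lambda>k. x - 1 / real (Suc k)) \<longlonglongrightarrow> x - 0"
          by (intro tendsto_diff tendsto_const LIMSEQ_Suc[OF lim_const_over_n])
        then have "\<forall>\<^sub>F k in sequentially. s < x - 1 / real (Suc k)"
          using that by (intro order_tendstoD) auto
        then show "\<forall>\<^sub>F k in sequentially. F s \<le> F (x - 1 / real (Suc k))"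
          by (rule eventually_mono) (intro monoD[OF F(1)], simp)
      qed simp
      have "\<forall>\<^sub>F k in sequentially. L x - e / 4 < F (x - 1 / real (Suc k))"
        using L[OF True] e by (intro order_tendstoD) auto
      then obtain k where k: "L x - e / 4 < F (x - 1 / real (Suc k))"
        by (auto simp: eventually_sequentially)
      have "x - 1 / real (Suc k) < x" by simp
      from Rats_dense_in_real[OF this] obtain l where l: "l \<in> \<rat>" "x - 1 / real (Suc k) < l" "l < x" by auto
      have Fl': "L x - e / 4 < F l"
        using k monoD[OF F(1), of "x - 1 / real (Suc k)" l] l by linarith
      have "\<forall>\<^sub>F n in sequentially. \<forall>s\<in>{l<..<r}. dist (Fn n s) (F s) < e"
        using near[OF subsetD[OF Q(1) l(1)]] near_left[OF True] near[OF True] near[OF subsetD[OF Q(1) r(1)]]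
      proof eventually_elim
        case (elim n)
        have lr: "\<bar>Fn n l - F l\<bar> < e / 4" "\<bar>Fn n r - F r\<bar> < e / 4" using elim by auto
        show ?case
        proof
          fix s assume s: "s \<in> {l<..<r}"
          consider "s < x" | "x \<le> s" by linarith
          then show "dist (Fn n s) (F s) < e"
          proof cases
            case 1
            have "Fn n l \<le> Fn n s" "F l \<le> F s" using s by (auto intro!: monoD[OF F(1)] monoD[OF Fn])
            then show ?thesis
              using Gn[OF True 1, of n] Fl[OF 1] Fl' lr elim unfolding dist_real_def by linarith
          next
            case 2
            have "Fn n x \<le> Fn n s" "F x \<le> F s" "Fn n s \<le> Fn n r" "F s \<le> F r"
              using s 2 by (auto intro!: monoD[OF F(1)] monoD[OF Fn])
            then show ?thesis using lr elim r unfolding dist_real_def by linarith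
          qed
        qed
      qed
      then show ?thesis using l by blast
    next
      case False
      from Q(2)[OF False] have "(F \<longlongrightarrow> F x) (at_left x)"
        by (simp add: isCont_def filterlim_at_split)
      then have "\<forall>\<^sub>F y in at_left x. F x - e / 4 < F y" using e by (intro order_tendstoD) auto
      then obtain b where b: "b < x" "\<And>y. b < y \<Longrightarrow> y < x \<Longrightarrow> F x - e / 4 < F y"
        by (auto simp: eventually_at_left_field)
      from Rats_dense_in_real[OF b(1)] obtain l where l: "l \<in> \<rat>" "b < l" "l < x" by auto
      have Fl: "F x - e / 4 < F l" using b l by auto
      have "\<forall>\<^sub>F n in sequentially. \<forall>s\<in>{l<..<r}. dist (Fn n s) (F s) < e"
        using near[OF subsetD[OF Q(1) l(1)]] near[OF subsetD[OF Q(1) r(1)]]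
      proof eventually_elim
        case (elim n)
        have lr: "\<bar>Fn n l - F l\<bar> < e / 4" "\<bar>Fn n r - F r\<bar> < e / 4" using elim by auto
        show ?case
        proof
          fix s assume s: "s \<in> {l<..<r}"
          have "Fn n l \<le> Fn n s" "F l \<le> F s" "Fn n s \<le> Fn n r" "F s \<le> F r"
            using s by (auto intro!: monoD[OF F(1)] monoD[OF Fn])
          then show "dist (Fn n s) (F s) < e" using lr r Fl unfolding dist_real_def by linarith
        qed
      qed
      then show ?thesis using l by blast
    qed
    then obtain l where l: "l < x" "\<forall>\<^sub>F n in sequentially. \<forall>s\<in>{l<..<r}. dist (Fn n s) (F s) < e"
      by blast
    show ?case
    proof (intro exI[of _ "min (x - l) (r - x)"] conjI allI impI)
      fix u v assume "u \<le> x \<and> x \<le> v \<and> v - u < min (x - l) (r - x)"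
      then have "{u..v} \<subseteq> {l<..<r}" by auto
      then show "P u v" unfolding P_def using l(2) by (rule_tac eventually_mono) blast+
    qed (use l r in auto)
  qed
  then show "\<forall>\<^sub>F n in sequentially. \<forall>x\<in>{a..b}. dist (Fn n x) (F x) < e"
    by (simp add: P_def)
qed

text \<open>
\<open>X\<close> represents the common law of the sample \<open>Xs 1, Xs 2, \<dots>\<close>; expectations are expressed with it.
\<close>

locale iid_sample = prob_space M for M :: "'a measure" +
  fixes S :: "'s measure" and X :: "'a \<Rightarrow> 's" and Xs :: "nat \<Rightarrow> 'a \<Rightarrow> 's"
  assumes X_rv [measurable]: "X \<in> M \<rightarrow>\<^sub>M S"
    and Xs_indep: "indep_vars (\<lambda>_. S) Xs {1..}"
    and Xs_distr: "\<And>l. 1 \<le> l \<Longrightarrow> distr M S (Xs l) = distr M S X"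
begin

lemma Xs_rv: "1 \<le> l \<Longrightarrow> Xs l \<in> M \<rightarrow>\<^sub>M S"
  using Xs_indep by (auto simp: indep_vars_def)

lemma sample_average:
  assumes f [measurable]: "f \<in> borel_measurable S" and int: "integrable M (\<lambda>\<omega>. f (X \<omega>) :: real)"
  shows "AE \<omega> in M. (\<lambda>n. 1 / real n * (\<Sum>l=1..n. f (Xs l \<omega>))) \<longlonglongrightarrow> expectation (\<lambda>\<omega>. f (X \<omega>))"
proof -
  define Y where "Y i \<omega> = f (Xs (Suc i) \<omega>)" for i \<omega>
  define N where "N = (\<lambda>i::nat. if i = 0 then count_space UNIV else S)"
  have rv [measurable]: "Xs (Suc i) \<in> M \<rightarrow>\<^sub>M S" for i by (rule Xs_rv) simp
  have distr: "distr M borel (Y i) = distr M borel (\<lambda>\<omega>. f (X \<omega>))" for i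
  proof -
    have "distr M borel (Y i) = distr (distr M S (Xs (Suc i))) borel f"
      by (simp add: distr_distr comp_def Y_def[abs_def])
    also have "\<dots> = distr M borel (\<lambda>\<omega>. f (X \<omega>))"
      by (simp add: Xs_distr distr_distr comp_def)
    finally show ?thesis .
  qed
  have law: "integrable M (Y 0)" "expectation (Y 0) = expectation (\<lambda>\<omega>. f (X \<omega>))"
  proof -
    have "integrable (distr M borel (Y 0)) (\<lambda>x. x)" unfolding distr using int by (simp add: integrable_distr_eq)
    then show "integrable M (Y 0)" by (simp add: integrable_distr_eq Y_def[abs_def])
    have "expectation (Y 0) = integral\<^sup>L (distr M borel (Y 0)) (\<lambda>x. x)"
      by (subst integral_distr) (auto simp: Y_def[abs_def])
    also have "\<dots> = expectation (\<lambda>\<omega>. f (X \<omega>))" unfolding distr by (subst integral_distr) auto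
    finally show "expectation (Y 0) = expectation (\<lambda>\<omega>. f (X \<omega>))" .
  qed
  have "indep_vars (\<lambda>_. borel) (\<lambda>l \<omega>. f (Xs l \<omega>)) {1..}"
    by (rule indep_vars_compose2[OF Xs_indep]) simp
  then have "indep_vars (\<lambda>_. borel) Y UNIV"
    unfolding Y_def[abs_def] by (rule indep_vars_Suc)
  then have "AE \<omega> in M. (\<lambda>n. (\<Sum>i<n. Y i \<omega>) / n) \<longlonglongrightarrow> expectation (Y 0)"
    by (rule strong_law_of_large_numbers) (simp_all add: distr law)
  then show ?thesis
    by (simp add: law(2) Y_def sum.atLeast1_atMost_eq lessThan_atLeast0 field_simps)
qed

text \<open>
A measurable property that holds on the whole range of \<open>X\<close> is a property of its law, hence holds almost surely for
the sample.
\<close>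

lemma AE_sample:
  assumes "{x \<in> space S. P x} \<in> sets S" and "\<And>\<omega>. \<omega> \<in> space M \<Longrightarrow> P (X \<omega>)"
  shows "AE \<omega> in M. \<forall>l\<ge>1. P (Xs l \<omega>)"
proof -
  have "AE \<omega> in M. P (Xs l \<omega>)" if l: "1 \<le> l" for l
  proof -
    have "AE x in distr M S X. P x"
      using assms by (subst AE_distr_iff) auto
    then show ?thesis
      unfolding Xs_distr[OF l, symmetric] using Xs_rv[OF l] assms(1) by (subst (asm) AE_distr_iff) auto
  qed
  then show ?thesis by (simp add: AE_all_countable)
qed

text \<open>
The processes are extended from \<open>[0,\<theta>]\<close> to the real line by constants. The strong law of large numbers is applied
to the values and to the left limits \<open>YL\<close> at the countably many points of \<open>Q\<close>; that the means of the left limits are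
the left limits of the mean, and that the mean is right-continuous, is dominated convergence with the bound
\<open>|Y 0| + |Y \<theta>|\<close>.
\<close>

theorem glivenko_cantelli:
  fixes Y :: "real \<Rightarrow> 's \<Rightarrow> real"
  assumes \<theta>: "0 \<le> \<theta>"
    and meas: "\<And>t. 0 \<le> t \<Longrightarrow> t \<le> \<theta> \<Longrightarrow> Y t \<in> borel_measurable S"
    and int: "\<And>t. 0 \<le> t \<Longrightarrow> t \<le> \<theta> \<Longrightarrow> integrable M (\<lambda>\<omega>. Y t (X \<omega>))"
    and mono: "\<And>x s t. x \<in> space S \<Longrightarrow> 0 \<le> s \<Longrightarrow> s \<le> t \<Longrightarrow> t \<le> \<theta> \<Longrightarrow> Y s x \<le> Y t x"
    and rc: "\<And>x t. x \<in> space S \<Longrightarrow> 0 \<le> t \<Longrightarrow> t < \<theta> \<Longrightarrow> ((\<lambda>u. Y u x) \<longlongrightarrow> Y t x) (at_right t)"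
  shows "AE \<omega> in M. uniform_limit {0..\<theta>} (\<lambda>n t. 1 / real n * (\<Sum>l=1..n. Y t (Xs l \<omega>)))
     (\<lambda>t. expectation (\<lambda>\<omega>. Y t (X \<omega>))) sequentially"
proof -
  define Yc where "Yc t = Y (max 0 (min \<theta> t))" for t
  have meas_c [measurable]: "Yc t \<in> borel_measurable S" for t
    unfolding Yc_def using \<theta> by (intro meas) auto
  have int_c: "integrable M (\<lambda>\<omega>. Yc t (X \<omega>))" for t
    unfolding Yc_def using \<theta> by (intro int) auto
  have mono_c: "Yc s x \<le> Yc t x" if "x \<in> space S" "s \<le> t" for s t x
    unfolding Yc_def using \<theta> that by (intro mono) auto
  have rc_c: "((\<lambda>u. Yc u x) \<longlongrightarrow> Yc t x) (at_right t)" if x: "x \<in> space S" for t x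
  proof -
    consider "t < 0" | "0 \<le> t" "t < \<theta>" | "\<theta> \<le> t" by linarith
    then show ?thesis
    proof cases
      case 1
      then have "\<forall>\<^sub>F u in at_right t. Yc u x = Yc t x"
        using \<theta> by (auto simp: eventually_at_right_field Yc_def intro!: exI[of _ 0])
      then show ?thesis by (rule tendsto_eventually)
    next
      case 2
      have "\<forall>\<^sub>F u in at_right t. Y u x = Yc u x"
        using 2 by (auto simp: eventually_at_right_field Yc_def intro!: exI[of _ \<theta>])
      then show ?thesis
        using Lim_transform_eventually[OF rc[OF x 2]] 2 by (simp add: Yc_def)
    next
      case 3
      then have "\<forall>\<^sub>F u in at_right t. Yc u x = Yc t x"
        using \<theta> by (auto simp: eventually_at_right_field Yc_def intro!: exI[of _ "t + 1"])
      then show ?thesis by (rule tendsto_eventually)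
    qed
  qed
  define b where "b x = \<bar>Yc 0 x\<bar> + \<bar>Yc \<theta> x\<bar>" for x
  have bound: "norm (Yc t x) \<le> b x" if "x \<in> space S" for t x
  proof -
    have "Yc (min 0 t) x \<le> Yc t x" "Yc t x \<le> Yc (max \<theta> t) x" using that by (auto intro!: mono_c)
    moreover have "Yc (min 0 t) x = Yc 0 x" "Yc (max \<theta> t) x = Yc \<theta> x"
      using \<theta> by (auto simp: Yc_def min_def max_def)
    ultimately show ?thesis by (auto simp: b_def)
  qed
  have int_b: "integrable M (\<lambda>\<omega>. b (X \<omega>))"
    unfolding b_def by (intro Bochner_Integration.integrable_add integrable_abs int_c)
  have XS: "X \<omega> \<in> space S" if "\<omega> \<in> space M" for \<omega>
    using measurable_space[OF X_rv that] .
  \<comment> \<open>The left limit, written as the limit of a sequence so that it is measurable in \<open>x\<close>.\<close>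
  define YL where "YL t x = lim (\<lambda>k. Yc (t - 1 / real (Suc k)) x)" for t x
  have YL_meas [measurable]: "YL t \<in> borel_measurable S" for t
    unfolding YL_def by measurable
  have inc: "incseq (\<lambda>k. Yc (t - 1 / real (Suc k)) x)" if "x \<in> space S" for t x
    using that by (intro incseq_SucI mono_c) (auto intro!: divide_left_mono)
  have YL: "(\<lambda>k. Yc (t - 1 / real (Suc k)) x) \<longlonglongrightarrow> YL t x" if x: "x \<in> space S" for t x
  proof -
    have "Yc (t - 1 / real (Suc k)) x \<le> b x" for k using bound[OF x, of "t - 1 / real (Suc k)"] by simp
    then obtain l where "(\<lambda>k. Yc (t - 1 / real (Suc k)) x) \<longlonglongrightarrow> l"
      using incseq_convergent[OF inc[OF x]] by blast
    then have "convergent (\<lambda>k. Yc (t - 1 / real (Suc k)) x)"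
      by (rule convergentI)
    then show ?thesis unfolding YL_def by (simp add: convergent_LIMSEQ_iff)
  qed
  have YL_ge: "Yc s x \<le> YL t x" if x: "x \<in> space S" and st: "s < t" for s t x
  proof (rule tendsto_lowerbound[OF YL[OF x]])
    have "(\<lambda>k. t - 1 / real (Suc k)) \<longlonglongrightarrow> t - 0"
      by (intro tendsto_diff tendsto_const LIMSEQ_Suc[OF lim_const_over_n])
    then have "\<forall>\<^sub>F k in sequentially. s < t - 1 / real (Suc k)"
      using st by (intro order_tendstoD) auto
    then show "\<forall>\<^sub>F k in sequentially. Yc s x \<le> Yc (t - 1 / real (Suc k)) x"
      by (rule eventually_mono) (intro mono_c[OF x], simp)
  qed simp
  have YL_bound: "norm (YL t x) \<le> b x" if x: "x \<in> space S" for t x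
    by (rule tendsto_upperbound[OF tendsto_norm[OF YL[OF x]]]) (use bound[OF x] in auto)
  have int_L: "integrable M (\<lambda>\<omega>. YL t (X \<omega>))" for t
    by (rule Bochner_Integration.integrable_bound[OF int_b]) (use YL_bound XS in \<open>auto simp: b_def intro!: AE_I2\<close>)
  define F where "F t = expectation (\<lambda>\<omega>. Yc t (X \<omega>))" for t
  define L where "L t = expectation (\<lambda>\<omega>. YL t (X \<omega>))" for t
  have F_mono: "mono F"
    unfolding F_def by (intro monoI integral_mono int_c mono_c XS)
  have F_rc: "(F \<longlongrightarrow> F t) (at_right t)" for t
  proof (rule tendsto_at_right_sequentially[of t "t + 1"])
    fix u assume u: "\<And>n. t < u n" "u \<longlonglongrightarrow> t"
    have ur: "filterlim u (at_right t) sequentially"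
      using u by (intro tendsto_imp_filterlim_at_right) auto
    show "(\<lambda>n. F (u n)) \<longlonglongrightarrow> F t"
      unfolding F_def
      by (rule integral_dominated_convergence[OF _ _ int_b])
        (use bound XS in \<open>auto intro!: AE_I2 filterlim_compose[OF rc_c ur]\<close>)
  qed simp
  have F_left: "(\<lambda>k. F (t - 1 / real (Suc k))) \<longlonglongrightarrow> L t" for t
    unfolding F_def L_def
    by (rule integral_dominated_convergence[OF _ _ int_b]) (use bound XS YL in \<open>auto intro!: AE_I2 simp del: of_nat_Suc\<close>)
  define Q where "Q = \<rat> \<union> {t. \<not> isCont F t}"
  have Q: "countable Q"
    unfolding Q_def using mono_ctble_discont[OF F_mono] countable_rat by auto
  have "AE \<omega> in M. \<forall>t\<in>Q. (\<lambda>n. 1 / real n * (\<Sum>l=1..n. Yc t (Xs l \<omega>))) \<longlonglongrightarrow> F t"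
    unfolding F_def by (intro AE_ball_countable[THEN iffD2, OF Q] ballI sample_average meas_c int_c)
  moreover have "AE \<omega> in M. \<forall>t\<in>Q. (\<lambda>n. 1 / real n * (\<Sum>l=1..n. YL t (Xs l \<omega>))) \<longlonglongrightarrow> L t"
    unfolding L_def by (intro AE_ball_countable[THEN iffD2, OF Q] ballI sample_average YL_meas int_L)
  ultimately show ?thesis
    using AE_space
  proof eventually_elim
    case (elim \<omega>)
    have S: "Xs l \<omega> \<in> space S" if "l \<in> {1..n}" for l n
      using measurable_space[OF Xs_rv] elim(3) that by auto
    have "uniform_limit {0..\<theta>} (\<lambda>n t. 1 / real n * (\<Sum>l=1..n. Yc t (Xs l \<omega>))) F sequentially"
    proof (rule uniform_limit_mono[OF F_mono F_rc])
      show "mono (\<lambda>t. 1 / real n * (\<Sum>l=1..n. Yc t (Xs l \<omega>)))" for n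
        using S by (intro monoI mult_left_mono sum_mono mono_c) auto
      show "1 / real n * (\<Sum>l=1..n. Yc s (Xs l \<omega>)) \<le> 1 / real n * (\<Sum>l=1..n. YL t (Xs l \<omega>))" if "s < t" for n s t
        using S that by (intro mult_left_mono sum_mono YL_ge) auto
      show "isCont F t" if "t \<notin> Q" for t
        using that unfolding Q_def by blast
      show "\<rat> \<subseteq> Q" by (simp add: Q_def)
      show "(\<lambda>n. 1 / real n * (\<Sum>l=1..n. Yc t (Xs l \<omega>))) \<longlonglongrightarrow> F t" if "t \<in> Q" for t
        using elim(1) that by blast
      show "(\<lambda>n. 1 / real n * (\<Sum>l=1..n. YL t (Xs l \<omega>))) \<longlonglongrightarrow> L t" if "t \<in> Q" for t
        using elim(2) that by blast
    qed (rule F_left, rule \<theta>)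
    then show ?case
      unfolding F_def by (rule uniform_limit_cong'[THEN iffD1, rotated 2]) (auto simp: Yc_def)
  qed
qed

end

section \<open>Left limits and truncated hazards\<close>

lemma left_limit_monotone:
  fixes f :: "real \<Rightarrow> real"
  assumes s: "0 < s" and mono: "\<And>u v. 0 \<le> u \<Longrightarrow> u \<le> v \<Longrightarrow> v \<le> s \<Longrightarrow> f u \<le> f v"
  shows "\<exists>l. (f \<longlongrightarrow> l) (at_left s)"
proof
  let ?S = "f ` {0..<s}"
  have bdd: "bdd_above ?S" using mono by (intro bdd_aboveI[of _ "f s"]) auto
  have ne: "?S \<noteq> {}" using s by auto
  show "(f \<longlongrightarrow> Sup ?S) (at_left s)"
  proof (rule order_tendstoI)
    fix a assume "a < Sup ?S"
    then obtain u where u: "0 \<le> u" "u < s" "a < f u" using less_cSup_iff[OF ne bdd] by auto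
    have "a < f v" if "u < v" "v < s" for v using mono[of u v] u that by auto
    then show "\<forall>\<^sub>F v in at_left s. a < f v"
      using u by (auto simp: eventually_at_left_field)
  next
    fix a assume a: "Sup ?S < a"
    have "f v < a" if "0 < v" "v < s" for v
      using cSup_upper[OF _ bdd, of "f v"] a that by auto
    then show "\<forall>\<^sub>F v in at_left s. f v < a"
      using s by (auto simp: eventually_at_left_field)
  qed
qed

text \<open>
Together with \<open>D\<close>, the function \<open>p + D\<close> is nondecreasing on \<open>[0,T]\<close>; so \<open>p\<close> has finite variation and left limits.
\<close>

definition dominated_increments :: "(real \<Rightarrow> real) \<Rightarrow> bool" where
  "dominated_increments p \<longleftrightarrow> (\<forall>T. \<exists>D. \<forall>u v. 0 \<le> u \<longrightarrow> u \<le> v \<longrightarrow> v \<le> T \<longrightarrow> \<bar>p v - p u\<bar> \<le> D v - D u)"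

lemma dominated_increments_left_limit:
  assumes p: "dominated_increments p" and s: "0 < s"
  shows "(p \<longlongrightarrow> Lim (at_left s) p) (at_left s)"
proof -
  obtain D where D: "\<And>u v. 0 \<le> u \<Longrightarrow> u \<le> v \<Longrightarrow> v \<le> s \<Longrightarrow> \<bar>p v - p u\<bar> \<le> D v - D u"
    using p unfolding dominated_increments_def by blast
  have "\<exists>l. (D \<longlongrightarrow> l) (at_left s)"
    by (rule left_limit_monotone[OF s]) (use D in fastforce)
  then obtain l1 where l1: "(D \<longlongrightarrow> l1) (at_left s)" by blast
  have "\<exists>l. ((\<lambda>u. p u + D u) \<longlongrightarrow> l) (at_left s)"
    by (rule left_limit_monotone[OF s]) (use D in fastforce)
  then obtain l2 where l2: "((\<lambda>u. p u + D u) \<longlongrightarrow> l2) (at_left s)" by blast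
  have "(p \<longlongrightarrow> l2 - l1) (at_left s)"
    using tendsto_diff[OF l2 l1] by simp
  moreover from this have "Lim (at_left s) p = l2 - l1"
    by (intro tendsto_Lim) auto
  ultimately show ?thesis by simp
qed

text \<open>
The bound \<open>|p u - P s| < e/2\<close> on an interval to the left of \<open>s\<close> passes to the left limits \<open>P w\<close> at the interior points
\<open>w\<close>.
\<close>

lemma left_limits_left_continuous:
  fixes p :: "real \<Rightarrow> real"
  assumes lim: "\<And>s. 0 < s \<Longrightarrow> (p \<longlongrightarrow> P s) (at_left s)"
  shows "left_continuous P"
  unfolding left_continuous_def
proof (intro allI impI tendstoI)
  fix s e :: real assume s: "0 < s" and e: "0 < e"
  have "\<forall>\<^sub>F u in at_left s. dist (p u) (P s) < e / 2"
    using tendstoD[OF lim[OF s], of "e / 2"] e by simp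
  then obtain a where a: "a < s" "\<And>u. a < u \<Longrightarrow> u < s \<Longrightarrow> dist (p u) (P s) < e / 2"
    by (auto simp: eventually_at_left_field)
  have "dist (P w) (P s) < e" if w: "max a 0 < w" "w < s" for w
  proof -
    have "dist (P w) (P s) \<le> e / 2"
    proof (rule tendsto_upperbound)
      show "((\<lambda>u. dist (p u) (P s)) \<longlongrightarrow> dist (P w) (P s)) (at_left w)"
        using w by (intro tendsto_intros lim) auto
      show "\<forall>\<^sub>F u in at_left w. dist (p u) (P s) \<le> e / 2"
        using a(2) w by (auto simp: eventually_at_left_field intro!: exI[of _ a] less_imp_le)
    qed simp
    then show ?thesis using e by simp
  qed
  then show "\<forall>\<^sub>F w in at_left s. dist (P w) (P s) < e"
    using s a(1) by (auto simp: eventually_at_left_field intro!: exI[of _ "max a 0"])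
qed

definition hazard_weight :: "real \<Rightarrow> (real \<Rightarrow> real) \<Rightarrow> real \<Rightarrow> real" where
  "hazard_weight \<epsilon> p s = 1 / max (Lim (at_left s) p) \<epsilon>"

lemma trunc_hazard_stieltjes: "trunc_hazard \<epsilon> p q = stieltjes (hazard_weight \<epsilon> p) q"
  by (simp add: fun_eq_iff trunc_hazard_def hazard_weight_def[abs_def])

lemma hazard_weight_bounds:
  assumes "0 < \<epsilon>"
  shows "0 \<le> hazard_weight \<epsilon> p s" "\<bar>hazard_weight \<epsilon> p s\<bar> \<le> 1 / \<epsilon>"
proof -
  show "0 \<le> hazard_weight \<epsilon> p s" using assms by (auto simp: hazard_weight_def)
  then show "\<bar>hazard_weight \<epsilon> p s\<bar> \<le> 1 / \<epsilon>"
    using assms by (auto simp: hazard_weight_def intro!: divide_left_mono)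
qed

lemma hazard_weight_left_continuous:
  assumes p: "dominated_increments p" and "0 < \<epsilon>"
  shows "left_continuous (hazard_weight \<epsilon> p)"
proof -
  have "left_continuous (\<lambda>s. Lim (at_left s) p)"
    by (rule left_limits_left_continuous) (rule dominated_increments_left_limit[OF p])
  moreover have "max (Lim (at_left s) p) \<epsilon> \<noteq> 0" for s
    using \<open>0 < \<epsilon>\<close> by linarith
  ultimately show ?thesis
    unfolding left_continuous_def hazard_weight_def by (auto intro!: tendsto_intros tendsto_max)
qed

text \<open>
The map \<open>x \<mapsto> 1/(x \<or> \<epsilon>)\<close> is Lipschitz with constant \<open>1/\<epsilon>\<^sup>2\<close>, and uniform distances are inherited by left limits.
\<close>

lemma hazard_weight_diff:
  assumes p: "dominated_increments p1" "dominated_increments p2" and \<epsilon>: "0 < \<epsilon>"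
    and s: "0 < s" "s \<le> \<theta>" and e: "\<And>u. 0 \<le> u \<Longrightarrow> u \<le> \<theta> \<Longrightarrow> \<bar>p1 u - p2 u\<bar> \<le> e"
  shows "\<bar>hazard_weight \<epsilon> p1 s - hazard_weight \<epsilon> p2 s\<bar> \<le> e / \<epsilon>\<^sup>2"
proof -
  let ?a = "Lim (at_left s) p1" and ?b = "Lim (at_left s) p2"
  have "\<bar>?a - ?b\<bar> \<le> e"
  proof (rule tendsto_upperbound)
    show "((\<lambda>u. \<bar>p1 u - p2 u\<bar>) \<longlongrightarrow> \<bar>?a - ?b\<bar>) (at_left s)"
      by (intro tendsto_intros dominated_increments_left_limit p s)
    show "\<forall>\<^sub>F u in at_left s. \<bar>p1 u - p2 u\<bar> \<le> e"
      using e s by (auto simp: eventually_at_left_field intro!: exI[of _ 0])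
  qed simp
  then have num: "\<bar>max ?b \<epsilon> - max ?a \<epsilon>\<bar> \<le> e" by linarith
  have pos: "\<epsilon> \<le> max ?a \<epsilon>" "\<epsilon> \<le> max ?b \<epsilon>" by auto
  have "hazard_weight \<epsilon> p1 s - hazard_weight \<epsilon> p2 s = (max ?b \<epsilon> - max ?a \<epsilon>) / (max ?a \<epsilon> * max ?b \<epsilon>)"
    using \<epsilon> pos unfolding hazard_weight_def by (subst diff_frac_eq) auto
  also have "\<bar>\<dots>\<bar> = \<bar>max ?b \<epsilon> - max ?a \<epsilon>\<bar> / (max ?a \<epsilon> * max ?b \<epsilon>)"
    using \<epsilon> pos by (simp add: abs_mult)
  also have "\<dots> \<le> e / \<epsilon>\<^sup>2"
    unfolding power2_eq_square using num \<epsilon> pos by (intro frac_le mult_mono mult_pos_pos) auto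
  finally show ?thesis .
qed

lemma trunc_hazard_integrator:
  assumes q: "integrator q" and p: "dominated_increments p" and \<epsilon>: "0 < \<epsilon>"
  shows "integrator (trunc_hazard \<epsilon> p q)"
  unfolding trunc_hazard_stieltjes
  by (intro stieltjes_integrator[OF q] hazard_weight_bounds(1)[OF \<epsilon>]
      riemann_stieltjes_left(2)[OF q _ hazard_weight_left_continuous[OF p \<epsilon>] hazard_weight_bounds(2)[OF \<epsilon>]])

text \<open>
The weight and the integrator change one after the other: the change of the weight is uniformly small and is
integrated against bounded mass, and the integrals of the fixed limiting weight converge by assumption.
\<close>

lemma trunc_hazard_uniform_limit:
  assumes p: "dominated_increments p" "\<And>n. dominated_increments (pn n)"
    and q: "\<And>n. integrator (qn n)" and \<epsilon>: "0 < \<epsilon>" and \<theta>: "0 \<le> \<theta>"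
    and pn: "uniform_limit {0..\<theta>} pn p sequentially"
    and qn: "(\<lambda>n. qn n \<theta> - qn n 0) \<longlonglongrightarrow> c"
    and V: "uniform_limit {0..\<theta>} (\<lambda>n. stieltjes (hazard_weight \<epsilon> p) (qn n)) (trunc_hazard \<epsilon> p q) sequentially"
  shows "uniform_limit {0..\<theta>} (\<lambda>n. trunc_hazard \<epsilon> (pn n) (qn n)) (trunc_hazard \<epsilon> p q) sequentially"
proof (rule uniform_limitI)
  fix e :: real assume e: "0 < e"
  define C where "C = \<bar>c\<bar> + 1"
  have C: "0 < C" "c < C" by (auto simp: C_def)
  \<comment> \<open>The change of the weight is at most \<open>\<eta> / \<epsilon>\<^sup>2\<close> and the mass at most \<open>C\<close>, which makes a total of \<open>e / 2\<close>.\<close>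
  define \<eta> where "\<eta> = e / 2 * \<epsilon>\<^sup>2 / C"
  have \<eta>: "0 < \<eta>" using e \<epsilon> C by (simp add: \<eta>_def)
  have "\<forall>\<^sub>F n in sequentially. qn n \<theta> - qn n 0 < C"
    using qn C(2) by (rule order_tendstoD)
  moreover have "\<forall>\<^sub>F n in sequentially. \<forall>t\<in>{0..\<theta>}. dist (pn n t) (p t) < \<eta>"
    using uniform_limitD[OF pn \<eta>] .
  moreover have "\<forall>\<^sub>F n in sequentially. \<forall>t\<in>{0..\<theta>}. dist (stieltjes (hazard_weight \<epsilon> p) (qn n) t) (trunc_hazard \<epsilon> p q t) < e / 2"
    using uniform_limitD[OF V half_gt_zero[OF e]] .
  ultimately show "\<forall>\<^sub>F n in sequentially. \<forall>t\<in>{0..\<theta>}. dist (trunc_hazard \<epsilon> (pn n) (qn n) t) (trunc_hazard \<epsilon> p q t) < e"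
  proof eventually_elim
    case (elim n)
    show ?case
    proof
      fix t assume t: "t \<in> {0..\<theta>}"
      have m: "mono (qn n)" using q by (simp add: integrator_def)
      have "\<bar>stieltjes (hazard_weight \<epsilon> (pn n)) (qn n) t - stieltjes (hazard_weight \<epsilon> p) (qn n) t\<bar>
          \<le> \<eta> / \<epsilon>\<^sup>2 * (qn n t - qn n 0)"
      proof (rule stieltjes_diff_le[OF q])
        fix s assume s: "0 < s" "s \<le> t"
        show "\<bar>hazard_weight \<epsilon> (pn n) s - hazard_weight \<epsilon> p s\<bar> \<le> \<eta> / \<epsilon>\<^sup>2"
          using s t elim(2) by (intro hazard_weight_diff[OF p(2) p(1) \<epsilon>, of s \<theta>]) (auto simp: dist_real_def intro: less_imp_le)
      qed (use t p in \<open>auto intro!: hazard_weight_left_continuous hazard_weight_bounds \<epsilon>\<close>)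
      also have "\<dots> \<le> \<eta> / \<epsilon>\<^sup>2 * C"
        using elim(1) monoD[OF m, of t \<theta>] t \<eta> \<epsilon> by (intro mult_left_mono) auto
      also have "\<dots> = e / 2" using \<epsilon> C by (simp add: \<eta>_def)
      finally have "\<bar>trunc_hazard \<epsilon> (pn n) (qn n) t - stieltjes (hazard_weight \<epsilon> p) (qn n) t\<bar> \<le> e / 2"
        unfolding trunc_hazard_stieltjes .
      moreover have "dist (stieltjes (hazard_weight \<epsilon> p) (qn n) t) (trunc_hazard \<epsilon> p q t) < e / 2"
        using elim(3) t by blast
      ultimately show "dist (trunc_hazard \<epsilon> (pn n) (qn n) t) (trunc_hazard \<epsilon> p q t) < e"
        unfolding dist_real_def by linarith
    qed
  qed
qed

section \<open>Paths with finitely many jumps on compacts\<close>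

text \<open>
A set of possible jump times; \<open>z\<close> need not jump at each of them. Everything about jump paths is derived from this
description.
\<close>

definition skeleton :: "(real \<Rightarrow> 'j) \<Rightarrow> real set \<Rightarrow> bool" where
  "skeleton z D \<longleftrightarrow> D \<subseteq> {0<..} \<and> (\<forall>t. finite (D \<inter> {..t})) \<and>
     (\<forall>x y. 0 \<le> x \<longrightarrow> x \<le> y \<longrightarrow> D \<inter> {x<..y} = {} \<longrightarrow> z x = z y)"

lemma jump_path_skeleton:
  assumes "jump_path z"
  obtains D where "skeleton z D"
proof -
  obtain T :: "nat \<Rightarrow> real" where T: "T 0 = 0" "strict_mono T" "filterlim T at_top sequentially"
    and z: "\<And>n s. s \<in> {T n..<T (Suc n)} \<Longrightarrow> z s = z (T n)"
    using assms unfolding jump_path_def by blast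
  define D where "D = T ` {1..}"
  have fin: "finite (D \<inter> {..t})" for t
  proof -
    obtain m where m: "\<And>n. m \<le> n \<Longrightarrow> t < T n"
      using T(3) by (auto simp: filterlim_at_top_dense eventually_sequentially)
    have "D \<inter> {..t} \<subseteq> T ` {..<m}"
      using m by (force simp: D_def not_less[symmetric])
    then show ?thesis by (rule finite_subset) simp
  qed
  have const: "z x = z y" if xy: "0 \<le> x" "x \<le> y" "D \<inter> {x<..y} = {}" for x y
  proof -
    obtain n0 where "x < T n0"
      using T(3) by (auto simp: filterlim_at_top_dense eventually_sequentially)
    define n where "n = (LEAST n. x < T n)"
    have n: "x < T n" unfolding n_def by (rule LeastI) fact
    have "n \<noteq> 0" using n xy(1) T(1) by (cases n) auto
    then obtain m where m: "n = Suc m" by (cases n) auto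
    have "T m \<le> x" using not_less_Least[of m "\<lambda>n. x < T n"] m by (simp add: n_def)
    have "T n \<in> D" using m by (auto simp: D_def)
    then have "y < T n" using xy(3) n by force
    then have "z y = z (T m)" using xy(2) \<open>T m \<le> x\<close> m by (intro z) auto
    moreover have "z x = z (T m)" using n \<open>T m \<le> x\<close> m by (intro z) auto
    ultimately show ?thesis by simp
  qed
  have pos: "D \<subseteq> {0<..}"
    using strict_monoD[OF T(2), of 0] T(1) by (auto simp: D_def)
  have "skeleton z D"
    unfolding skeleton_def using pos fin const by blast
  then show ?thesis by (rule that)
qed

lemma skeletonD:
  assumes "skeleton z D"
  shows "D \<subseteq> {0<..}" "finite (D \<inter> {..t})" "0 \<le> x \<Longrightarrow> x \<le> y \<Longrightarrow> D \<inter> {x<..y} = {} \<Longrightarrow> z x = z y"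
  using assms by (auto simp: skeleton_def)

lemma skeleton_gap:
  assumes "skeleton z D"
  obtains d where "0 < d" "D \<inter> {x<..<x + d} = {}" "D \<inter> {x - d<..<x} = {}"
proof -
  obtain d where d: "0 < d" "\<And>y. y \<in> D \<inter> {..x + 1} \<Longrightarrow> y \<noteq> x \<Longrightarrow> d \<le> dist x y"
    using finite_set_avoid[OF skeletonD(2)[OF assms], of "x + 1" x] by blast
  have "\<not> d \<le> dist x y" if "y \<in> {x<..<x + min d 1} \<union> {x - min d 1<..<x}" for y
    using that by (auto simp: dist_real_def)
  then have *: "D \<inter> ({x<..<x + min d 1} \<union> {x - min d 1<..<x}) = {}"
    using d(2) by fastforce
  show ?thesis
    by (rule that[of "min d 1"]) (use d(1) * in auto)
qed

lemma jump_path_locally_constant: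
  assumes "jump_path z" "0 \<le> x"
  obtains d where "0 < d" "\<And>y. x \<le> y \<Longrightarrow> y < x + d \<Longrightarrow> z y = z x"
    "\<And>y. 0 \<le> y \<Longrightarrow> x - d < y \<Longrightarrow> y < x \<Longrightarrow> z y = left_state z x"
proof -
  obtain D where D: "skeleton z D" using jump_path_skeleton[OF assms(1)] .
  obtain d where d: "0 < d" "D \<inter> {x<..<x + d} = {}" "D \<inter> {x - d<..<x} = {}"
    using skeleton_gap[OF D] .
  have right: "z y = z x" if "x \<le> y" "y < x + d" for y
  proof -
    have "{x<..y} \<subseteq> {x<..<x + d}" using that by auto
    with d(2) have "D \<inter> {x<..y} = {}" by blast
    then show ?thesis using skeletonD(3)[OF D assms(2) that(1)] by simp
  qed
  have left: "z y = z y'" if "0 \<le> y" "x - d < y" "y \<le> y'" "y' < x" for y y'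
  proof -
    have "{y<..y'} \<subseteq> {x - d<..<x}" using that by auto
    with d(3) have "D \<inter> {y<..y'} = {}" by blast
    then show ?thesis using skeletonD(3)[OF D that(1,3)] by simp
  qed
  have "z y = left_state z x" if y: "0 \<le> y" "x - d < y" "y < x" for y
  proof -
    have ev: "\<forall>\<^sub>F s in at_left x. z s = z y"
      unfolding eventually_at_left_field
    proof (intro exI[of _ y] conjI allI impI)
      fix s assume "y < s" "s < x"
      then show "z s = z y" using y by (intro left[symmetric]) auto
    qed (rule y(3))
    have "left_state z x = z y"
      unfolding left_state_def
    proof (rule the_equality)
      show "\<forall>\<^sub>F s in at_left x. z s = z y" by (rule ev)
      fix k assume "\<forall>\<^sub>F s in at_left x. z s = k"
      with ev have "\<forall>\<^sub>F s in at_left x. k = z y" by eventually_elim simp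
      then show "k = z y" by simp
    qed
    then show ?thesis by simp
  qed
  with d(1) right show ?thesis by (rule that)
qed

text \<open>
Bisection: at a point where left limit and value agree, the path is constant in a neighbourhood.
\<close>

lemma constant_if_no_jump:
  assumes z: "jump_path z" and st: "0 \<le> s" "s \<le> t"
    and no_jump: "\<And>u. s < u \<Longrightarrow> u \<le> t \<Longrightarrow> left_state z u = z u"
  shows "z t = z s"
proof -
  define P where "P u v \<longleftrightarrow> (s \<le> u \<longrightarrow> v \<le> t \<longrightarrow> z u = z v)" for u v
  have "P s t"
    using st(2)
  proof (induction rule: Bolzano)
    case (local x)
    obtain d where d: "0 < d" "\<And>y. x \<le> y \<Longrightarrow> y < x + d \<Longrightarrow> z y = z x"
      "\<And>y. 0 \<le> y \<Longrightarrow> x - d < y \<Longrightarrow> y < x \<Longrightarrow> z y = left_state z x"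
      using jump_path_locally_constant[OF z, of x] local(1) st by (metis order.trans)
    show ?case
    proof (intro exI[of _ d] conjI allI impI)
      fix u v assume "u \<le> x \<and> x \<le> v \<and> v - u < d"
      show "P u v"
        unfolding P_def
      proof (intro impI)
        assume "s \<le> u" "v \<le> t"
        note uv = this \<open>u \<le> x \<and> x \<le> v \<and> v - u < d\<close>
        have "z v = z x" using uv by (intro d(2)) auto
        moreover have "z u = z x"
        proof (cases "u = x")
          case False
          then have "z u = left_state z x" using uv st by (intro d(3)) auto
          also have "\<dots> = z x" using False uv by (intro no_jump) auto
          finally show ?thesis .
        qed simp
        ultimately show "z u = z v" by simp
      qed
    qed fact
  qed (auto simp: P_def)
  then show ?thesis by (simp add: P_def)
qed

lemma left_state_in_cell:
  assumes D: "skeleton z D" and z: "jump_path z" and "0 \<le> a" "a < u" "D \<inter> {a<..<u} = {}"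
  shows "left_state z u = z a"
proof -
  obtain d where d: "0 < d" "\<And>y. 0 \<le> y \<Longrightarrow> u - d < y \<Longrightarrow> y < u \<Longrightarrow> z y = left_state z u"
    using jump_path_locally_constant[OF z, of u] assms by (metis less_imp_le order.trans)
  obtain y where y: "max a (u - d) < y" "y < u"
    using dense[of "max a (u - d)" u] d assms by auto
  have "D \<inter> {a<..y} = {}" using y assms by auto
  then have "z a = z y" using y assms by (intro skeletonD(3)[OF D]) auto
  also have "\<dots> = left_state z u" using y assms by (intro d(2)) auto
  finally show ?thesis by simp
qed

abbreviation jumps :: "(real \<Rightarrow> 'j) \<Rightarrow> 'j \<Rightarrow> 'j \<Rightarrow> real set" where
  "jumps z j k \<equiv> {s. left_state z s = j \<and> z s = k}"

lemma jumps_in_skeleton: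
  assumes D: "skeleton z D" and z: "jump_path z" and jk: "j \<noteq> k"
  shows "jumps z j k \<inter> {0<..t} \<subseteq> D \<inter> {..t}"
proof
  fix u assume u: "u \<in> jumps z j k \<inter> {0<..t}"
  obtain d where d: "0 < d" "D \<inter> {u - d<..<u} = {}"
    using skeleton_gap[OF D] .
  obtain y where y: "max 0 (u - d) < y" "y < u"
    using dense[of "max 0 (u - d)" u] d u by auto
  have "left_state z u = z y"
    using y d(2) by (intro left_state_in_cell[OF D z]) auto
  moreover have "z y = z u" if "u \<notin> D"
  proof (rule skeletonD(3)[OF D])
    show "D \<inter> {y<..u} = {}" using that d(2) y by (auto, smt (verit) IntI empty_iff greaterThanLessThan_iff)
  qed (use y in auto)
  ultimately show "u \<in> D \<inter> {..t}" using u jk by auto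
qed

lemma jump_count_diff:
  assumes z: "jump_path z" and jk: "j \<noteq> k" and "0 \<le> a" "a \<le> b"
  shows "jump_count z j k b - jump_count z j k a = real (card (jumps z j k \<inter> {a<..b}))"
    and "finite (jumps z j k \<inter> {a<..b})"
proof -
  obtain D where D: "skeleton z D" using jump_path_skeleton[OF z] .
  have fin: "finite (jumps z j k \<inter> {0<..t})" for t
    using jumps_in_skeleton[OF D z jk, of t] skeletonD(2)[OF D, of t] by (rule finite_subset)
  have jc: "jump_count z j k t = real (card (jumps z j k \<inter> {0<..t}))" for t
    unfolding jump_count_def by (intro arg_cong[of _ _ "\<lambda>A. real (card A)"]) auto
  show fin': "finite (jumps z j k \<inter> {a<..b})"
    by (rule finite_subset[OF _ fin[of b]]) (use assms in auto)
  have "jumps z j k \<inter> {0<..b} = (jumps z j k \<inter> {0<..a}) \<union> (jumps z j k \<inter> {a<..b})"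
    using assms by auto
  then have "card (jumps z j k \<inter> {0<..b}) = card (jumps z j k \<inter> {0<..a}) + card (jumps z j k \<inter> {a<..b})"
    using fin[of a] fin' by (simp add: card_Un_disjoint disjoint_iff)
  then show "jump_count z j k b - jump_count z j k a = real (card (jumps z j k \<inter> {a<..b}))"
    by (simp add: jc)
qed

lemma jump_count_nonpos: "t \<le> 0 \<Longrightarrow> jump_count z j k t = 0"
  by (simp add: jump_count_def)

lemma jump_count_nonneg: "0 \<le> jump_count z j k t"
  by (simp add: jump_count_def)

text \<open>
On a cell with at most one possible jump time, the states at the end points reveal whether a jump from \<open>j\<close> to \<open>k\<close> took
place. This turns the counting process into a limit of functions of finitely many states.
\<close>

lemma jump_count_cell:
  assumes z: "jump_path z" and jk: "j \<noteq> k" and ab: "0 \<le> a" "a \<le> b"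
    and D: "skeleton z D" "\<And>u v. u \<in> D \<inter> {a<..b} \<Longrightarrow> v \<in> D \<inter> {a<..b} \<Longrightarrow> u = v"
  shows "jump_count z j k b - jump_count z j k a = of_bool (z a = j \<and> z b = k)"
proof -
  have sub: "jumps z j k \<inter> {a<..b} \<subseteq> D \<inter> {a<..b}"
    using jumps_in_skeleton[OF D(1) z jk, of b] ab by auto
  have "jumps z j k \<inter> {a<..b} = (if z a = j \<and> z b = k then D \<inter> {a<..b} else {})
     \<and> (z a = j \<and> z b = k \<longrightarrow> card (D \<inter> {a<..b}) = 1)"
  proof (cases "D \<inter> {a<..b} = {}")
    case True
    then have "z a = z b" using skeletonD(3)[OF D(1) ab] by simp
    then show ?thesis using True sub jk by auto
  next
    case False
    then obtain u where u: "D \<inter> {a<..b} = {u}" using D(2) by blast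
    have "u \<in> {a<..b}" using u by blast
    then have au: "a < u" "u \<le> b" by auto
    have "x = u" if "x \<in> D" "a < x" "x \<le> b" for x
    proof -
      have "x \<in> D \<inter> {a<..b}" using that by simp
      then show ?thesis unfolding u by simp
    qed
    then have "x \<notin> {a<..<u}" "x \<notin> {u<..b}" if "x \<in> D" for x
      using au that by force+
    then have "D \<inter> {a<..<u} = {}" "D \<inter> {u<..b} = {}" by blast+
    then have *: "left_state z u = z a" "z u = z b"
      using left_state_in_cell[OF D(1) z ab(1) au(1)] skeletonD(3)[OF D(1), of u b] ab au by auto
    have "jumps z j k \<inter> {a<..b} = (if u \<in> jumps z j k then {u} else {})"
      using sub u by auto
    moreover have "u \<in> jumps z j k \<longleftrightarrow> z a = j \<and> z b = k" using * by simp
    ultimately show ?thesis using u by simp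
  qed
  then show ?thesis using jump_count_diff(1)[OF z jk ab] by auto
qed

lemma jump_count_integrator:
  assumes z: "jump_path z" and jk: "j \<noteq> k"
  shows "integrator (jump_count z j k)"
  unfolding integrator_def
proof (intro conjI allI monoI)
  fix a b :: real assume ab: "a \<le> b"
  show "jump_count z j k a \<le> jump_count z j k b"
  proof (cases "0 \<le> a")
    case True
    then show ?thesis using jump_count_diff(1)[OF z jk True ab] by linarith
  next
    case False
    then show ?thesis by (simp add: jump_count_nonpos jump_count_nonneg)
  qed
next
  fix a :: real
  have "\<forall>\<^sub>F b in at_right a. jump_count z j k b = jump_count z j k a"
  proof (cases "0 \<le> a")
    case True
    obtain D where D: "skeleton z D" using jump_path_skeleton[OF z] .
    obtain d where d: "0 < d" "D \<inter> {a<..<a + d} = {}" using skeleton_gap[OF D] .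
    have "jump_count z j k b = jump_count z j k a" if b: "a < b" "b < a + d" for b
    proof -
      have none: "D \<inter> {a<..b} = {}" using d b by auto
      then have "z a = z b" using skeletonD(3)[OF D True] b by simp
      then have "(z a = j \<and> z b = k) = False" using jk by auto
      then show ?thesis using jump_count_cell[OF z jk True _ D, of b] none b by (simp only:) simp
    qed
    then show ?thesis using d(1) by (auto simp: eventually_at_right_field intro!: exI[of _ "a + d"])
  next
    case False
    then show ?thesis by (auto simp: eventually_at_right_field jump_count_nonpos intro!: exI[of _ 0])
  qed
  then show "continuous (at_right a) (jump_count z j k)"
    by (simp add: continuous_within tendsto_eventually)
qed

text \<open>
Once the mesh is finer than the smallest distance between possible jump times in \<open>[0,t]\<close>, the sum over the cells is
exact.
\<close>

lemma jump_count_grid: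
  assumes z: "jump_path z" and jk: "j \<noteq> k" and t: "0 \<le> t"
  defines "g \<equiv> \<lambda>n i. mesh t n i"
  shows "(\<lambda>n. \<Sum>i<Suc n. of_bool (z (g n i) = j \<and> z (g n (Suc i)) = k)) \<longlonglongrightarrow> jump_count z j k t"
proof (rule tendsto_eventually)
  obtain D where D: "skeleton z D" using jump_path_skeleton[OF z] .
  define A where "A = D \<inter> {..t}"
  have A: "finite A" using skeletonD(2)[OF D] by (simp add: A_def)
  define \<delta> where "\<delta> = Min (insert 1 ((\<lambda>(x, y). \<bar>x - y\<bar>) ` {(x, y). x \<in> A \<and> y \<in> A \<and> x \<noteq> y}))"
  have fin: "finite ((\<lambda>(x, y). \<bar>x - y\<bar>) ` {(x, y). x \<in> A \<and> y \<in> A \<and> x \<noteq> y})"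
    by (rule finite_imageI, rule finite_subset[of _ "A \<times> A"]) (use A in auto)
  have \<delta>: "0 < \<delta>" unfolding \<delta>_def using fin by (subst Min_gr_iff) auto
  have gap: "\<delta> \<le> \<bar>x - y\<bar>" if "x \<in> A" "y \<in> A" "x \<noteq> y" for x y
    unfolding \<delta>_def using fin that by (intro Min_le) auto
  have g_mono: "g n i \<le> g n (Suc i)" "0 \<le> g n i" for n i
    using t by (auto simp: g_def intro!: divide_right_mono mult_left_mono)
  have g_le: "g n (Suc i) \<le> t" if "i < Suc n" for n i
    using t that mult_left_mono[of "real (Suc i)" "real (Suc n)" t]
    by (auto simp: g_def divide_le_eq simp del: of_nat_Suc)
  have g_diff: "g n (Suc i) - g n i = t / Suc n" for n i
    unfolding g_def diff_divide_distrib[symmetric] right_diff_distrib[symmetric] by simp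
  have g_end: "g n 0 = 0" "g n (Suc n) = t" for n
    by (simp_all add: g_def del: of_nat_Suc)
  have "(\<lambda>n. t / Suc n) \<longlonglongrightarrow> 0" using LIMSEQ_Suc[OF lim_const_over_n[of t]] by simp
  then have "\<forall>\<^sub>F n in sequentially. t / Suc n < \<delta>" by (rule order_tendstoD) (rule \<delta>)
  then show "\<forall>\<^sub>F n in sequentially. (\<Sum>i<Suc n. of_bool (z (g n i) = j \<and> z (g n (Suc i)) = k)) = jump_count z j k t"
  proof (rule eventually_mono)
    fix n assume n: "t / Suc n < \<delta>"
    have "(\<Sum>i<Suc n. of_bool (z (g n i) = j \<and> z (g n (Suc i)) = k))
        = (\<Sum>i<Suc n. jump_count z j k (g n (Suc i)) - jump_count z j k (g n i))"
    proof (rule sum.cong)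
      fix i assume i: "i \<in> {..<Suc n}"
      have "u = v" if uv: "u \<in> D \<inter> {g n i<..g n (Suc i)}" "v \<in> D \<inter> {g n i<..g n (Suc i)}" for u v
      proof (rule ccontr)
        assume "u \<noteq> v"
        then have "\<delta> \<le> \<bar>u - v\<bar>" using uv g_le[of i n] i by (intro gap) (auto simp: A_def)
        then show False using uv n g_diff[of n i] by auto
      qed
      then show "of_bool (z (g n i) = j \<and> z (g n (Suc i)) = k)
          = jump_count z j k (g n (Suc i)) - jump_count z j k (g n i)"
        using jump_count_cell[OF z jk g_mono(2,1) D, of n i] by simp
    qed simp
    also have "\<dots> = jump_count z j k (g n (Suc n)) - jump_count z j k (g n 0)"
      by (rule sum_lessThan_telescope)
    finally show "(\<Sum>i<Suc n. of_bool (z (g n i) = j \<and> z (g n (Suc i)) = k)) = jump_count z j k t"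
      by (simp add: g_end jump_count_nonpos del: sum.lessThan_Suc)
  qed
qed

definition total_jumps :: "(real \<Rightarrow> 'j::finite) \<Rightarrow> real \<Rightarrow> real" where
  "total_jumps z t = (\<Sum>j\<in>UNIV. \<Sum>k\<in>UNIV - {j}. jump_count z j k t)"

text \<open>
A path that is not constant has a jump, which contributes to exactly one of the counting processes.
\<close>

lemma total_jumps_increase:
  fixes z :: "real \<Rightarrow> 'j::finite"
  assumes z: "jump_path z" and st: "0 \<le> s" "s \<le> t" and change: "\<exists>u\<in>{s..t}. z u \<noteq> z s"
  shows "total_jumps z s + 1 \<le> total_jumps z t"
proof -
  obtain v where v: "s \<le> v" "v \<le> t" "z v \<noteq> z s" using change by auto
  obtain u where u: "s < u" "u \<le> v" "left_state z u \<noteq> z u"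
    using constant_if_no_jump[OF z st(1) v(1)] v(3) by blast
  define j k where "j = left_state z u" "k = z u"
  have jk: "j \<noteq> k" using u by (simp add: j_k_def)
  have mono: "jump_count z a b s \<le> jump_count z a b t" if "a \<noteq> b" for a b
    using jump_count_integrator[OF z that] st by (auto simp: integrator_def dest: monoD)
  have "{u} \<subseteq> jumps z j k \<inter> {s<..t}" using u v by (auto simp: j_k_def)
  then have "card {u} \<le> card (jumps z j k \<inter> {s<..t})"
    by (intro card_mono jump_count_diff(2)[OF z jk st])
  then have one: "jump_count z j k s + 1 \<le> jump_count z j k t"
    using jump_count_diff(1)[OF z jk st] by simp
  have "1 = (\<Sum>a\<in>UNIV. \<Sum>b\<in>UNIV - {a}. if a = j \<and> b = k then 1 else 0 :: real)"
  proof -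
    have "(\<Sum>b\<in>UNIV - {a}. if a = j \<and> b = k then 1 else 0 :: real) = (if a = j then 1 else 0)" for a
      using jk by (cases "a = j") (simp_all add: sum.delta)
    then show ?thesis by simp
  qed
  also have "\<dots> \<le> (\<Sum>a\<in>UNIV. \<Sum>b\<in>UNIV - {a}. jump_count z a b t - jump_count z a b s)"
    using one mono by (intro sum_mono) auto
  also have "\<dots> = total_jumps z t - total_jumps z s"
    by (simp add: total_jumps_def sum_subtractf)
  finally show ?thesis by simp
qed

section \<open>Measurability on the space of jump paths\<close>

text \<open>
Left limits, jump counts and hitting times are measurable only after restriction to jump paths, because the
\<open>\<sigma>\<close>-algebra of the path space is generated by single coordinates.
\<close>

definition jump_space :: "(real \<Rightarrow> 'j) measure" where
  "jump_space = restrict_space path_space (Collect jump_path)"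

lemma space_path_space [simp]: "space path_space = UNIV"
  by (simp add: path_space_def state_algebra_def)

lemma space_jump_space [simp]: "space jump_space = Collect jump_path"
  by (simp add: jump_space_def space_restrict_space)

lemma measurable_coordinate_path [measurable]:
  fixes t :: real
  assumes "0 \<le> t"
  shows "(\<lambda>z. z t) \<in> path_space \<rightarrow>\<^sub>M count_space (UNIV :: 'j::finite set)"
proof -
  have "{z. z t = k} \<in> sets path_space" for k :: 'j
    unfolding path_space_def state_algebra_def using assms by auto
  then have "(\<lambda>z. z t) -` {k} \<inter> space path_space \<in> sets path_space" for k :: 'j
    by (simp add: vimage_def)
  then show ?thesis by (subst measurable_count_space_eq2) auto
qed

lemma measurable_coordinate [measurable]:
  "0 \<le> t \<Longrightarrow> (\<lambda>z. z t) \<in> jump_space \<rightarrow>\<^sub>M count_space (UNIV :: 'j::finite set)"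
  unfolding jump_space_def by (intro measurable_restrict_space1 measurable_coordinate_path)

lemma measurable_jump_count [measurable]:
  fixes j k :: "'j::finite"
  assumes jk: "j \<noteq> k"
  shows "(\<lambda>z. jump_count z j k t) \<in> borel_measurable jump_space"
proof (cases "0 \<le> t")
  case True
  show ?thesis
  proof (rule borel_measurable_LIMSEQ_real)
    fix z :: "real \<Rightarrow> 'j" assume "z \<in> space jump_space"
    then show "(\<lambda>n. \<Sum>i<Suc n. of_bool (z (mesh t n i) = j \<and> z (mesh t n (Suc i)) = k))
        \<longlonglongrightarrow> jump_count z j k t"
      using jump_count_grid[OF _ jk True] by simp
  next
    fix n
    have [measurable]: "(\<lambda>z. z (mesh t n i)) \<in> jump_space \<rightarrow>\<^sub>M count_space (UNIV :: 'j set)" for i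
      using True by (intro measurable_coordinate) simp
    show "(\<lambda>z :: real \<Rightarrow> 'j. \<Sum>i<Suc n. of_bool (z (mesh t n i) = j \<and> z (mesh t n (Suc i)) = k) :: real)
        \<in> borel_measurable jump_space"
      by measurable
  qed
next
  case False
  then show ?thesis by (simp add: jump_count_nonpos)
qed

lemma hitting_time_nonneg: "0 \<le> hitting_time J z"
  unfolding hitting_time_def by (intro Inf_greatest) auto

text \<open>
Every state is kept for a positive time, so that a set of states visited at time \<open>t\<close> is also visited at rational
times arbitrarily close to \<open>t\<close>.
\<close>

lemma hitting_time_rational:
  assumes z: "jump_path z"
  shows "hitting_time J z = (INF q\<in>\<rat> \<inter> {0<..}. if z q \<in> J then ereal q else \<infinity>)" (is "_ = ?I")
proof (rule antisym)
  show "hitting_time J z \<le> ?I"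
    unfolding hitting_time_def by (intro INF_greatest) (auto intro!: Inf_lower)
  show "?I \<le> hitting_time J z"
    unfolding hitting_time_def
  proof (intro Inf_greatest)
    fix x assume "x \<in> ereal ` {t. 0 < t \<and> z t \<in> J}"
    then obtain t where t: "x = ereal t" "0 < t" "z t \<in> J" by auto
    obtain d where d: "0 < d" "\<And>y. t \<le> y \<Longrightarrow> y < t + d \<Longrightarrow> z y = z t"
      using jump_path_locally_constant[OF z, of t] t(2) by (metis less_imp_le)
    show "?I \<le> x"
    proof (rule dense_ge)
      fix w assume "x < w"
      then obtain r where r: "t < r" "ereal r < w" using t(1) ereal_dense2[of x w] by auto
      obtain q where q: "q \<in> \<rat>" "t < q" "q < min r (t + d)"
        using Rats_dense_in_real[of t "min r (t + d)"] r d by auto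
      have "?I \<le> (if z q \<in> J then ereal q else \<infinity>)" using q t by (intro INF_lower) auto
      also have "\<dots> = ereal q" using q d(2)[of q] t by simp
      also have "\<dots> \<le> w" using q r by (auto intro: order.trans[of "ereal q" "ereal r"])
      finally show "?I \<le> w" .
    qed
  qed
qed

lemma measurable_hitting_time [measurable]:
  "hitting_time J \<in> borel_measurable (jump_space :: (real \<Rightarrow> 'j::finite) measure)"
proof -
  have [simp]: "countable (\<rat> \<inter> {0<..} :: real set)"
    using countable_rat by (rule countable_subset[rotated]) auto
  have "(\<lambda>z :: real \<Rightarrow> 'j. if z q \<in> J then ereal q else \<infinity>) \<in> borel_measurable jump_space" if "0 < q" for q
  proof -
    have [measurable]: "(\<lambda>z. z q) \<in> jump_space \<rightarrow>\<^sub>M count_space (UNIV :: 'j set)"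
      using that by (intro measurable_coordinate) simp
    have [measurable]: "Measurable.pred jump_space (\<lambda>z :: real \<Rightarrow> 'j. z q \<in> J)"
      by (rule measurable_compose[of "\<lambda>z. z q" _ "count_space UNIV"]) auto
    show ?thesis by measurable
  qed
  then have "(\<lambda>z :: real \<Rightarrow> 'j. INF q\<in>\<rat> \<inter> {0<..}. if z q \<in> J then ereal q else \<infinity>) \<in> borel_measurable jump_space"
    by (intro borel_measurable_INF) auto
  then show ?thesis
    by (rule measurable_cong[THEN iffD1, rotated]) (simp add: hitting_time_rational)
qed

lemma measurable_grid_evaluation:
  assumes [measurable]: "g \<in> jump_space \<rightarrow>\<^sub>M count_space (UNIV :: nat set)"
  shows "(\<lambda>z. z (real (g z) / real (Suc n))) \<in> jump_space \<rightarrow>\<^sub>M count_space (UNIV :: 'j::finite set)"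
  by (rule measurable_compose_countable[where f = "\<lambda>i z. z (real i / real (Suc n))", OF _ assms])
    (intro measurable_coordinate, simp)

text \<open>
The time \<open>u z\<close> is approximated strictly from the right by grid points. These take countably many values, and by
right-continuity the state at them is eventually the state at \<open>u z\<close>.
\<close>

lemma measurable_state_at:
  fixes u :: "(real \<Rightarrow> 'j::finite) \<Rightarrow> real"
  assumes u [measurable]: "u \<in> borel_measurable jump_space" and pos: "\<And>z. 0 \<le> u z"
  shows "(\<lambda>z. of_bool (z (u z) = k) :: real) \<in> borel_measurable jump_space"
proof (rule borel_measurable_LIMSEQ_real)
  let ?r = "\<lambda>n z. real (nat (\<lfloor>u z * real (Suc n)\<rfloor> + 1)) / real (Suc n)"
  fix z :: "real \<Rightarrow> 'j" assume "z \<in> space jump_space"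
  then obtain d where d: "0 < d" "\<And>y. u z \<le> y \<Longrightarrow> y < u z + d \<Longrightarrow> z y = z (u z)"
    using jump_path_locally_constant[of z "u z"] pos by (metis mem_Collect_eq space_jump_space)
  have r: "u z < ?r n z" "?r n z \<le> u z + 1 / Suc n" for n
  proof -
    have "real (nat (\<lfloor>u z * real (Suc n)\<rfloor> + 1)) = of_int (\<lfloor>u z * real (Suc n)\<rfloor> + 1)"
      using pos[of z] by (subst of_nat_nat) (auto simp: add_nonneg_nonneg simp del: of_nat_Suc)
    then have "u z * real (Suc n) < real (nat (\<lfloor>u z * real (Suc n)\<rfloor> + 1))"
      "real (nat (\<lfloor>u z * real (Suc n)\<rfloor> + 1)) \<le> u z * real (Suc n) + 1" by linarith+
    then show "u z < ?r n z" "?r n z \<le> u z + 1 / Suc n"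
      by (simp_all add: less_divide_eq divide_le_eq distrib_right del: of_nat_Suc)
  qed
  have "\<forall>\<^sub>F n in sequentially. 1 / real (Suc n) < d"
    using LIMSEQ_Suc[OF lim_const_over_n[of 1]] d(1) by (intro order_tendstoD) auto
  then have "\<forall>\<^sub>F n in sequentially. of_bool (z (?r n z) = k) = (of_bool (z (u z) = k) :: real)"
  proof (rule eventually_mono)
    fix n assume "1 / real (Suc n) < d"
    then have "z (?r n z) = z (u z)" using r[of n] by (intro d(2)) linarith+
    then show "of_bool (z (?r n z) = k) = (of_bool (z (u z) = k) :: real)" by simp
  qed
  then show "(\<lambda>n. of_bool (z (?r n z) = k)) \<longlonglongrightarrow> (of_bool (z (u z) = k) :: real)"
    by (rule tendsto_eventually)
next
  fix n
  have [measurable]: "(\<lambda>z. z (real (nat (\<lfloor>u z * real (Suc n)\<rfloor> + 1)) / real (Suc n)))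
      \<in> jump_space \<rightarrow>\<^sub>M count_space (UNIV :: 'j set)"
    by (rule measurable_grid_evaluation) measurable
  show "(\<lambda>z. of_bool (z (real (nat (\<lfloor>u z * real (Suc n)\<rfloor> + 1)) / real (Suc n)) = k) :: real) \<in> borel_measurable jump_space"
    by measurable
qed

text \<open>
The same with grid points strictly to the left. At time 0 the left state would depend on the values of the path at
negative times, hence the restriction to \<open>0 < u z\<close>.
\<close>

lemma measurable_left_state_at:
  fixes u :: "(real \<Rightarrow> 'j::finite) \<Rightarrow> real"
  assumes u [measurable]: "u \<in> borel_measurable jump_space"
  shows "(\<lambda>z. of_bool (0 < u z \<and> left_state z (u z) = k) :: real) \<in> borel_measurable jump_space"
proof (rule borel_measurable_LIMSEQ_real)
  let ?r = "\<lambda>n z. real (nat (\<lceil>u z * real (Suc n)\<rceil> - 1)) / real (Suc n)"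
  fix z :: "real \<Rightarrow> 'j" assume z: "z \<in> space jump_space"
  show "(\<lambda>n. of_bool (0 < u z \<and> z (?r n z) = k)) \<longlonglongrightarrow> (of_bool (0 < u z \<and> left_state z (u z) = k) :: real)"
  proof (cases "0 < u z")
    case True
    obtain d where d: "0 < d" "\<And>y. 0 \<le> y \<Longrightarrow> u z - d < y \<Longrightarrow> y < u z \<Longrightarrow> z y = left_state z (u z)"
      using jump_path_locally_constant[of z "u z"] z True by (metis mem_Collect_eq space_jump_space less_imp_le)
    have r: "?r n z < u z" "u z - 1 / Suc n \<le> ?r n z" for n
    proof -
      have "0 < u z * real (Suc n)" using True by simp
      then have "real (nat (\<lceil>u z * real (Suc n)\<rceil> - 1)) = of_int (\<lceil>u z * real (Suc n)\<rceil> - 1)"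
        by (subst of_nat_nat) (auto simp del: of_nat_Suc)
      then have "real (nat (\<lceil>u z * real (Suc n)\<rceil> - 1)) < u z * real (Suc n)"
        "u z * real (Suc n) - 1 \<le> real (nat (\<lceil>u z * real (Suc n)\<rceil> - 1))" by linarith+
      then show "?r n z < u z" "u z - 1 / Suc n \<le> ?r n z"
        by (simp_all add: le_divide_eq divide_less_eq left_diff_distrib del: of_nat_Suc)
    qed
    have "\<forall>\<^sub>F n in sequentially. 1 / real (Suc n) < d"
      using LIMSEQ_Suc[OF lim_const_over_n[of 1]] d(1) by (intro order_tendstoD) auto
    then have "\<forall>\<^sub>F n in sequentially. of_bool (0 < u z \<and> z (?r n z) = k) = (of_bool (0 < u z \<and> left_state z (u z) = k) :: real)"
    proof (rule eventually_mono)
      fix n assume n: "1 / real (Suc n) < d"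
      have "z (?r n z) = left_state z (u z)"
        using r[of n] n by (intro d(2)) (simp_all del: of_nat_Suc)
      then show "of_bool (0 < u z \<and> z (?r n z) = k) = (of_bool (0 < u z \<and> left_state z (u z) = k) :: real)" by simp
    qed
    then show ?thesis by (rule tendsto_eventually)
  qed simp
next
  fix n
  have [measurable]: "(\<lambda>z. z (real (nat (\<lceil>u z * real (Suc n)\<rceil> - 1)) / real (Suc n)))
      \<in> jump_space \<rightarrow>\<^sub>M count_space (UNIV :: 'j set)"
    by (rule measurable_grid_evaluation) measurable
  show "(\<lambda>z. of_bool (0 < u z \<and> z (real (nat (\<lceil>u z * real (Suc n)\<rceil> - 1)) / real (Suc n)) = k) :: real) \<in> borel_measurable jump_space"
    by measurable
qed

text \<open>
The graph map \<open>z \<mapsto> (u z, z)\<close> is measurable for the predictable \<open>\<sigma>\<close>-algebra, since the latter is generated by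
rectangles.
\<close>

lemma measurable_predictable_evaluation:
  fixes u :: "(real \<Rightarrow> 'j::finite) \<Rightarrow> real"
  assumes u [measurable]: "u \<in> borel_measurable jump_space" and pos: "\<And>z. 0 \<le> u z"
    and g: "predictable UNIV (natural_filtration UNIV (\<lambda>z. z)) g"
  shows "(\<lambda>z. g (u z) z) \<in> borel_measurable jump_space"
proof -
  let ?F = "natural_filtration UNIV (\<lambda>z :: real \<Rightarrow> 'j. z)"
  have spaceF: "A \<in> sets (?F s) \<Longrightarrow> A \<in> sets path_space" for A s
  proof -
    have "sets (?F s) \<subseteq> sets (path_space :: (real \<Rightarrow> 'j) measure)"
      unfolding natural_filtration_def path_space_def state_algebra_def
      by (auto intro!: sigma_sets_mono')
    then show "A \<in> sets (?F s) \<Longrightarrow> A \<in> sets path_space" by auto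
  qed
  have meas: "A \<inter> Collect jump_path \<in> sets jump_space" if "A \<in> sets (?F s)" for A s
    using spaceF[OF that] by (auto simp: jump_space_def sets_restrict_space)
  have "(\<lambda>z. (u z, z)) \<in> jump_space \<rightarrow>\<^sub>M predictable_algebra UNIV ?F"
    unfolding predictable_algebra_def
  proof (rule measurable_measure_of)
    fix B assume "B \<in> {{0} \<times> A | A. A \<in> sets (?F 0)} \<union> {{s<..t} \<times> A | s t A. 0 \<le> s \<and> s \<le> t \<and> A \<in> sets (?F s)}"
    then obtain T s A where B: "B = T \<times> A" "A \<in> sets (?F s)" and T [measurable]: "T \<in> sets borel" by auto
    have "(\<lambda>z. (u z, z)) -` B \<inter> space jump_space = (u -` T \<inter> space jump_space) \<inter> (A \<inter> Collect jump_path)"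
      by (auto simp: B)
    also have "\<dots> \<in> sets jump_space"
      by (rule sets.Int[OF measurable_sets[OF u T] meas[OF B(2)]])
    finally show "(\<lambda>z. (u z, z)) -` B \<inter> space jump_space \<in> sets jump_space" .
  qed (use pos in auto)
  then have "(\<lambda>z. (\<lambda>(t, z). g t z) (u z, z)) \<in> borel_measurable jump_space"
    using g unfolding predictable_def by (rule measurable_compose)
  then show ?thesis by simp
qed

section \<open>Occupation and transition functionals of one observation\<close>

text \<open>
The properties of the scaling process that matter: measurability, values between 0 and a bound that is locally
uniform in time, and no change of value while the path is constant. The constant functional 1 is the unscaled case.
\<close>

definition path_functional :: "(real \<Rightarrow> (real \<Rightarrow> 'j::finite) \<Rightarrow> real) \<Rightarrow> (real \<Rightarrow> real) \<Rightarrow> bool" where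
  "path_functional h b \<longleftrightarrow> (\<forall>t. h t \<in> borel_measurable jump_space) \<and>
     (\<forall>z s t. jump_path z \<longrightarrow> 0 \<le> s \<longrightarrow> s \<le> t \<longrightarrow> 0 \<le> h s z \<and> h s z \<le> b t) \<and>
     (\<forall>z s t. jump_path z \<longrightarrow> 0 \<le> s \<longrightarrow> s \<le> t \<longrightarrow> (\<forall>u\<in>{s..t}. z u = z s) \<longrightarrow> h s z = h t z)"

definition sample_space :: "((real \<Rightarrow> 'j) \<times> real) measure" where
  "sample_space = restrict_space (path_space \<Otimes>\<^sub>M borel) (Collect jump_path \<times> UNIV)"

lemma space_sample_space [simp]: "space sample_space = Collect jump_path \<times> UNIV"
  by (auto simp: sample_space_def space_restrict_space space_pair_measure)

lemma measurable_fst_sample [measurable]: "fst \<in> sample_space \<rightarrow>\<^sub>M jump_space"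
  unfolding jump_space_def
  by (rule measurable_restrict_space2)
    (auto simp: sample_space_def space_restrict_space intro!: measurable_restrict_space1)

lemma measurable_snd_sample [measurable]: "snd \<in> borel_measurable sample_space"
  unfolding sample_space_def by (rule measurable_restrict_space1) measurable

definition occ :: "(real \<Rightarrow> (real \<Rightarrow> 'j) \<Rightarrow> real) \<Rightarrow> 'j \<Rightarrow> real \<Rightarrow> (real \<Rightarrow> 'j) \<times> real \<Rightarrow> real" where
  "occ h j t x = h t (fst x) * of_bool (fst x t = j) * of_bool (t < snd x)"

definition transitions :: "(real \<Rightarrow> (real \<Rightarrow> 'j) \<Rightarrow> real) \<Rightarrow> 'j \<Rightarrow> 'j \<Rightarrow> real \<Rightarrow> (real \<Rightarrow> 'j) \<times> real \<Rightarrow> real" where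
  "transitions h j k t x = stieltjes (\<lambda>s. h s (fst x) * of_bool (s \<le> snd x)) (jump_count (fst x) j k) t"

text \<open>
The occupation processes move only when the clock ticks: at a jump of the path or at censoring.
\<close>

definition clock :: "real \<Rightarrow> (real \<Rightarrow> 'j::finite) \<times> real \<Rightarrow> real" where
  "clock t x = total_jumps (fst x) t + of_bool (snd x \<le> t)"

lemma total_jumps_mono:
  assumes z: "jump_path z" "s \<le> t"
  shows "total_jumps z s \<le> total_jumps z t"
proof -
  have "jump_count z j k s \<le> jump_count z j k t" if "j \<noteq> k" for j k
    using jump_count_integrator[OF z(1) that] z(2) by (auto simp: integrator_def dest: monoD)
  then show ?thesis unfolding total_jumps_def by (intro sum_mono) auto
qed

lemma clock_mono:
  assumes "jump_path (fst x)" "s \<le> t"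
  shows "clock s x \<le> clock t x"
  using total_jumps_mono[OF assms] assms by (auto simp: clock_def)

lemma clock_right_continuous:
  assumes z: "jump_path (fst x)"
  shows "((\<lambda>u. clock u x) \<longlongrightarrow> clock t x) (at_right t)"
proof -
  have "((\<lambda>u. total_jumps (fst x) u) \<longlongrightarrow> total_jumps (fst x) t) (at_right t)"
    unfolding total_jumps_def using jump_count_integrator[OF z]
    by (intro tendsto_sum) (auto simp: integrator_def continuous_within)
  moreover have "((\<lambda>u. of_bool (snd x \<le> u) :: real) \<longlongrightarrow> of_bool (snd x \<le> t)) (at_right t)"
  proof (rule tendsto_eventually)
    show "\<forall>\<^sub>F u in at_right t. (of_bool (snd x \<le> u) :: real) = of_bool (snd x \<le> t)"
    proof (cases "snd x \<le> t")
      case True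
      then show ?thesis by (auto simp: eventually_at_right_field intro!: exI[of _ "t + 1"])
    next
      case False
      then show ?thesis by (auto simp: eventually_at_right_field intro!: exI[of _ "snd x"])
    qed
  qed
  ultimately show ?thesis unfolding clock_def by (rule tendsto_add)
qed

lemma measurable_clock [measurable]: "clock t \<in> borel_measurable (sample_space :: ((real \<Rightarrow> 'j::finite) \<times> real) measure)"
proof -
  have [measurable]: "(\<lambda>x. jump_count (fst x) j k t) \<in> borel_measurable (sample_space :: ((real \<Rightarrow> 'j) \<times> real) measure)"
    if "j \<noteq> k" for j k
    by (rule measurable_compose[OF measurable_fst_sample measurable_jump_count[OF that]])
  show ?thesis
    unfolding clock_def[abs_def] total_jumps_def
    by (intro borel_measurable_add borel_measurable_sum) (auto, measurable)
qed

context
  fixes h :: "real \<Rightarrow> (real \<Rightarrow> 'j::finite) \<Rightarrow> real" and b :: "real \<Rightarrow> real"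
  assumes h: "path_functional h b"
begin

lemma h_measurable [measurable]: "h t \<in> borel_measurable jump_space"
  using h by (simp add: path_functional_def)

lemma h_nonneg: "jump_path z \<Longrightarrow> 0 \<le> t \<Longrightarrow> 0 \<le> h t z"
  using h[unfolded path_functional_def, THEN conjunct2, THEN conjunct1, rule_format, of z t t] by simp

lemma h_bound: "jump_path z \<Longrightarrow> 0 \<le> s \<Longrightarrow> s \<le> t \<Longrightarrow> h s z \<le> b t"
  using h[unfolded path_functional_def, THEN conjunct2, THEN conjunct1, rule_format, of z s t] by simp

lemma h_constant:
  assumes "jump_path z" "0 \<le> s" "s \<le> t" and const: "\<And>u. s \<le> u \<Longrightarrow> u \<le> t \<Longrightarrow> z u = z s"
  shows "h s z = h t z"
proof -
  have "\<forall>u\<in>{s..t}. z u = z s" by (intro ballI const) auto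
  then show ?thesis using h assms(1-3) unfolding path_functional_def by blast
qed

lemma h_right_constant:
  assumes z: "jump_path z" and t: "0 \<le> t"
  obtains d where "0 < d" "\<And>y. t \<le> y \<Longrightarrow> y < t + d \<Longrightarrow> z y = z t \<and> h y z = h t z"
proof -
  obtain d where d: "0 < d" "\<And>y. t \<le> y \<Longrightarrow> y < t + d \<Longrightarrow> z y = z t"
    using jump_path_locally_constant[OF z t] by metis
  have "h y z = h t z" if "t \<le> y" "y < t + d" for y
  proof (rule h_constant[OF z t that(1), symmetric])
    show "z u = z t" if "t \<le> u" "u \<le> y" for u
      using that \<open>y < t + d\<close> by (intro d(2)) auto
  qed
  with d show ?thesis by (intro that[of d] conjI)
qed

lemma b_nonneg: "jump_path (z :: real \<Rightarrow> 'j) \<Longrightarrow> 0 \<le> t \<Longrightarrow> 0 \<le> b t"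
  using h_nonneg[of z t] h_bound[of z t t] by simp

lemma measurable_occ [measurable]:
  assumes "0 \<le> t"
  shows "occ h j t \<in> borel_measurable sample_space"
proof -
  have [measurable]: "(\<lambda>x. h t (fst x)) \<in> borel_measurable sample_space"
    by (rule measurable_compose[OF measurable_fst_sample h_measurable])
  have [measurable]: "(\<lambda>x. fst x t) \<in> sample_space \<rightarrow>\<^sub>M count_space (UNIV :: 'j set)"
    by (rule measurable_compose[OF measurable_fst_sample measurable_coordinate[OF assms]])
  show ?thesis unfolding occ_def[abs_def] by measurable
qed

lemma occ_bounds:
  assumes "jump_path (fst x)" "0 \<le> s" "s \<le> t"
  shows "0 \<le> occ h j s x" "occ h j s x \<le> b t"
  using h_nonneg[OF assms(1,2)] h_bound[OF assms] by (auto simp: occ_def of_bool_def)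

text \<open>
If neither a jump nor the censoring falls into \<open>(s,t]\<close> the occupation does not change. Otherwise the clock increases by at
least 1, while the occupation stays in \<open>[0, b T]\<close>.
\<close>

lemma occ_increment:
  assumes z: "jump_path (fst x)" and st: "0 \<le> s" "s \<le> t" "t \<le> T"
  shows "\<bar>occ h j t x - occ h j s x\<bar> \<le> b T * (clock t x - clock s x)"
proof (cases "(\<exists>u\<in>{s..t}. fst x u \<noteq> fst x s) \<or> (s < snd x \<and> snd x \<le> t)")
  case True
  have "1 \<le> clock t x - clock s x"
    using True
  proof
    assume "\<exists>u\<in>{s..t}. fst x u \<noteq> fst x s"
    then have "total_jumps (fst x) s + 1 \<le> total_jumps (fst x) t"
      by (rule total_jumps_increase[OF z st(1,2)])
    then show ?thesis using st by (auto simp: clock_def)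
  next
    assume "s < snd x \<and> snd x \<le> t"
    then show ?thesis using total_jumps_mono[OF z st(2)] by (auto simp: clock_def)
  qed
  moreover have "\<bar>occ h j t x - occ h j s x\<bar> \<le> b T"
    using occ_bounds[OF z, of s T j] occ_bounds[OF z, of t T j] st by (simp add: abs_le_iff)
  moreover have "0 \<le> b T" using b_nonneg[OF z] st by simp
  ultimately show ?thesis
    using mult_left_mono[of 1 "clock t x - clock s x" "b T"] by simp
next
  case False
  then have const: "fst x u = fst x s" if "s \<le> u" "u \<le> t" for u
    using that atLeastAtMost_iff by blast
  have "h s (fst x) = h t (fst x)" by (rule h_constant[OF z st(1,2) const])
  moreover have "fst x t = fst x s" by (rule const[OF st(2) order.refl])
  moreover have "t < snd x \<longleftrightarrow> s < snd x" using False st by linarith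
  ultimately have "occ h j t x = occ h j s x" by (simp add: occ_def)
  then show ?thesis using clock_mono[OF z st(2)] b_nonneg[OF z, of T] st by simp
qed

lemma occ_right_continuous:
  assumes z: "jump_path (fst x)" and t: "0 \<le> t"
  shows "((\<lambda>u. occ h j u x) \<longlongrightarrow> occ h j t x) (at_right t)"
proof (rule tendsto_eventually)
  obtain d where d: "0 < d" "\<And>y. t \<le> y \<Longrightarrow> y < t + d \<Longrightarrow> fst x y = fst x t \<and> h y (fst x) = h t (fst x)"
    by (rule h_right_constant[OF z t]) blast
  \<comment> \<open>Up to time \<open>c\<close> neither the path nor the censoring indicator changes.\<close>
  define c where "c = (if t < snd x then min (t + d) (snd x) else t + d)"
  have "occ h j y x = occ h j t x" if "t < y" "y < c" for y
    using d(2)[of y] that by (auto simp: occ_def c_def split: if_splits)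
  then show "\<forall>\<^sub>F u in at_right t. occ h j u x = occ h j t x"
    using d(1) by (auto simp: eventually_at_right_field c_def intro!: exI[of _ c])
qed

text \<open>
The functional \<open>h\<close> is right-continuous and the censoring indicator left-continuous in time; they are sampled at the
right and at the left end point of each cell, respectively.
\<close>

lemma transitions_riemann:
  assumes z: "jump_path (fst x)" and jk: "j \<noteq> k" and t: "0 \<le> t"
  shows "(\<lambda>n. \<Sum>i<Suc n. h (mesh t n (Suc i)) (fst x) * of_bool (mesh t n i \<le> snd x) *
      (jump_count (fst x) j k (mesh t n (Suc i)) - jump_count (fst x) j k (mesh t n i)))
      \<longlonglongrightarrow> transitions h j k t x"
    and "set_integrable (interval_measure (jump_count (fst x) j k)) {0<..t} (\<lambda>s. h s (fst x) * of_bool (s \<le> snd x))"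
proof -
  let ?k = "\<lambda>u v. h v (fst x) * of_bool (u \<le> snd x)"
  have bound: "\<bar>?k u v\<bar> \<le> b t" if "0 \<le> u" "u \<le> v" "v \<le> t" for u v
    using h_nonneg[OF z, of v] h_bound[OF z, of v t] that by (auto simp: of_bool_def)
  have lim: "(\<lambda>n. ?k (u n) (v n)) \<longlonglongrightarrow> h s (fst x) * of_bool (s \<le> snd x)"
    if s: "0 < s" and uv: "\<And>n. 0 \<le> u n \<and> u n < s \<and> s \<le> v n \<and> v n \<le> t" "u \<longlonglongrightarrow> s" "v \<longlonglongrightarrow> s" for s u v
  proof (rule tendsto_eventually)
    obtain d where d: "0 < d" "\<And>y. s \<le> y \<Longrightarrow> y < s + d \<Longrightarrow> fst x y = fst x s \<and> h y (fst x) = h s (fst x)"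
      by (rule h_right_constant[OF z less_imp_le[OF s]]) blast
    have "\<forall>\<^sub>F n in sequentially. v n < s + d"
      using uv(3) d(1) by (intro order_tendstoD) auto
    moreover have "\<forall>\<^sub>F n in sequentially. (u n \<le> snd x) = (s \<le> snd x)"
    proof (cases "s \<le> snd x")
      case True
      then have "u n \<le> snd x" for n using uv(1)[of n] by linarith
      with True show ?thesis by simp
    next
      case False
      then have "\<forall>\<^sub>F n in sequentially. snd x < u n"
        using uv(2) by (intro order_tendstoD) auto
      then show ?thesis by (rule eventually_mono) (use False in auto)
    qed
    ultimately show "\<forall>\<^sub>F n in sequentially. ?k (u n) (v n) = h s (fst x) * of_bool (s \<le> snd x)"
    proof eventually_elim
      case (elim n)
      then show ?case using d(2)[of "v n"] uv(1)[of n] by simp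
    qed
  qed
  note G = jump_count_integrator[OF z jk]
  show "(\<lambda>n. \<Sum>i<Suc n. ?k (mesh t n i) (mesh t n (Suc i)) *
      (jump_count (fst x) j k (mesh t n (Suc i)) - jump_count (fst x) j k (mesh t n i)))
      \<longlonglongrightarrow> transitions h j k t x"
    unfolding transitions_def by (rule riemann_stieltjes(1)[OF G t bound lim])
  show "set_integrable (interval_measure (jump_count (fst x) j k)) {0<..t} (\<lambda>s. h s (fst x) * of_bool (s \<le> snd x))"
    by (rule riemann_stieltjes(2)[OF G t bound lim])
qed

lemma transitions_integrator:
  assumes z: "jump_path (fst x)" and jk: "j \<noteq> k"
  shows "integrator (\<lambda>t. transitions h j k t x)"
  unfolding transitions_def
  by (intro stieltjes_integrator jump_count_integrator[OF z jk] transitions_riemann(2)[OF z jk])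
    (use h_nonneg[OF z] in auto)

lemma transitions_0: "t \<le> 0 \<Longrightarrow> transitions h j k t x = 0"
  by (simp add: transitions_def)

lemma transitions_bounds:
  assumes z: "jump_path (fst x)" and jk: "j \<noteq> k" and t: "0 \<le> t"
  shows "0 \<le> transitions h j k t x" "transitions h j k t x \<le> b t * jump_count (fst x) j k t"
proof -
  have "mono (\<lambda>t. transitions h j k t x)"
    using transitions_integrator[OF z jk] by (simp add: integrator_def)
  from monoD[OF this t] show "0 \<le> transitions h j k t x"
    by (simp add: transitions_0)
  have "transitions h j k t x \<le> b t * (jump_count (fst x) j k t - jump_count (fst x) j k 0)"
    unfolding transitions_def
    using h_bound[OF z, of _ t] b_nonneg[OF z t]
    by (intro stieltjes_le jump_count_integrator[OF z jk] t transitions_riemann(2)[OF z jk]) (auto simp: of_bool_def)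
  then show "transitions h j k t x \<le> b t * jump_count (fst x) j k t"
    by (simp add: jump_count_nonpos)
qed

lemma measurable_transitions [measurable]:
  assumes jk: "j \<noteq> k"
  shows "transitions h j k t \<in> borel_measurable sample_space"
proof (cases "0 \<le> t")
  case True
  show ?thesis
  proof (rule borel_measurable_LIMSEQ_real)
    fix x :: "(real \<Rightarrow> 'j) \<times> real" assume "x \<in> space sample_space"
    then have "jump_path (fst x)" by auto
    from transitions_riemann(1)[OF this jk True]
    show "(\<lambda>n. \<Sum>i<Suc n. h (mesh t n (Suc i)) (fst x) * of_bool (mesh t n i \<le> snd x) *
      (jump_count (fst x) j k (mesh t n (Suc i)) - jump_count (fst x) j k (mesh t n i)))
      \<longlonglongrightarrow> transitions h j k t x" .
  next
    fix n
    have [measurable]: "(\<lambda>x. h s (fst x)) \<in> borel_measurable sample_space" for s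
      by (rule measurable_compose[OF measurable_fst_sample h_measurable])
    have [measurable]: "(\<lambda>x. jump_count (fst x) j k s) \<in> borel_measurable sample_space" for s
      by (rule measurable_compose[OF measurable_fst_sample measurable_jump_count[OF jk]])
    show "(\<lambda>x. \<Sum>i<Suc n. h (mesh t n (Suc i)) (fst x) * of_bool (mesh t n i \<le> snd x) *
      (jump_count (fst x) j k (mesh t n (Suc i)) - jump_count (fst x) j k (mesh t n i)))
      \<in> borel_measurable sample_space"
      by measurable
  qed
next
  case False
  then have "transitions h j k t = (\<lambda>x. 0)" by (intro ext transitions_0) simp
  then show ?thesis by simp
qed

end

section \<open>Consistency of the cumulative rates\<close>

locale censored_sample = iid_sample M sample_space X Xs
  for M :: "'a measure" and X :: "'a \<Rightarrow> (real \<Rightarrow> 'j::finite) \<times> real" and Xs +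
  assumes jump_count_integrable:
    "\<And>t j k. 0 \<le> t \<Longrightarrow> j \<noteq> k \<Longrightarrow> integrable M (\<lambda>\<omega>. jump_count (fst (X \<omega>)) j k t)"
begin

lemma X_path: "\<omega> \<in> space M \<Longrightarrow> jump_path (fst (X \<omega>))"
  using measurable_space[OF X_rv, of \<omega>] by auto

lemma Xs_path: "\<omega> \<in> space M \<Longrightarrow> 1 \<le> l \<Longrightarrow> jump_path (fst (Xs l \<omega>))"
  using measurable_space[OF Xs_rv] by fastforce

lemma clock_integrable: "0 \<le> t \<Longrightarrow> integrable M (\<lambda>\<omega>. clock t (X \<omega>))"
  unfolding clock_def total_jumps_def
  by (intro Bochner_Integration.integrable_add Bochner_Integration.integrable_sum jump_count_integrable)
    (auto intro!: integrable_const_bound[where B = 1] measurable_compose[OF X_rv])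

text \<open>
Monotonicity is immediate; right-continuity is dominated convergence on \<open>[a,a+1]\<close>.
\<close>

lemma integrator_expectation:
  assumes meas: "\<And>t. Y t \<in> borel_measurable sample_space"
    and Y: "\<And>x. jump_path (fst x) \<Longrightarrow> integrator (\<lambda>t. Y t x)"
    and int: "\<And>t. integrable M (\<lambda>\<omega>. Y t (X \<omega>))"
  shows "integrator (\<lambda>t. expectation (\<lambda>\<omega>. Y t (X \<omega>)))"
  unfolding integrator_def
proof (intro conjI allI)
  have mono: "Y s x \<le> Y t x" if "jump_path (fst x)" "s \<le> t" for s t x
    using Y[OF that(1)] that(2) by (auto simp: integrator_def mono_def)
  show "mono (\<lambda>t. expectation (\<lambda>\<omega>. Y t (X \<omega>)))"
    by (intro monoI integral_mono int mono X_path)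
  fix a :: real
  have "((\<lambda>t. expectation (\<lambda>\<omega>. Y t (X \<omega>))) \<longlongrightarrow> expectation (\<lambda>\<omega>. Y a (X \<omega>))) (at_right a)"
  proof (rule tendsto_at_right_sequentially[of a "a + 1"])
    fix u assume u: "\<And>n. a < u n" "\<And>n. u n < a + 1" "u \<longlonglongrightarrow> a"
    have ur: "filterlim u (at_right a) sequentially"
      using u by (intro tendsto_imp_filterlim_at_right) auto
    show "(\<lambda>n. expectation (\<lambda>\<omega>. Y (u n) (X \<omega>))) \<longlonglongrightarrow> expectation (\<lambda>\<omega>. Y a (X \<omega>))"
    proof (rule integral_dominated_convergence[where w = "\<lambda>\<omega>. \<bar>Y a (X \<omega>)\<bar> + \<bar>Y (a + 1) (X \<omega>)\<bar>"])
      show "AE \<omega> in M. (\<lambda>n. Y (u n) (X \<omega>)) \<longlonglongrightarrow> Y a (X \<omega>)"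
      proof (rule AE_I2)
        fix \<omega> assume "\<omega> \<in> space M"
        then have "((\<lambda>t. Y t (X \<omega>)) \<longlongrightarrow> Y a (X \<omega>)) (at_right a)"
          using Y[OF X_path] by (simp add: integrator_def continuous_within)
        then show "(\<lambda>n. Y (u n) (X \<omega>)) \<longlonglongrightarrow> Y a (X \<omega>)" by (rule filterlim_compose[OF _ ur])
      qed
      show "AE \<omega> in M. norm (Y (u n) (X \<omega>)) \<le> \<bar>Y a (X \<omega>)\<bar> + \<bar>Y (a + 1) (X \<omega>)\<bar>" for n
      proof (rule AE_I2)
        fix \<omega> assume \<omega>: "\<omega> \<in> space M"
        show "norm (Y (u n) (X \<omega>)) \<le> \<bar>Y a (X \<omega>)\<bar> + \<bar>Y (a + 1) (X \<omega>)\<bar>"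
          using mono[OF X_path[OF \<omega>], of a "u n"] mono[OF X_path[OF \<omega>], of "u n" "a + 1"] u(1,2)[of n]
          by (simp add: less_imp_le)
      qed
    qed (use int in \<open>auto intro: measurable_compose[OF X_rv meas]\<close>)
  qed simp
  then show "continuous (at_right a) (\<lambda>t. expectation (\<lambda>\<omega>. Y t (X \<omega>)))" by (simp add: continuous_within)
qed

definition mean_occ where "mean_occ h j t = expectation (\<lambda>\<omega>. occ h j t (X \<omega>))"
definition mean_trans where "mean_trans h j k t = expectation (\<lambda>\<omega>. transitions h j k t (X \<omega>))"
definition avg_occ where "avg_occ h n \<omega> j t = 1 / real n * (\<Sum>l=1..n. occ h j t (Xs l \<omega>))"
definition avg_trans where "avg_trans h n \<omega> j k t = 1 / real n * (\<Sum>l=1..n. transitions h j k t (Xs l \<omega>))"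

context
  fixes h :: "real \<Rightarrow> (real \<Rightarrow> 'j) \<Rightarrow> real" and b :: "real \<Rightarrow> real"
  assumes h: "path_functional h b"
begin

lemma occ_integrable: "0 \<le> t \<Longrightarrow> integrable M (\<lambda>\<omega>. occ h j t (X \<omega>))"
  by (rule integrable_const_bound[where B = "b t"])
    (auto intro!: AE_I2 measurable_compose[OF X_rv measurable_occ[OF h]]
      simp: occ_bounds[OF h X_path _ order.refl])

lemma transitions_integrable:
  assumes jk: "j \<noteq> k"
  shows "integrable M (\<lambda>\<omega>. transitions h j k t (X \<omega>))"
proof (cases "0 \<le> t")
  case True
  show ?thesis
  proof (rule Bochner_Integration.integrable_bound)
    show "integrable M (\<lambda>\<omega>. b t * jump_count (fst (X \<omega>)) j k t)"
      using jump_count_integrable[OF True jk] by simp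
    show "(\<lambda>\<omega>. transitions h j k t (X \<omega>)) \<in> borel_measurable M"
      by (rule measurable_compose[OF X_rv measurable_transitions[OF h jk]])
    show "AE \<omega> in M. norm (transitions h j k t (X \<omega>)) \<le> norm (b t * jump_count (fst (X \<omega>)) j k t)"
    proof (rule AE_I2)
      fix \<omega> assume "\<omega> \<in> space M"
      from transitions_bounds[OF h X_path[OF this] jk True]
      show "norm (transitions h j k t (X \<omega>)) \<le> norm (b t * jump_count (fst (X \<omega>)) j k t)" by simp
    qed
  qed
next
  case False
  then show ?thesis using transitions_0[OF h, of t] by simp
qed

lemma mean_trans_integrator:
  assumes "j \<noteq> k"
  shows "integrator (mean_trans h j k)"
  unfolding mean_trans_def
  by (intro integrator_expectation measurable_transitions[OF h] transitions_integrator[OF h] transitions_integrable assms)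

lemma avg_trans_integrator:
  assumes "\<omega> \<in> space M" "j \<noteq> k"
  shows "integrator (avg_trans h n \<omega> j k)"
  unfolding avg_trans_def
  by (intro integrator_scaled_sum transitions_integrator[OF h] Xs_path assms) auto

lemma mean_occ_dominated_increments: "dominated_increments (mean_occ h j)"
  unfolding dominated_increments_def
proof (intro allI exI[of _ "\<lambda>t. b _ * expectation (\<lambda>\<omega>. clock t (X \<omega>))"] impI)
  fix T u v :: real assume uv: "0 \<le> u" "u \<le> v" "v \<le> T"
  have v: "0 \<le> v" using uv by simp
  have "\<bar>mean_occ h j v - mean_occ h j u\<bar> = \<bar>expectation (\<lambda>\<omega>. occ h j v (X \<omega>) - occ h j u (X \<omega>))\<bar>"
    unfolding mean_occ_def by (simp add: occ_integrable uv v)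
  also have "\<dots> \<le> expectation (\<lambda>\<omega>. \<bar>occ h j v (X \<omega>) - occ h j u (X \<omega>)\<bar>)"
    by (rule integral_abs_bound)
  also have "\<dots> \<le> expectation (\<lambda>\<omega>. b T * (clock v (X \<omega>) - clock u (X \<omega>)))"
    by (intro integral_mono integrable_abs Bochner_Integration.integrable_diff integrable_mult_right
      occ_integrable clock_integrable occ_increment[OF h X_path] uv v)
  also have "\<dots> = b T * expectation (\<lambda>\<omega>. clock v (X \<omega>)) - b T * expectation (\<lambda>\<omega>. clock u (X \<omega>))"
    using uv v by (simp add: clock_integrable right_diff_distrib)
  finally show "\<bar>mean_occ h j v - mean_occ h j u\<bar> \<le> b T * expectation (\<lambda>\<omega>. clock v (X \<omega>)) - b T * expectation (\<lambda>\<omega>. clock u (X \<omega>))" .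
qed

lemma avg_occ_dominated_increments:
  assumes \<omega>: "\<omega> \<in> space M"
  shows "dominated_increments (avg_occ h n \<omega> j)"
  unfolding dominated_increments_def
proof (intro allI exI[of _ "\<lambda>t. 1 / real n * (\<Sum>l=1..n. b _ * clock t (Xs l \<omega>))"] impI)
  fix T u v :: real assume uv: "0 \<le> u" "u \<le> v" "v \<le> T"
  have "\<bar>avg_occ h n \<omega> j v - avg_occ h n \<omega> j u\<bar> = 1 / real n * \<bar>\<Sum>l=1..n. occ h j v (Xs l \<omega>) - occ h j u (Xs l \<omega>)\<bar>"
    unfolding avg_occ_def right_diff_distrib[symmetric] sum_subtractf[symmetric] by (simp add: abs_mult)
  also have "\<dots> \<le> 1 / real n * (\<Sum>l=1..n. \<bar>occ h j v (Xs l \<omega>) - occ h j u (Xs l \<omega>)\<bar>)"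
    by (intro mult_left_mono sum_abs) auto
  also have "\<dots> \<le> 1 / real n * (\<Sum>l=1..n. b T * clock v (Xs l \<omega>) - b T * clock u (Xs l \<omega>))"
  proof (intro mult_left_mono sum_mono)
    fix l assume "l \<in> {1..n}"
    then have "jump_path (fst (Xs l \<omega>))" using Xs_path[OF \<omega>] by simp
    from occ_increment[OF h this uv]
    show "\<bar>occ h j v (Xs l \<omega>) - occ h j u (Xs l \<omega>)\<bar> \<le> b T * clock v (Xs l \<omega>) - b T * clock u (Xs l \<omega>)"
      by (simp add: right_diff_distrib)
  qed simp
  finally show "\<bar>avg_occ h n \<omega> j v - avg_occ h n \<omega> j u\<bar>
      \<le> 1 / real n * (\<Sum>l=1..n. b T * clock v (Xs l \<omega>)) - 1 / real n * (\<Sum>l=1..n. b T * clock u (Xs l \<omega>))"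
    by (simp only: sum_subtractf right_diff_distrib)
qed

text \<open>
The occupation plus \<open>c\<close> times the clock, and \<open>c\<close> times the clock, are monotone. The uniform law of large numbers holds for
both and hence for their difference.
\<close>

lemma avg_occ_uniform_limit:
  assumes \<theta>: "0 \<le> \<theta>"
  shows "AE \<omega> in M. uniform_limit {0..\<theta>} (\<lambda>n. avg_occ h n \<omega> j) (mean_occ h j) sequentially"
proof -
  define c where "c = b \<theta>"
  have c: "0 \<le> c" unfolding c_def using b_nonneg[OF h X_path \<theta>] not_empty by blast
  have 1: "AE \<omega> in M. uniform_limit {0..\<theta>}
      (\<lambda>n t. 1 / real n * (\<Sum>l=1..n. occ h j t (Xs l \<omega>) + c * clock t (Xs l \<omega>)))
      (\<lambda>t. expectation (\<lambda>\<omega>. occ h j t (X \<omega>) + c * clock t (X \<omega>))) sequentially"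
  proof (rule glivenko_cantelli[OF \<theta>])
    fix x :: "(real \<Rightarrow> 'j) \<times> real" and s t :: real
    assume x: "x \<in> space sample_space" and st: "0 \<le> s" "s \<le> t" "t \<le> \<theta>"
    then have "\<bar>occ h j t x - occ h j s x\<bar> \<le> c * (clock t x - clock s x)"
      unfolding c_def by (intro occ_increment[OF h]) auto
    then show "occ h j s x + c * clock s x \<le> occ h j t x + c * clock t x"
      by (simp add: right_diff_distrib abs_le_iff)
  next
    fix x :: "(real \<Rightarrow> 'j) \<times> real" and t :: real
    assume "x \<in> space sample_space" "0 \<le> t"
    then show "((\<lambda>u. occ h j u x + c * clock u x) \<longlongrightarrow> occ h j t x + c * clock t x) (at_right t)"
      by (intro tendsto_intros occ_right_continuous[OF h] clock_right_continuous) auto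
  qed (auto intro!: occ_integrable clock_integrable measurable_occ[OF h] borel_measurable_add borel_measurable_times)
  have 2: "AE \<omega> in M. uniform_limit {0..\<theta>} (\<lambda>n t. 1 / real n * (\<Sum>l=1..n. c * clock t (Xs l \<omega>)))
      (\<lambda>t. expectation (\<lambda>\<omega>. c * clock t (X \<omega>))) sequentially"
    by (rule glivenko_cantelli[OF \<theta>])
      (use c in \<open>auto intro!: clock_integrable mult_left_mono clock_mono tendsto_intros clock_right_continuous\<close>)
  from 1 2 show ?thesis
  proof eventually_elim
    case (elim \<omega>)
    show ?case
      by (rule uniform_limit_cong'[THEN iffD1, OF _ _ uniform_limit_minus[OF elim]])
        (auto simp: avg_occ_def mean_occ_def sum.distrib distrib_left occ_integrable clock_integrable)
  qed
qed

lemma avg_trans_limit: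
  assumes jk: "j \<noteq> k"
  shows "AE \<omega> in M. (\<lambda>n. avg_trans h n \<omega> j k t) \<longlonglongrightarrow> mean_trans h j k t"
  unfolding avg_trans_def mean_trans_def by (intro sample_average measurable_transitions[OF h jk] transitions_integrable[OF jk])

context
  fixes f :: "real \<Rightarrow> real" and B :: real
  assumes f: "left_continuous f" "\<And>s. 0 \<le> f s" "\<And>s. \<bar>f s\<bar> \<le> B"
begin

abbreviation weighted :: "'j \<Rightarrow> 'j \<Rightarrow> (real \<Rightarrow> 'j) \<times> real \<Rightarrow> real \<Rightarrow> real" where
  "weighted j k x \<equiv> stieltjes f (\<lambda>t. transitions h j k t x)"

lemma weighted_integrator:
  assumes "jump_path (fst x)" "j \<noteq> k"
  shows "integrator (weighted j k x)"
  by (intro stieltjes_integrator f(2) transitions_integrator[OF h] assms riemann_stieltjes_left(2)[OF _ _ f(1,3)])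

lemma weighted_riemann:
  assumes "jump_path (fst x)" "j \<noteq> k" "0 \<le> t"
  defines "g \<equiv> \<lambda>n i. mesh t n i"
  shows "(\<lambda>n. \<Sum>i<Suc n. f (g n i) * (transitions h j k (g n (Suc i)) x - transitions h j k (g n i) x))
      \<longlonglongrightarrow> weighted j k x t"
  unfolding g_def by (rule riemann_stieltjes_left(1)[OF transitions_integrator[OF h assms(1,2)] assms(3) f(1,3)])

lemma measurable_weighted:
  assumes jk: "j \<noteq> k"
  shows "(\<lambda>x. weighted j k x t) \<in> borel_measurable sample_space"
proof (cases "0 \<le> t")
  case True
  show ?thesis
  proof (rule borel_measurable_LIMSEQ_real)
    fix x :: "(real \<Rightarrow> 'j) \<times> real" assume "x \<in> space sample_space"
    then have "jump_path (fst x)" by auto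
    then show "(\<lambda>n. \<Sum>i<Suc n. f (mesh t n i) *
      (transitions h j k (mesh t n (Suc i)) x - transitions h j k (mesh t n i) x))
      \<longlonglongrightarrow> weighted j k x t"
      by (rule weighted_riemann[OF _ jk True])
  qed (intro borel_measurable_sum borel_measurable_times borel_measurable_diff borel_measurable_const
      measurable_transitions[OF h jk])
qed simp

lemma weighted_le:
  assumes "jump_path (fst x)" "j \<noteq> k" "0 \<le> t"
  shows "0 \<le> weighted j k x t"
    "weighted j k x t \<le> B * transitions h j k t x"
proof -
  have "mono (weighted j k x)"
    using weighted_integrator[OF assms(1,2)] by (simp add: integrator_def)
  from monoD[OF this assms(3)] show "0 \<le> weighted j k x t" by simp
  have "f s \<le> B" for s using f(3)[of s] by simp
  then have "weighted j k x t \<le> B * (transitions h j k t x - transitions h j k 0 x)"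
    by (intro stieltjes_le transitions_integrator[OF h] assms riemann_stieltjes_left(2)[OF _ _ f(1,3)])
  then show "weighted j k x t \<le> B * transitions h j k t x"
    by (simp add: transitions_0[OF h])
qed

lemma weighted_integrable:
  assumes jk: "j \<noteq> k" and t: "0 \<le> t"
  shows "integrable M (\<lambda>\<omega>. weighted j k (X \<omega>) t)"
proof (rule Bochner_Integration.integrable_bound)
  show "integrable M (\<lambda>\<omega>. B * transitions h j k t (X \<omega>))"
    using transitions_integrable[OF jk] by simp
  show "(\<lambda>\<omega>. weighted j k (X \<omega>) t) \<in> borel_measurable M"
    by (rule measurable_compose[OF X_rv measurable_weighted[OF jk]])
  show "AE \<omega> in M. norm (weighted j k (X \<omega>) t) \<le> norm (B * transitions h j k t (X \<omega>))"
  proof (rule AE_I2)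
    fix \<omega> assume "\<omega> \<in> space M"
    from weighted_le[OF X_path[OF this] jk t]
    show "norm (weighted j k (X \<omega>) t) \<le> norm (B * transitions h j k t (X \<omega>))" by simp
  qed
qed

text \<open>
For Riemann sums the identity is linearity of the expectation. Both sides are limits of Riemann sums, the left-hand one
by dominated convergence.
\<close>

lemma weighted_expectation:
  assumes jk: "j \<noteq> k" and t: "0 \<le> t"
  shows "expectation (\<lambda>\<omega>. weighted j k (X \<omega>) t) = stieltjes f (mean_trans h j k) t"
proof -
  let ?g = "\<lambda>n i. mesh t n i"
  let ?R = "\<lambda>G n. \<Sum>i<Suc n. f (?g n i) * (G (?g n (Suc i)) - G (?g n i))"
  have B: "0 \<le> B" using f(3)[of 0] by simp
  have g_mono: "?g n i \<le> ?g n (Suc i)" for n i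
    using t by (intro divide_right_mono mult_left_mono) auto
  have g_end: "?g n 0 = 0" "?g n (Suc n) = t" for n by (simp_all del: of_nat_Suc)
  have R_bound: "norm (?R G n) \<le> B * (G t - G 0)" if "mono G" for G :: "real \<Rightarrow> real" and n
  proof -
    have "norm (?R G n) \<le> (\<Sum>i<Suc n. B * (G (?g n (Suc i)) - G (?g n i)))"
    proof (intro sum_norm_le)
      fix i
      have "G (?g n i) \<le> G (?g n (Suc i))" by (rule monoD[OF that g_mono])
      then show "norm (f (?g n i) * (G (?g n (Suc i)) - G (?g n i))) \<le> B * (G (?g n (Suc i)) - G (?g n i))"
        using f(3)[of "?g n i"] by (simp add: abs_mult mult_right_mono del: of_nat_Suc)
    qed
    also have "\<dots> = B * (\<Sum>i<Suc n. G (?g n (Suc i)) - G (?g n i))"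
      by (simp only: sum_distrib_left)
    also have "(\<Sum>i<Suc n. G (?g n (Suc i)) - G (?g n i)) = G t - G 0"
      by (subst sum_lessThan_telescope[of "\<lambda>i. G (?g n i)"]) (simp only: g_end)
    finally show ?thesis .
  qed
  have "(\<lambda>n. expectation (\<lambda>\<omega>. ?R (\<lambda>t. transitions h j k t (X \<omega>)) n))
      \<longlonglongrightarrow> expectation (\<lambda>\<omega>. weighted j k (X \<omega>) t)"
  proof (rule integral_dominated_convergence)
    show "integrable M (\<lambda>\<omega>. B * (transitions h j k t (X \<omega>) - transitions h j k 0 (X \<omega>)))"
      by (intro integrable_mult_right Bochner_Integration.integrable_diff transitions_integrable[OF jk])
    show "AE \<omega> in M. (\<lambda>n. ?R (\<lambda>t. transitions h j k t (X \<omega>)) n) \<longlonglongrightarrow> weighted j k (X \<omega>) t"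
      by (intro AE_I2 weighted_riemann[OF X_path jk t])
    show "AE \<omega> in M. norm (?R (\<lambda>t. transitions h j k t (X \<omega>)) n) \<le> B * (transitions h j k t (X \<omega>) - transitions h j k 0 (X \<omega>))" for n
    proof (rule AE_I2)
      fix \<omega> assume "\<omega> \<in> space M"
      then have "mono (\<lambda>t. transitions h j k t (X \<omega>))"
        using transitions_integrator[OF h X_path jk] by (simp add: integrator_def)
      from R_bound[OF this, of n]
      show "norm (?R (\<lambda>t. transitions h j k t (X \<omega>)) n) \<le> B * (transitions h j k t (X \<omega>) - transitions h j k 0 (X \<omega>))" .
    qed
    show "(\<lambda>\<omega>. weighted j k (X \<omega>) t) \<in> borel_measurable M"
      by (rule measurable_compose[OF X_rv measurable_weighted[OF jk]])
    show "(\<lambda>\<omega>. ?R (\<lambda>t. transitions h j k t (X \<omega>)) n) \<in> borel_measurable M" for n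
      by (intro borel_measurable_sum borel_measurable_times borel_measurable_diff borel_measurable_const
        measurable_compose[OF X_rv measurable_transitions[OF h jk]])
  qed
  moreover have "expectation (\<lambda>\<omega>. ?R (\<lambda>t. transitions h j k t (X \<omega>)) n) = ?R (mean_trans h j k) n" for n
    unfolding mean_trans_def by (subst Bochner_Integration.integral_sum) (simp_all add: transitions_integrable[OF jk] del: of_nat_Suc)
  ultimately have "(\<lambda>n. ?R (mean_trans h j k) n) \<longlonglongrightarrow> expectation (\<lambda>\<omega>. weighted j k (X \<omega>) t)"
    by (simp only:)
  moreover have "(\<lambda>n. ?R (mean_trans h j k) n) \<longlonglongrightarrow> stieltjes f (mean_trans h j k) t"
    by (rule riemann_stieltjes_left(1)[OF mean_trans_integrator[OF jk] t f(1,3)])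
  ultimately show ?thesis by (rule LIMSEQ_unique)
qed

text \<open>
For a deterministic weight the integral against the average of the transition processes is an average of i.i.d.
monotone processes.
\<close>

lemma weighted_uniform_limit:
  assumes jk: "j \<noteq> k" and \<theta>: "0 \<le> \<theta>"
  shows "AE \<omega> in M. uniform_limit {0..\<theta>} (\<lambda>n. stieltjes f (avg_trans h n \<omega> j k)) (stieltjes f (mean_trans h j k)) sequentially"
proof -
  have "AE \<omega> in M. uniform_limit {0..\<theta>}
      (\<lambda>n t. 1 / real n * (\<Sum>l=1..n. weighted j k (Xs l \<omega>) t))
      (\<lambda>t. expectation (\<lambda>\<omega>. weighted j k (X \<omega>) t)) sequentially"
  proof (rule glivenko_cantelli[OF \<theta>])
    fix x :: "(real \<Rightarrow> 'j) \<times> real" assume "x \<in> space sample_space"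
    then have i: "integrator (weighted j k x)"
      by (intro weighted_integrator jk) auto
    then show "weighted j k x s \<le> weighted j k x t" if "s \<le> t" for s t
      using that by (auto simp: integrator_def dest: monoD)
    from i show "(weighted j k x \<longlongrightarrow> weighted j k x t) (at_right t)" for t
      by (simp add: integrator_def continuous_within)
  qed (auto intro!: measurable_weighted weighted_integrable jk)
  then show ?thesis
    using AE_space
  proof eventually_elim
    case (elim \<omega>)
    have "stieltjes f (avg_trans h n \<omega> j k) t = 1 / real n * (\<Sum>l=1..n. weighted j k (Xs l \<omega>) t)" for n t
      unfolding avg_trans_def
      by (rule stieltjes_scaled_sum) (use f Xs_path[OF elim(2)] in \<open>auto intro!: transitions_integrator[OF h] jk\<close>)
    then show ?case
      by (intro uniform_limit_cong'[THEN iffD1, OF _ _ elim(1)]) (auto simp: weighted_expectation[OF jk])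
  qed
qed

end

lemma trunc_hazard_consistent:
  assumes jk: "j \<noteq> k" and \<theta>: "0 \<le> \<theta>" and \<epsilon>: "0 < \<epsilon>"
  shows "AE \<omega> in M. uniform_limit {0..\<theta>} (\<lambda>n. trunc_hazard \<epsilon> (avg_occ h n \<omega> j) (avg_trans h n \<omega> j k))
     (trunc_hazard \<epsilon> (mean_occ h j) (mean_trans h j k)) sequentially"
proof -
  have "AE \<omega> in M. uniform_limit {0..\<theta>} (\<lambda>n. stieltjes (hazard_weight \<epsilon> (mean_occ h j)) (avg_trans h n \<omega> j k))
      (stieltjes (hazard_weight \<epsilon> (mean_occ h j)) (mean_trans h j k)) sequentially"
    by (rule weighted_uniform_limit[OF hazard_weight_left_continuous[OF mean_occ_dominated_increments \<epsilon>]
        hazard_weight_bounds[OF \<epsilon>] jk \<theta>])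
  then show ?thesis
    using avg_occ_uniform_limit[OF \<theta>, of j] avg_trans_limit[OF jk, of \<theta>] avg_trans_limit[OF jk, of 0] AE_space
  proof eventually_elim
    case (elim \<omega>)
    show ?case
      by (rule trunc_hazard_uniform_limit[OF mean_occ_dominated_increments avg_occ_dominated_increments avg_trans_integrator
            \<epsilon> \<theta> elim(2) tendsto_diff[OF elim(3,4)]])
        (use elim jk in \<open>auto simp: trunc_hazard_stieltjes\<close>)
  qed
qed

end

end

section \<open>Rate matrices and their product integrals\<close>

text \<open>
A dominating function for the rate matrix: the entry \<open>L i j\<close> occurs off the diagonal and possibly on it, which accounts
for the factor 2, and \<open>L1 i j\<close> possibly on the diagonal.
\<close>

definition total_rate :: "('j::finite \<Rightarrow> 'j \<Rightarrow> real \<Rightarrow> real) \<Rightarrow> ('j \<Rightarrow> 'j \<Rightarrow> real \<Rightarrow> real) \<Rightarrow> real \<Rightarrow> real" where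
  "total_rate L L1 t = (\<Sum>i\<in>UNIV. \<Sum>j\<in>UNIV - {i}. 2 * L i j t + L1 i j t)"

lemma rate_matrix_diff:
  "mnorm (rate_matrix J0 L L1 s - rate_matrix J0 L' L1' t)
    \<le> (\<Sum>i\<in>UNIV. \<Sum>j\<in>UNIV - {i}. 2 * \<bar>L i j s - L' i j t\<bar> + \<bar>L1 i j s - L1' i j t\<bar>)"
proof -
  let ?A = "rate_matrix J0 L L1 s - rate_matrix J0 L' L1' t"
  have "(\<Sum>j\<in>UNIV. \<bar>?A $ i $ j\<bar>) \<le> (\<Sum>j\<in>UNIV - {i}. 2 * \<bar>L i j s - L' i j t\<bar> + \<bar>L1 i j s - L1' i j t\<bar>)" for i
  proof -
    let ?S = "UNIV - {i}"
    have diag: "\<bar>?A $ i $ i\<bar> \<le> (\<Sum>j\<in>?S. \<bar>L i j s - L' i j t\<bar> + \<bar>L1 i j s - L1' i j t\<bar>)"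
    proof (cases "i \<in> J0")
      case True
      then have "\<bar>?A $ i $ i\<bar> = \<bar>\<Sum>j\<in>?S. L1 i j s - L1' i j t\<bar>"
        by (simp add: rate_matrix_def sum_subtractf)
      also have "\<dots> \<le> (\<Sum>j\<in>?S. \<bar>L1 i j s - L1' i j t\<bar>)" by (rule sum_abs)
      also have "\<dots> \<le> (\<Sum>j\<in>?S. \<bar>L i j s - L' i j t\<bar> + \<bar>L1 i j s - L1' i j t\<bar>)" by (intro sum_mono) simp
      finally show ?thesis .
    next
      case False
      then have "\<bar>?A $ i $ i\<bar> = \<bar>\<Sum>j\<in>?S. L i j s - L' i j t\<bar>"
        by (simp add: rate_matrix_def sum_subtractf)
      also have "\<dots> \<le> (\<Sum>j\<in>?S. \<bar>L i j s - L' i j t\<bar>)" by (rule sum_abs)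
      also have "\<dots> \<le> (\<Sum>j\<in>?S. \<bar>L i j s - L' i j t\<bar> + \<bar>L1 i j s - L1' i j t\<bar>)" by (intro sum_mono) simp
      finally show ?thesis .
    qed
    have "(\<Sum>j\<in>UNIV. \<bar>?A $ i $ j\<bar>) = \<bar>?A $ i $ i\<bar> + (\<Sum>j\<in>?S. \<bar>?A $ i $ j\<bar>)"
      by (rule sum.remove) auto
    also have "(\<Sum>j\<in>?S. \<bar>?A $ i $ j\<bar>) = (\<Sum>j\<in>?S. \<bar>L i j s - L' i j t\<bar>)"
      by (rule sum.cong) (auto simp: rate_matrix_def)
    also have "\<bar>?A $ i $ i\<bar> + \<dots> \<le> (\<Sum>j\<in>?S. \<bar>L i j s - L' i j t\<bar> + \<bar>L1 i j s - L1' i j t\<bar>) + \<dots>"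
      using diag by simp
    also have "\<dots> = (\<Sum>j\<in>?S. 2 * \<bar>L i j s - L' i j t\<bar> + \<bar>L1 i j s - L1' i j t\<bar>)"
      unfolding sum.distrib[symmetric] by (intro sum.cong) auto
    finally show ?thesis .
  qed
  then show ?thesis
    by (intro order.trans[OF mnorm_le_sum] sum_mono)
qed

lemma total_rate_integrator:
  assumes "\<And>j k. j \<noteq> k \<Longrightarrow> integrator (L j k)" "\<And>j k. j \<noteq> k \<Longrightarrow> integrator (L1 j k)"
  shows "integrator (total_rate L L1)"
  unfolding integrator_def
proof (intro conjI allI monoI)
  fix s t :: real assume "s \<le> t"
  then have "L j k s \<le> L j k t" "L1 j k s \<le> L1 j k t" if "j \<noteq> k" for j k
    using assms(1,2)[OF that] by (auto simp: integrator_def dest: monoD)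
  then show "total_rate L L1 s \<le> total_rate L L1 t"
    unfolding total_rate_def by (intro sum_mono add_mono mult_left_mono) auto
next
  fix a :: real
  show "continuous (at_right a) (total_rate L L1)"
    unfolding total_rate_def using assms
    by (intro continuous_sum continuous_add continuous_mult continuous_const) (auto simp: integrator_def)
qed

lemma rate_matrix_increment:
  assumes "\<And>j k. j \<noteq> k \<Longrightarrow> integrator (L j k)" "\<And>j k. j \<noteq> k \<Longrightarrow> integrator (L1 j k)" "s \<le> t"
  shows "mnorm (rate_matrix J0 L L1 t - rate_matrix J0 L L1 s) \<le> total_rate L L1 t - total_rate L L1 s"
proof -
  have mono: "L j k s \<le> L j k t" "L1 j k s \<le> L1 j k t" if "j \<noteq> k" for j k
    using assms(1,2)[OF that] assms(3) by (auto simp: integrator_def dest: monoD)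
  have "(\<Sum>i\<in>UNIV. \<Sum>j\<in>UNIV - {i}. 2 * \<bar>L i j t - L i j s\<bar> + \<bar>L1 i j t - L1 i j s\<bar>)
      = (\<Sum>i\<in>UNIV. \<Sum>j\<in>UNIV - {i}. (2 * L i j t + L1 i j t) - (2 * L i j s + L1 i j s))"
    using mono by (intro sum.cong) auto
  also have "\<dots> = total_rate L L1 t - total_rate L L1 s"
    by (simp only: total_rate_def sum_subtractf)
  finally show ?thesis using rate_matrix_diff[of J0 L L1 t L L1 s] by simp
qed

text \<open>
The total variations on \<open>[0,\<theta>]\<close> are bounded by the increments of the total rates, which converge. The stability bound
for product integrals therefore holds with one constant for all large \<open>n\<close> and all \<open>t\<close>.
\<close>

lemma product_integral_uniform_limit:
  fixes L L1 :: "'j::finite \<Rightarrow> 'j \<Rightarrow> real \<Rightarrow> real" and Ln L1n :: "nat \<Rightarrow> 'j \<Rightarrow> 'j \<Rightarrow> real \<Rightarrow> real"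
  assumes L: "\<And>j k. j \<noteq> k \<Longrightarrow> integrator (L j k)" "\<And>j k. j \<noteq> k \<Longrightarrow> integrator (L1 j k)"
    and Ln: "\<And>n j k. j \<noteq> k \<Longrightarrow> integrator (Ln n j k)" "\<And>n j k. j \<noteq> k \<Longrightarrow> integrator (L1n n j k)"
    and lim: "\<And>j k. j \<noteq> k \<Longrightarrow> uniform_limit {0..\<theta>} (\<lambda>n. Ln n j k) (L j k) sequentially"
      "\<And>j k. j \<noteq> k \<Longrightarrow> uniform_limit {0..\<theta>} (\<lambda>n. L1n n j k) (L1 j k) sequentially"
    and \<theta>: "0 \<le> \<theta>"
  shows "uniform_limit {0..\<theta>} (\<lambda>n t. product_integral (rate_matrix J0 (Ln n) (L1n n)) t $ a $ c)
     (\<lambda>t. product_integral (rate_matrix J0 L L1) t $ a $ c) sequentially"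
proof (rule uniform_limitI)
  fix e :: real assume e: "0 < e"
  let ?\<alpha> = "total_rate L L1" and ?\<beta> = "\<lambda>n. total_rate (Ln n) (L1n n)"
  have \<alpha>: "integrator ?\<alpha>" by (rule total_rate_integrator[OF L])
  have \<beta>: "integrator (?\<beta> n)" for n by (rule total_rate_integrator[OF Ln])
  have part: "partitioned \<gamma> t" if "integrator \<gamma>" "0 \<le> t" for \<gamma> t
    using that by (intro right_continuous_partitioned) (auto simp: integrator_def continuous_within)
  define K where "K = 2 * (?\<alpha> \<theta> - ?\<alpha> 0) + 1"
  have \<alpha>0: "0 \<le> ?\<alpha> \<theta> - ?\<alpha> 0" using \<alpha> \<theta> by (auto simp: integrator_def dest: monoD)
  \<comment> \<open>There are at most \<open>CARD('j)\<^sup>2\<close> pairs of states, each with weight \<open>2 + 1\<close> in the bound for rate matrices.\<close>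
  define m where "m = 3 * real CARD('j) * real CARD('j)"
  define C where "C = 2 * m * (1 + K) * exp K"
  have m: "0 < m" by (simp add: m_def)
  have C: "0 < C" using \<alpha>0 m by (auto simp: C_def K_def intro!: mult_pos_pos)
  define \<delta> where "\<delta> = e / (2 * C)"
  have \<delta>: "0 < \<delta>" using e C by (simp add: \<delta>_def)
  have pointwise: "(\<lambda>n. ?\<beta> n t) \<longlonglongrightarrow> ?\<alpha> t" if "t \<in> {0..\<theta>}" for t
    unfolding total_rate_def using tendsto_uniform_limitI[OF lim(1) that] tendsto_uniform_limitI[OF lim(2) that]
    by (intro tendsto_intros) auto
  have "(\<lambda>n. ?\<beta> n \<theta> - ?\<beta> n 0) \<longlonglongrightarrow> ?\<alpha> \<theta> - ?\<alpha> 0"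
    using \<theta> by (intro tendsto_diff pointwise) auto
  then have "\<forall>\<^sub>F n in sequentially. ?\<beta> n \<theta> - ?\<beta> n 0 < ?\<alpha> \<theta> - ?\<alpha> 0 + 1"
    by (rule order_tendstoD) simp
  moreover have "\<forall>\<^sub>F n in sequentially. \<forall>j. \<forall>k\<in>UNIV - {j}. \<forall>t\<in>{0..\<theta>}. dist (Ln n j k t) (L j k t) < \<delta>"
    by (intro eventually_all_finite eventually_ball_finite ballI uniform_limitD[OF lim(1) \<delta>]) auto
  moreover have "\<forall>\<^sub>F n in sequentially. \<forall>j. \<forall>k\<in>UNIV - {j}. \<forall>t\<in>{0..\<theta>}. dist (L1n n j k t) (L1 j k t) < \<delta>"
    by (intro eventually_all_finite eventually_ball_finite ballI uniform_limitD[OF lim(2) \<delta>]) auto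
  ultimately show "\<forall>\<^sub>F n in sequentially. \<forall>t\<in>{0..\<theta>}.
      dist (product_integral (rate_matrix J0 (Ln n) (L1n n)) t $ a $ c) (product_integral (rate_matrix J0 L L1) t $ a $ c) < e"
  proof eventually_elim
    case (elim n)
    show ?case
    proof
      fix t assume t: "t \<in> {0..\<theta>}"
      have "\<bar>product_integral (rate_matrix J0 (Ln n) (L1n n)) t $ a $ c - product_integral (rate_matrix J0 L L1) t $ a $ c\<bar>
          \<le> 2 * (m * \<delta>) * (1 + K) * exp K"
      proof (rule product_integral_diff)
        show "mnorm (rate_matrix J0 (Ln n) (L1n n) y - rate_matrix J0 (Ln n) (L1n n) x) \<le> ?\<beta> n y - ?\<beta> n x"
          if "x \<le> y" for x y by (rule rate_matrix_increment[OF Ln that])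
        show "mnorm (rate_matrix J0 L L1 y - rate_matrix J0 L L1 x) \<le> ?\<alpha> y - ?\<alpha> x"
          if "x \<le> y" for x y by (rule rate_matrix_increment[OF L that])
        show "mnorm (rate_matrix J0 (Ln n) (L1n n) x - rate_matrix J0 L L1 x) \<le> m * \<delta>" if x: "0 \<le> x" "x \<le> t" for x
        proof -
          have "mnorm (rate_matrix J0 (Ln n) (L1n n) x - rate_matrix J0 L L1 x)
              \<le> (\<Sum>i\<in>UNIV. \<Sum>j\<in>UNIV - {i}. 2 * \<bar>Ln n i j x - L i j x\<bar> + \<bar>L1n n i j x - L1 i j x\<bar>)"
            by (rule rate_matrix_diff)
          also have "\<dots> \<le> (\<Sum>i\<in>(UNIV::'j set). \<Sum>j\<in>UNIV - {i}. 3 * \<delta>)"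
          proof (intro sum_mono)
            fix i j :: 'j assume j: "j \<in> UNIV - {i}"
            have "x \<in> {0..\<theta>}" using x t by auto
            then have "\<bar>Ln n i j x - L i j x\<bar> < \<delta>" "\<bar>L1n n i j x - L1 i j x\<bar> < \<delta>"
              using elim(2,3) j unfolding dist_real_def by blast+
            then show "2 * \<bar>Ln n i j x - L i j x\<bar> + \<bar>L1n n i j x - L1 i j x\<bar> \<le> 3 * \<delta>" by simp
          qed
          also have "\<dots> \<le> (\<Sum>i\<in>(UNIV::'j set). \<Sum>j\<in>(UNIV::'j set). 3 * \<delta>)"
            using \<delta> by (intro sum_mono sum_mono2) auto
          also have "\<dots> = m * \<delta>" by (simp add: m_def)
          finally show ?thesis .
        qed
        have "?\<alpha> t \<le> ?\<alpha> \<theta>" "?\<beta> n t \<le> ?\<beta> n \<theta>" using t \<alpha> \<beta>[of n] by (auto simp: integrator_def dest: monoD)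
        then show "?\<beta> n t - ?\<beta> n 0 + (?\<alpha> t - ?\<alpha> 0) \<le> K" using elim(1) by (simp add: K_def)
      qed (use t part \<alpha> \<beta> in auto)
      also have "\<dots> = C * \<delta>" by (simp add: C_def)
      also have "\<dots> < e" using e C by (simp add: \<delta>_def)
      finally show "dist (product_integral (rate_matrix J0 (Ln n) (L1n n)) t $ a $ c)
          (product_integral (rate_matrix J0 L L1) t $ a $ c) < e"
        by (simp add: dist_real_def)
    qed
  qed
qed

lemma uniform_limit_SUP:
  fixes f :: "nat \<Rightarrow> real \<Rightarrow> real"
  assumes f: "uniform_limit {0..\<theta>} f g sequentially" and \<theta>: "0 \<le> \<theta>"
  shows "(\<lambda>n. SUP t\<in>{0..\<theta>}. ereal \<bar>f n t - g t\<bar>) \<longlonglongrightarrow> 0"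
proof (rule order_tendstoI)
  fix a :: ereal assume "a < 0"
  also have "0 \<le> ereal \<bar>f n 0 - g 0\<bar>" for n by simp
  also have "ereal \<bar>f n 0 - g 0\<bar> \<le> (SUP t\<in>{0..\<theta>}. ereal \<bar>f n t - g t\<bar>)" for n
    using \<theta> by (intro SUP_upper) auto
  finally show "\<forall>\<^sub>F n in sequentially. a < (SUP t\<in>{0..\<theta>}. ereal \<bar>f n t - g t\<bar>)" by simp
next
  fix a :: ereal assume "0 < a"
  then obtain e where e: "0 < e" "ereal e < a" using ereal_dense2[of 0 a] by auto
  have "\<forall>\<^sub>F n in sequentially. \<forall>t\<in>{0..\<theta>}. dist (f n t) (g t) < e"
    using uniform_limitD[OF f e(1)] .
  then show "\<forall>\<^sub>F n in sequentially. (SUP t\<in>{0..\<theta>}. ereal \<bar>f n t - g t\<bar>) < a"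
  proof (rule eventually_mono)
    fix n assume "\<forall>t\<in>{0..\<theta>}. dist (f n t) (g t) < e"
    then have "(SUP t\<in>{0..\<theta>}. ereal \<bar>f n t - g t\<bar>) \<le> ereal e"
      by (intro SUP_least) (auto simp: dist_real_def less_imp_le)
    also have "\<dots> < a" by (rule e(2))
    finally show "(SUP t\<in>{0..\<theta>}. ereal \<bar>f n t - g t\<bar>) < a" .
  qed
qed

section \<open>The scaling process as a path functional\<close>

definition entry_time :: "'j set \<Rightarrow> (real \<Rightarrow> 'j) \<Rightarrow> real" where
  "entry_time J z = real_of_ereal (hitting_time J z)"

text \<open>
For entry time 0, which also stands for a path that never enters \<open>J\<close>, the value is set to 0. This keeps the functional
independent of left states at time 0.
\<close>

definition entry_value :: "(real \<Rightarrow> 'j \<Rightarrow> 'j \<Rightarrow> (real \<Rightarrow> 'j) \<Rightarrow> real) \<Rightarrow> 'j set \<Rightarrow> (real \<Rightarrow> 'j) \<Rightarrow> real" where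
  "entry_value g J z = (let u = entry_time J z in of_bool (0 < u) * g u (left_state z u) (z u) z)"

text \<open>
The scaling process, clipped to an interval that depends on the time of entry. Clipping makes the functional nonnegative
and locally bounded on all jump paths; it has no effect on those paths on which the bounds hold anyway.
\<close>

definition path_scaling ::
  "(real \<Rightarrow> 'j \<Rightarrow> 'j \<Rightarrow> (real \<Rightarrow> 'j) \<Rightarrow> real) \<Rightarrow> (nat \<Rightarrow> real) \<Rightarrow> 'j set \<Rightarrow> real \<Rightarrow> (real \<Rightarrow> 'j) \<Rightarrow> real" where
  "path_scaling g c J t z = (if 0 < hitting_time J z \<and> hitting_time J z \<le> ereal t
     then max 0 (min (c (nat \<lceil>entry_time J z\<rceil>)) (entry_value g J z)) else 1)"

lemma entry_time_nonneg: "0 \<le> entry_time J z"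
  using hitting_time_nonneg[of J z] by (simp add: entry_time_def real_of_ereal_pos)

lemma measurable_entry_time [measurable]:
  "entry_time J \<in> borel_measurable (jump_space :: (real \<Rightarrow> 'j::finite) measure)"
  unfolding entry_time_def[abs_def] by measurable

lemma measurable_entry_value [measurable]:
  fixes g :: "real \<Rightarrow> 'j \<Rightarrow> 'j \<Rightarrow> (real \<Rightarrow> 'j::finite) \<Rightarrow> real"
  assumes g: "\<And>j k. predictable UNIV (natural_filtration UNIV (\<lambda>z. z)) (\<lambda>t. g t j k)"
  shows "entry_value g J \<in> borel_measurable jump_space"
proof -
  let ?u = "entry_time J"
  have eq: "entry_value g J z = (\<Sum>j\<in>UNIV. \<Sum>k\<in>UNIV.
      of_bool (0 < ?u z \<and> left_state z (?u z) = j) * of_bool (z (?u z) = k) * g (?u z) j k z)" for z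
  proof -
    have "(\<Sum>k\<in>UNIV. of_bool (0 < ?u z \<and> left_state z (?u z) = j) * of_bool (z (?u z) = k) * g (?u z) j k z)
        = of_bool (0 < ?u z \<and> left_state z (?u z) = j) * g (?u z) j (z (?u z)) z" for j
      by (subst sum.remove[of _ "z (?u z)"]) (auto intro!: sum.neutral)
    moreover have "(\<Sum>j\<in>UNIV. of_bool (0 < ?u z \<and> left_state z (?u z) = j) * g (?u z) j (z (?u z)) z)
        = of_bool (0 < ?u z) * g (?u z) (left_state z (?u z)) (z (?u z)) z"
      by (subst sum.remove[of _ "left_state z (?u z)"]) (auto intro!: sum.neutral)
    ultimately show ?thesis by (simp add: entry_value_def Let_def)
  qed
  have [measurable]: "(\<lambda>z. g (?u z) j k z) \<in> borel_measurable jump_space" for j k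
    by (rule measurable_predictable_evaluation[OF measurable_entry_time entry_time_nonneg g])
  show ?thesis
    unfolding eq[abs_def]
    by (intro borel_measurable_sum borel_measurable_times measurable_left_state_at measurable_state_at
        entry_time_nonneg measurable_entry_time) measurable
qed

text \<open>
Right-continuity: points of \<open>J\<close> are visited arbitrarily soon after the infimum, when the path still has the state
attained at the infimum.
\<close>

lemma hitting_time_attained:
  assumes z: "jump_path z" and u: "hitting_time J z = ereal u"
  shows "z u \<in> J"
proof -
  have "0 \<le> u" using hitting_time_nonneg[of J z] u by simp
  then obtain d where d: "0 < d" "\<And>y. u \<le> y \<Longrightarrow> y < u + d \<Longrightarrow> z y = z u"
    using jump_path_locally_constant[OF z] by metis
  have "Inf (ereal ` {t. 0 < t \<and> z t \<in> J}) < ereal (u + d)"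
    using u d(1) by (simp add: hitting_time_def)
  then obtain t where t: "0 < t" "z t \<in> J" "t < u + d" by (auto simp: Inf_less_iff)
  have "hitting_time J z \<le> ereal t"
    unfolding hitting_time_def using t by (intro Inf_lower) auto
  then show ?thesis using d(2)[of t] t u by simp
qed

lemma hitting_time_pos:
  assumes z: "jump_path z" and "z 0 \<notin> J"
  shows "0 < hitting_time J z"
  using hitting_time_attained[OF z, of J 0] hitting_time_nonneg[of J z] assms(2)
  by (auto simp: less_le zero_ereal_def)

text \<open>
Entry into \<open>J\<close> during \<open>(s,t]\<close> is impossible while the path is constant: at the time of entry the state would lie in \<open>J\<close>, and
so it would have earlier.
\<close>

lemma path_scaling_functional:
  fixes g :: "real \<Rightarrow> 'j \<Rightarrow> 'j \<Rightarrow> (real \<Rightarrow> 'j::finite) \<Rightarrow> real"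
  assumes g: "\<And>j k. predictable UNIV (natural_filtration UNIV (\<lambda>z. z)) (\<lambda>t. g t j k)"
  shows "path_functional (path_scaling g c J) (\<lambda>t. 1 + (\<Sum>i\<le>nat \<lceil>t\<rceil>. \<bar>c i\<bar>))"
  unfolding path_functional_def
proof (intro conjI allI impI)
  fix t
  have [measurable]: "(\<lambda>z. c (nat \<lceil>entry_time J z\<rceil>)) \<in> borel_measurable (jump_space :: (real \<Rightarrow> 'j) measure)"
    by (rule measurable_compose[of _ _ "count_space UNIV"]) measurable
  have [measurable]: "entry_value g J \<in> borel_measurable jump_space"
    by (rule measurable_entry_value[OF g])
  show "path_scaling g c J t \<in> borel_measurable jump_space"
    unfolding path_scaling_def by measurable
next
  fix z :: "real \<Rightarrow> 'j" and s t :: real assume z: "jump_path z" and st: "0 \<le> s" "s \<le> t"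
  show "0 \<le> path_scaling g c J s z" by (simp add: path_scaling_def)
  show "path_scaling g c J s z \<le> 1 + (\<Sum>i\<le>nat \<lceil>t\<rceil>. \<bar>c i\<bar>)"
  proof (cases "0 < hitting_time J z \<and> hitting_time J z \<le> ereal s")
    case True
    let ?n = "nat \<lceil>entry_time J z\<rceil>"
    have "entry_time J z \<le> s"
      using True by (cases "hitting_time J z") (auto simp: entry_time_def)
    then have "?n \<le> nat \<lceil>t\<rceil>" using st by (intro nat_mono ceiling_mono) simp
    then have "\<bar>c ?n\<bar> \<le> (\<Sum>i\<le>nat \<lceil>t\<rceil>. \<bar>c i\<bar>)"
      by (intro member_le_sum) auto
    then show ?thesis using True by (auto simp: path_scaling_def max_def min_def)
  next
    case False
    then have "path_scaling g c J s z = 1" by (auto simp: path_scaling_def)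
    then show ?thesis by (simp add: sum_nonneg)
  qed
next
  fix z :: "real \<Rightarrow> 'j" and s t :: real
  assume z: "jump_path z" and st: "0 \<le> s" "s \<le> t" and const: "\<forall>u\<in>{s..t}. z u = z s"
  have "hitting_time J z \<le> ereal s" if le: "hitting_time J z \<le> ereal t"
  proof (rule ccontr)
    assume "\<not> hitting_time J z \<le> ereal s"
    then obtain u where u: "hitting_time J z = ereal u" "s < u" "u \<le> t"
      using le by (cases "hitting_time J z") auto
    define w where "w = (s + u) / 2"
    have w: "s < w" "w < u" using u by (auto simp: w_def)
    have "z w = z s" using w u by (intro const[rule_format]) auto
    moreover have "z u = z s" using u by (intro const[rule_format]) auto
    ultimately have "z w \<in> J" using hitting_time_attained[OF z u(1)] by simp
    then have "hitting_time J z \<le> ereal w"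
      unfolding hitting_time_def using w st by (intro Inf_lower) auto
    then show False using w u by simp
  qed
  moreover have "hitting_time J z \<le> ereal t" if "hitting_time J z \<le> ereal s"
    using that st by (auto intro: order.trans)
  ultimately have "hitting_time J z \<le> ereal s \<longleftrightarrow> hitting_time J z \<le> ereal t" by blast
  then show "path_scaling g c J s z = path_scaling g c J t z" by (simp add: path_scaling_def)
qed

text \<open>
A path that starts outside \<open>J\<close> enters it at a positive time, so that the value 0, which \<^const>\<open>entry_value\<close> takes at entry time 0, is not met.
\<close>

lemma path_scaling_eq:
  assumes z: "jump_path z" "z 0 \<notin> J"
    and v: "0 \<le> entry_value g J z" "entry_value g J z \<le> c (nat \<lceil>entry_time J z\<rceil>)"
  defines "u \<equiv> real_of_ereal (hitting_time J z)"
  shows "g u (left_state z u) (z u) z ^ (of_bool (hitting_time J z \<le> ereal t) :: nat) = path_scaling g c J t z"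
proof (cases "hitting_time J z \<le> ereal t")
  case True
  have pos: "0 < hitting_time J z" by (rule hitting_time_pos[OF z])
  then have "0 < u" using True by (cases "hitting_time J z") (auto simp: u_def)
  then have "entry_value g J z = g u (left_state z u) (z u) z"
    by (simp add: entry_value_def entry_time_def u_def Let_def)
  then show ?thesis using True pos v by (simp add: path_scaling_def)
next
  case False
  then show ?thesis by (simp add: path_scaling_def)
qed

lemma path_functional_1: "path_functional (\<lambda>_ _. 1) (\<lambda>_. 1)"
  by (simp add: path_functional_def)

section \<open>Strong consistency\<close>

text \<open>
Laws and independence are given on the full path space. They carry over to the jump paths, since restricting the
\<open>\<sigma>\<close>-algebra to the range of the observations does not change the preimages.
\<close>

lemma (in prob_space) censored_sampleI:
  fixes Z :: "'a \<Rightarrow> real \<Rightarrow> 'j::finite" and R :: "'a \<Rightarrow> real"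
  assumes Z: "\<And>t. 0 \<le> t \<Longrightarrow> (\<lambda>\<omega>. Z \<omega> t) \<in> M \<rightarrow>\<^sub>M count_space UNIV"
    and jump: "\<And>\<omega>. \<omega> \<in> space M \<Longrightarrow> jump_path (Z \<omega>)"
    and int: "\<And>t j k. 0 \<le> t \<Longrightarrow> j \<noteq> k \<Longrightarrow> integrable M (\<lambda>\<omega>. jump_count (Z \<omega>) j k t)"
    and R: "R \<in> borel_measurable M"
    and copies_jump: "\<And>l \<omega>. 1 \<le> l \<Longrightarrow> \<omega> \<in> space M \<Longrightarrow> jump_path (Zs l \<omega>)"
    and copies_indep: "indep_vars (\<lambda>_. path_space \<Otimes>\<^sub>M borel) (\<lambda>l \<omega>. (Zs l \<omega>, Rs l \<omega>)) {1..}"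
    and copies_distr: "\<And>l. 1 \<le> l \<Longrightarrow>
          distr M (path_space \<Otimes>\<^sub>M borel) (\<lambda>\<omega>. (Zs l \<omega>, Rs l \<omega>)) =
          distr M (path_space \<Otimes>\<^sub>M borel) (\<lambda>\<omega>. (Z \<omega>, R \<omega>))"
  shows "censored_sample M (\<lambda>\<omega>. (Z \<omega>, R \<omega>)) (\<lambda>l \<omega>. (Zs l \<omega>, Rs l \<omega>))"
proof -
  let ?P = "path_space \<Otimes>\<^sub>M borel :: ((real \<Rightarrow> 'j) \<times> real) measure"
  let ?J = "Collect jump_path \<times> UNIV :: ((real \<Rightarrow> 'j) \<times> real) set"
  let ?X = "\<lambda>\<omega>. (Z \<omega>, R \<omega>)" and ?Xs = "\<lambda>l \<omega>. (Zs l \<omega>, Rs l \<omega>)"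
  have [measurable]: "Z \<in> M \<rightarrow>\<^sub>M path_space"
    unfolding path_space_def state_algebra_def
  proof (rule measurable_measure_of)
    fix A :: "(real \<Rightarrow> 'j) set" assume "A \<in> {{z \<in> UNIV. z s = k} | s k. s \<in> {0..}}"
    then obtain s k where A: "A = {z. z s = k}" "0 \<le> s" by auto
    have "Z -` A \<inter> space M = (\<lambda>\<omega>. Z \<omega> s) -` {k} \<inter> space M" by (auto simp: A)
    also have "\<dots> \<in> sets M" by (rule measurable_sets[OF Z[OF A(2)]]) simp
    finally show "Z -` A \<inter> space M \<in> sets M" .
  qed auto
  have X: "?X \<in> M \<rightarrow>\<^sub>M ?P" using R by measurable
  have Xs: "?Xs l \<in> M \<rightarrow>\<^sub>M ?P" if "1 \<le> l" for l
    using copies_indep that by (auto simp: indep_vars_def)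
  have X': "?X \<in> M \<rightarrow>\<^sub>M sample_space"
    unfolding sample_space_def by (rule measurable_restrict_space2[OF _ X]) (auto simp: jump)
  have Xs': "?Xs l \<in> M \<rightarrow>\<^sub>M sample_space" if "1 \<le> l" for l
    unfolding sample_space_def by (rule measurable_restrict_space2[OF _ Xs[OF that]]) (auto simp: copies_jump[OF that])
  have preimages: "{f -` A \<inter> space M | A. A \<in> sets sample_space} = {f -` A \<inter> space M | A. A \<in> sets ?P}"
    if f: "\<And>\<omega>. \<omega> \<in> space M \<Longrightarrow> f \<omega> \<in> ?J" for f :: "'a \<Rightarrow> (real \<Rightarrow> 'j) \<times> real"
  proof -
    have eq: "f -` (?J \<inter> A) \<inter> space M = f -` A \<inter> space M" for A using f by blast
    show ?thesis
      unfolding sample_space_def sets_restrict_space Setcompr_eq_image image_image by (simp only: eq)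
  qed
  show ?thesis
  proof unfold_locales
    show "?X \<in> M \<rightarrow>\<^sub>M sample_space" by (rule X')
    have P: "indep_sets (\<lambda>l. {?Xs l -` A \<inter> space M | A. A \<in> sets ?P}) {1..}"
      using copies_indep unfolding indep_vars_def2 by blast
    have "{?Xs l -` A \<inter> space M | A. A \<in> sets sample_space} = {?Xs l -` A \<inter> space M | A. A \<in> sets ?P}"
      if "l \<in> {1..}" for l
      using copies_jump[of l] that by (intro preimages) auto
    then have "indep_sets (\<lambda>l. {?Xs l -` A \<inter> space M | A. A \<in> sets sample_space}) {1..}"
      by (rule indep_sets_cong[THEN iffD2, OF refl _ P])
    then show "indep_vars (\<lambda>_. sample_space) ?Xs {1..}"
      unfolding indep_vars_def2 using Xs' by auto
    show "distr M sample_space (?Xs l) = distr M sample_space ?X" if l: "1 \<le> l" for l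
    proof (rule measure_eqI)
      fix B :: "((real \<Rightarrow> 'j) \<times> real) set" assume "B \<in> sets (distr M sample_space (?Xs l))"
      then have B: "B \<in> sets sample_space" by simp
      then obtain A where A: "A \<in> sets ?P" "B = ?J \<inter> A"
        by (auto simp: sample_space_def sets_restrict_space)
      have "emeasure (distr M sample_space (?Xs l)) B = emeasure M (?Xs l -` B \<inter> space M)"
        by (rule emeasure_distr[OF Xs'[OF l] B])
      also have "?Xs l -` B \<inter> space M = ?Xs l -` A \<inter> space M"
        using copies_jump[OF l] by (auto simp: A)
      also have "emeasure M \<dots> = emeasure (distr M ?P (?Xs l)) A"
        by (rule emeasure_distr[OF Xs[OF l] A(1), symmetric])
      also have "\<dots> = emeasure M (?X -` A \<inter> space M)"
        unfolding copies_distr[OF l] by (rule emeasure_distr[OF X A(1)])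
      also have "?X -` A \<inter> space M = ?X -` B \<inter> space M"
        using jump by (auto simp: A)
      also have "emeasure M \<dots> = emeasure (distr M sample_space ?X) B"
        by (rule emeasure_distr[OF X' B, symmetric])
      finally show "emeasure (distr M sample_space (?Xs l)) B = emeasure (distr M sample_space ?X) B" .
    qed simp
  qed (use int in auto)
qed

context censored_sample
begin

text \<open>
The target and the estimator are the truncated hazards of expectations and of averages of the path functionals. The
identity of the scaling processes with the functional is required almost surely for the copies.
\<close>

lemma cum_rate_consistent:
  assumes h: "path_functional h b" and \<theta>: "0 \<le> \<theta>" and \<epsilon>: "0 < \<epsilon>"
    and H: "\<And>t \<omega>. \<omega> \<in> space M \<Longrightarrow> H t \<omega> = h t (fst (X \<omega>))"
    and Hs: "AE \<omega> in M. \<forall>l\<ge>1. \<forall>t. Hs l t \<omega> = h t (fst (Xs l \<omega>))"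
  defines "\<Lambda> \<equiv> cum_rate M \<epsilon> H (\<lambda>\<omega>. fst (X \<omega>)) (\<lambda>\<omega>. snd (X \<omega>))"
    and "\<Lambda>_hat \<equiv> \<lambda>n \<omega>. cum_rate_hat n \<epsilon> Hs (\<lambda>l \<omega>. fst (Xs l \<omega>)) (\<lambda>l \<omega>. snd (Xs l \<omega>)) \<omega>"
  shows "j \<noteq> k \<Longrightarrow> integrator (\<Lambda> j k)"
    and "AE \<omega> in M. \<forall>j k. j \<noteq> k \<longrightarrow> (\<forall>n. integrator (\<Lambda>_hat n \<omega> j k)) \<and>
      uniform_limit {0..\<theta>} (\<lambda>n. \<Lambda>_hat n \<omega> j k) (\<Lambda> j k) sequentially"
proof -
  have p_eq: "p_occ M H (\<lambda>\<omega>. fst (X \<omega>)) (\<lambda>\<omega>. snd (X \<omega>)) j = mean_occ h j" for j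
    unfolding p_occ_def mean_occ_def occ_def
    by (intro ext Bochner_Integration.integral_cong) (auto simp: H)
  have q_eq: "p_trans M H (\<lambda>\<omega>. fst (X \<omega>)) (\<lambda>\<omega>. snd (X \<omega>)) j k = mean_trans h j k" for j k
    unfolding p_trans_def mean_trans_def transitions_def
    by (intro ext Bochner_Integration.integral_cong) (auto simp: H)
  have \<Lambda>: "\<Lambda> j k = trunc_hazard \<epsilon> (mean_occ h j) (mean_trans h j k)" for j k
    unfolding \<Lambda>_def cum_rate_def p_eq q_eq ..
  show "integrator (\<Lambda> j k)" if "j \<noteq> k" for j k
    unfolding \<Lambda> by (rule trunc_hazard_integrator[OF mean_trans_integrator[OF h that] mean_occ_dominated_increments[OF h] \<epsilon>])
  have "AE \<omega> in M. \<forall>j k. j \<noteq> k \<longrightarrow>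
      uniform_limit {0..\<theta>} (\<lambda>n. trunc_hazard \<epsilon> (avg_occ h n \<omega> j) (avg_trans h n \<omega> j k)) (\<Lambda> j k) sequentially"
    unfolding \<Lambda> by (intro AE_all_countable[THEN iffD2] allI AE_impI trunc_hazard_consistent[OF h _ \<theta> \<epsilon>])
  then show "AE \<omega> in M. \<forall>j k. j \<noteq> k \<longrightarrow> (\<forall>n. integrator (\<Lambda>_hat n \<omega> j k)) \<and>
      uniform_limit {0..\<theta>} (\<lambda>n. \<Lambda>_hat n \<omega> j k) (\<Lambda> j k) sequentially"
    using Hs AE_space
  proof eventually_elim
    case (elim \<omega>)
    have I_eq: "I_occ n Hs (\<lambda>l \<omega>. fst (Xs l \<omega>)) (\<lambda>l \<omega>. snd (Xs l \<omega>)) \<omega> j = avg_occ h n \<omega> j" for n j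
      unfolding I_occ_def avg_occ_def occ_def using elim(2) by (auto intro!: ext sum.cong)
    have N_eq: "N_trans n Hs (\<lambda>l \<omega>. fst (Xs l \<omega>)) (\<lambda>l \<omega>. snd (Xs l \<omega>)) \<omega> j k = avg_trans h n \<omega> j k" for n j k
      unfolding N_trans_def avg_trans_def transitions_def using elim(2) by (auto intro!: ext sum.cong)
    have hat: "\<Lambda>_hat n \<omega> j k = trunc_hazard \<epsilon> (avg_occ h n \<omega> j) (avg_trans h n \<omega> j k)" for n j k
      unfolding \<Lambda>_hat_def cum_rate_hat_def I_eq N_eq ..
    show ?case
      unfolding hat using elim(1,3)
      by (auto intro!: trunc_hazard_integrator avg_trans_integrator[OF h] avg_occ_dominated_increments[OF h] \<epsilon>)
  qed
qed

end

theorem theorem5p2: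
  fixes M :: "'a measure" and F :: "real \<Rightarrow> 'a measure"
    and Z :: "'a \<Rightarrow> real \<Rightarrow> 'j::finite" and z0 :: 'j and J0 J1 :: "'j set"
    and \<rho> :: "real \<Rightarrow> 'j \<Rightarrow> 'j \<Rightarrow> 'a \<Rightarrow> real"
    and R :: "'a \<Rightarrow> real" and \<theta> \<epsilon> :: real
    and Zs :: "nat \<Rightarrow> 'a \<Rightarrow> real \<Rightarrow> 'j" and Rs :: "nat \<Rightarrow> 'a \<Rightarrow> real"
    and \<rho>s :: "nat \<Rightarrow> real \<Rightarrow> 'j \<Rightarrow> 'j \<Rightarrow> 'a \<Rightarrow> real"
  defines "H \<equiv> scaling J1 \<rho> Z"
    and "Hs \<equiv> (\<lambda>l. scaling J1 (\<rho>s l) (Zs l))"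
  assumes prob: "prob_space M"
    and filtration: "filtration (space M) F" "\<And>t. sets (F t) \<subseteq> sets M"
    and adapted: "\<And>t. 0 \<le> t \<Longrightarrow> (\<lambda>\<omega>. Z \<omega> t) \<in> F t \<rightarrow>\<^sub>M count_space UNIV"
    and jump: "\<And>\<omega>. \<omega> \<in> space M \<Longrightarrow> jump_path (Z \<omega>)"
    and initial: "\<And>\<omega>. \<omega> \<in> space M \<Longrightarrow> Z \<omega> 0 = z0"
    and finite_mean: "\<And>t j k. 0 \<le> t \<Longrightarrow> j \<noteq> k \<Longrightarrow> integrable M (\<lambda>\<omega>. jump_count (Z \<omega>) j k t)"
    and states: "J0 \<union> J1 = UNIV" "J0 \<inter> J1 = {}" "z0 \<in> J0"
    and no_return: "\<And>s t. 0 \<le> t \<Longrightarrow> t \<le> s \<Longrightarrow>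
          measure M {\<omega> \<in> space M. Z \<omega> t \<in> J1 \<and> Z \<omega> s \<in> J0} = 0"
    and rho_predictable: "\<And>j k. predictable (space M) (natural_filtration (space M) Z) (\<lambda>t. \<rho> t j k)"
    and rho_nonneg: "\<And>t j k \<omega>. 0 \<le> t \<Longrightarrow> \<omega> \<in> space M \<Longrightarrow> 0 \<le> \<rho> t j k \<omega>"
    and rho_bounded: "\<And>T. \<exists>C. \<forall>t\<in>{0..T}. \<forall>j k. \<forall>\<omega>\<in>space M. \<rho> t j k \<omega> \<le> C"
    and standing: "finite_cum_rates M H Z" "finite_cum_rates M unit_scaling Z"
    and R_measurable: "R \<in> borel_measurable M"
    and R_pos: "\<And>\<omega>. \<omega> \<in> space M \<Longrightarrow> 0 < R \<omega>"
    and R_indep: "prob_space.indep_set M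
          (sets (state_algebra (space M) Z {0..})) (sets (vimage_algebra (space M) R borel))"
    and theta: "0 \<le> \<theta>" "ereal \<theta> < support_right_end M R"
    and copies_jump: "\<And>l \<omega>. 1 \<le> l \<Longrightarrow> \<omega> \<in> space M \<Longrightarrow> jump_path (Zs l \<omega>)"
    and copies_indep: "prob_space.indep_vars M (\<lambda>_. path_space \<Otimes>\<^sub>M borel)
          (\<lambda>l \<omega>. (Zs l \<omega>, Rs l \<omega>)) {1..}"
    and copies_distr: "\<And>l. 1 \<le> l \<Longrightarrow>
          distr M (path_space \<Otimes>\<^sub>M borel) (\<lambda>\<omega>. (Zs l \<omega>, Rs l \<omega>)) =
          distr M (path_space \<Otimes>\<^sub>M borel) (\<lambda>\<omega>. (Z \<omega>, R \<omega>))"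
    and versions: "corresponding_versions (space M) Z \<rho> Zs \<rho>s"
    and eps: "0 < \<epsilon>"
  shows "(\<forall>j k. j \<noteq> k \<longrightarrow>
            (AE \<omega> in M. (\<lambda>n. SUP t\<in>{0..\<theta>}.
               ereal \<bar>cum_rate_hat n \<epsilon> Hs Zs Rs \<omega> j k t - cum_rate M \<epsilon> H Z R j k t\<bar>) \<longlonglongrightarrow> 0)) \<and>
         (\<forall>j.
            (AE \<omega> in M. (\<lambda>n. SUP t\<in>{0..\<theta>}.
               ereal \<bar>p_eps_hat n J0 z0 \<epsilon> Hs Zs Rs \<omega> j t - p_eps M J0 z0 \<epsilon> H Z R j t\<bar>) \<longlonglongrightarrow> 0))"
proof -
  interpret prob_space M by (rule prob)
  obtain g :: "real \<Rightarrow> 'j \<Rightarrow> 'j \<Rightarrow> (real \<Rightarrow> 'j) \<Rightarrow> real"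
    where g: "\<And>j k. predictable UNIV (natural_filtration UNIV (\<lambda>z. z)) (\<lambda>t. g t j k)"
      and \<rho>_g: "\<And>t j k \<omega>. 0 \<le> t \<Longrightarrow> \<omega> \<in> space M \<Longrightarrow> \<rho> t j k \<omega> = g t j k (Z \<omega>)"
      and \<rho>s_g: "\<And>l t j k \<omega>. 1 \<le> l \<Longrightarrow> 0 \<le> t \<Longrightarrow> \<omega> \<in> space M \<Longrightarrow> \<rho>s l t j k \<omega> = g t j k (Zs l \<omega>)"
  proof -
    from versions obtain g where
      "\<forall>j k. predictable UNIV (natural_filtration UNIV (\<lambda>z. z)) (\<lambda>t. g t j k)"
      "\<forall>t\<ge>0. \<forall>j k. \<forall>\<omega>\<in>space M. \<rho> t j k \<omega> = g t j k (Z \<omega>)"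
      "\<forall>l\<ge>1. \<forall>t\<ge>0. \<forall>j k. \<forall>\<omega>\<in>space M. \<rho>s l t j k \<omega> = g t j k (Zs l \<omega>)"
      unfolding corresponding_versions_def by (elim exE conjE)
    then show ?thesis by (intro that[of g]) simp_all
  qed
  obtain C where C: "\<And>T t j k \<omega>. t \<in> {0..T} \<Longrightarrow> \<omega> \<in> space M \<Longrightarrow> \<rho> t j k \<omega> \<le> C T"
  proof -
    from rho_bounded have "\<forall>T. \<exists>C. \<forall>t\<in>{0..T}. \<forall>j k. \<forall>\<omega>\<in>space M. \<rho> t j k \<omega> \<le> C" by blast
    then obtain C where "\<forall>T. \<forall>t\<in>{0..T}. \<forall>j k. \<forall>\<omega>\<in>space M. \<rho> t j k \<omega> \<le> C T"
      by (rule choice[THEN exE])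
    then show ?thesis by (intro that[of C]) blast
  qed
  define c where "c i = \<bar>C (real i)\<bar>" for i :: nat
  have Z_meas: "(\<lambda>\<omega>. Z \<omega> t) \<in> M \<rightarrow>\<^sub>M count_space UNIV" if "0 \<le> t" for t
  proof (rule measurableI)
    fix A :: "'j set"
    have "space (F t) = space M" using filtration(1) by (simp add: filtration_def)
    then have "(\<lambda>\<omega>. Z \<omega> t) -` A \<inter> space M \<in> sets (F t)"
      using measurable_sets[OF adapted[OF that], of A] by simp
    then show "(\<lambda>\<omega>. Z \<omega> t) -` A \<inter> space M \<in> sets M" using filtration(2) by blast
  qed simp
  interpret censored_sample M "\<lambda>\<omega>. (Z \<omega>, R \<omega>)" "\<lambda>l \<omega>. (Zs l \<omega>, Rs l \<omega>)"
    by (rule censored_sampleI[OF Z_meas jump finite_mean R_measurable copies_jump copies_indep copies_distr])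
  define h where "h = path_scaling g c J1"
  have h: "path_functional h (\<lambda>t. 1 + (\<Sum>i\<le>nat \<lceil>t\<rceil>. \<bar>c i\<bar>))"
    unfolding h_def by (rule path_scaling_functional[OF g])
  \<comment> \<open>The bounds that hold on the paths of \<open>Z\<close>. They describe a measurable set, hence hold for the copies almost surely.\<close>
  define good where "good x \<longleftrightarrow> fst x 0 = z0 \<and> 0 \<le> entry_value g J1 (fst x)
    \<and> entry_value g J1 (fst x) \<le> c (nat \<lceil>entry_time J1 (fst x)\<rceil>)" for x :: "(real \<Rightarrow> 'j) \<times> real"
  have good_scaling: "g u (left_state z u) (z u) z ^ (of_bool (hitting_time J1 z \<le> ereal t) :: nat) = h t z"
    if "jump_path z" "good (z, r)" "u = real_of_ereal (hitting_time J1 z)" for z r t u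
    unfolding h_def \<open>u = _\<close> using that(1,2) states(2,3) by (intro path_scaling_eq) (auto simp: good_def)
  have good_Z: "good (Z \<omega>, R \<omega>)" if \<omega>: "\<omega> \<in> space M" for \<omega>
  proof -
    let ?u = "entry_time J1 (Z \<omega>)"
    have u: "0 \<le> ?u" "?u \<in> {0..real (nat \<lceil>?u\<rceil>)}"
      using entry_time_nonneg[of J1 "Z \<omega>"] by auto
    have "0 \<le> g ?u j k (Z \<omega>) \<and> g ?u j k (Z \<omega>) \<le> c (nat \<lceil>?u\<rceil>)" for j k
      using rho_nonneg[OF u(1) \<omega>, of j k] C[OF u(2) \<omega>, of j k] unfolding \<rho>_g[OF u(1) \<omega>] c_def by simp
    moreover have "0 \<le> c i" for i by (simp add: c_def)
    ultimately show ?thesis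
      using initial[OF \<omega>] by (auto simp: good_def entry_value_def Let_def of_bool_def)
  qed
  have "{x \<in> space sample_space. good x} \<in> sets sample_space"
  proof -
    have [measurable]: "(\<lambda>x. fst x 0) \<in> sample_space \<rightarrow>\<^sub>M count_space (UNIV :: 'j set)"
      by (rule measurable_compose[OF measurable_fst_sample measurable_coordinate]) simp
    have [measurable]: "(\<lambda>x. entry_value g J1 (fst x)) \<in> borel_measurable sample_space"
      by (rule measurable_compose[OF measurable_fst_sample measurable_entry_value[OF g]])
    have [measurable]: "(\<lambda>x. c (nat \<lceil>entry_time J1 (fst x)\<rceil>)) \<in> borel_measurable (sample_space :: ((real \<Rightarrow> 'j) \<times> real) measure)"
    proof (rule measurable_compose[of "\<lambda>x. nat \<lceil>entry_time J1 (fst x)\<rceil>" _ "count_space UNIV"])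
      have [measurable]: "(\<lambda>x. entry_time J1 (fst x)) \<in> borel_measurable (sample_space :: ((real \<Rightarrow> 'j) \<times> real) measure)"
        by (rule measurable_compose[OF measurable_fst_sample measurable_entry_time])
      show "(\<lambda>x. nat \<lceil>entry_time J1 (fst x)\<rceil>) \<in> (sample_space :: ((real \<Rightarrow> 'j) \<times> real) measure) \<rightarrow>\<^sub>M count_space UNIV"
        by measurable
    qed simp
    show ?thesis unfolding good_def by measurable
  qed
  then have good_copies: "AE \<omega> in M. \<forall>l\<ge>1. good (Zs l \<omega>, Rs l \<omega>)"
    by (rule AE_sample) (rule good_Z)
  have H: "H t \<omega> = h t (fst (Z \<omega>, R \<omega>))" if "\<omega> \<in> space M" for t \<omega>
    using good_scaling[OF jump[OF that] good_Z[OF that] refl, of t] entry_time_nonneg[of J1 "Z \<omega>"]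
    by (simp add: H_def scaling_def Let_def \<rho>_g[OF _ that] entry_time_def)
  have Hs: "AE \<omega> in M. \<forall>l\<ge>1. \<forall>t. Hs l t \<omega> = h t (fst (Zs l \<omega>, Rs l \<omega>))"
    using good_copies AE_space
  proof eventually_elim
    case (elim \<omega>)
    show ?case
    proof (intro allI impI)
      fix l :: nat and t assume l: "1 \<le> l"
      then have "good (Zs l \<omega>, Rs l \<omega>)" using elim(1) by blast
      from good_scaling[OF copies_jump[OF l elim(2)] this refl, of t]
      show "Hs l t \<omega> = h t (fst (Zs l \<omega>, Rs l \<omega>))"
        using entry_time_nonneg[of J1 "Zs l \<omega>"]
        by (simp add: Hs_def scaling_def Let_def \<rho>s_g[OF l _ elim(2)] entry_time_def)
    qed
  qed
  let ?\<Lambda> = "cum_rate M \<epsilon> H Z R" and ?\<Lambda>1 = "cum_rate M \<epsilon> unit_scaling Z R"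
  let ?\<Lambda>_hat = "\<lambda>n \<omega>. cum_rate_hat n \<epsilon> Hs Zs Rs \<omega>"
  let ?\<Lambda>1_hat = "\<lambda>n \<omega>. cum_rate_hat n \<epsilon> (\<lambda>_. unit_scaling) Zs Rs \<omega>"
  have rate: "\<And>j k. j \<noteq> k \<Longrightarrow> integrator (?\<Lambda> j k)"
    "AE \<omega> in M. \<forall>j k. j \<noteq> k \<longrightarrow> (\<forall>n. integrator (?\<Lambda>_hat n \<omega> j k)) \<and>
      uniform_limit {0..\<theta>} (\<lambda>n. ?\<Lambda>_hat n \<omega> j k) (?\<Lambda> j k) sequentially"
    using cum_rate_consistent[OF h theta(1) eps H Hs] unfolding fst_conv snd_conv by blast+
  have rate1: "\<And>j k. j \<noteq> k \<Longrightarrow> integrator (?\<Lambda>1 j k)"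
    "AE \<omega> in M. \<forall>j k. j \<noteq> k \<longrightarrow> (\<forall>n. integrator (?\<Lambda>1_hat n \<omega> j k)) \<and>
      uniform_limit {0..\<theta>} (\<lambda>n. ?\<Lambda>1_hat n \<omega> j k) (?\<Lambda>1 j k) sequentially"
    using cum_rate_consistent[where H = unit_scaling and Hs = "\<lambda>_. unit_scaling",
        OF path_functional_1 theta(1) eps]
    unfolding fst_conv snd_conv unit_scaling_def by simp_all
  show ?thesis
  proof (intro conjI allI impI)
    fix j k :: 'j assume jk: "j \<noteq> k"
    show "AE \<omega> in M. (\<lambda>n. SUP t\<in>{0..\<theta>}. ereal \<bar>?\<Lambda>_hat n \<omega> j k t - ?\<Lambda> j k t\<bar>) \<longlonglongrightarrow> 0"
      using rate(2)
    proof eventually_elim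
      case (elim \<omega>)
      then have "uniform_limit {0..\<theta>} (\<lambda>n. ?\<Lambda>_hat n \<omega> j k) (?\<Lambda> j k) sequentially" using jk by blast
      then show ?case by (rule uniform_limit_SUP[OF _ theta(1)])
    qed
  next
    fix j
    show "AE \<omega> in M. (\<lambda>n. SUP t\<in>{0..\<theta>}.
       ereal \<bar>p_eps_hat n J0 z0 \<epsilon> Hs Zs Rs \<omega> j t - p_eps M J0 z0 \<epsilon> H Z R j t\<bar>) \<longlonglongrightarrow> 0"
      using rate(2) rate1(2)
    proof eventually_elim
      case (elim \<omega>)
      show ?case
        unfolding p_eps_def p_eps_hat_def
      proof (rule uniform_limit_SUP[OF product_integral_uniform_limit theta(1)])
        show "integrator (?\<Lambda> i k)" "integrator (?\<Lambda>1 i k)" if "i \<noteq> k" for i k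
          by (fact rate(1)[OF that] rate1(1)[OF that])+
        show "integrator (?\<Lambda>_hat n \<omega> i k)" "integrator (?\<Lambda>1_hat n \<omega> i k)"
          "uniform_limit {0..\<theta>} (\<lambda>n. ?\<Lambda>_hat n \<omega> i k) (?\<Lambda> i k) sequentially"
          "uniform_limit {0..\<theta>} (\<lambda>n. ?\<Lambda>1_hat n \<omega> i k) (?\<Lambda>1 i k) sequentially" if "i \<noteq> k" for n i k
          using elim that by blast+
      qed (rule theta(1))
    qed
  qed
qed

end
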